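(* Let $X$ be a Banach space and let $\Omega$ be a compact Hausdorff space. Let $1\leq p\leq\infty$. The following statements are equivalent. (a) For every Banach space $Y$ and for every operator $S\in\mathcal{L}(\mathcal{C}(\Omega),\mathcal{L}(X,Y))$, there exists $U\in\mathcal{L}(\mathcal{C}_{p}(\Omega,X),Y)$ such that $U^{\#}=S$. (b) There exists a Banach space $Y\neq\{0\}$ such that for every operator $S\in\mathcal{L}(\mathcal{C}(\Omega),\mathcal{L}(X,Y))$, there exists $U\in\mathcal{L}(\mathcal{C}_{p}(\Omega,X),Y)$ such that $U^{\#}=S$. (c) $\mathcal{L}(\mathcal{C}(\Omega),X^{*})=\mathcal{P}_{p'}(\mathcal{C}(\Omega),X^{*})$ as sets. (d) The tensor norms $d_{p}$ and $\pi$ are equivalent on $\mathcal{C}(\Omega)\otimes X$.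
   Context: All Banach spaces are over the same field $\mathbb{K}$ ($\mathbb{R}$ or $\mathbb{C}$); $\mathcal{L}(X,Y)$ is the Banach space of bounded linear operators; $p'$ is the conjugate index, $1/p+1/p'=1$ with $1/\infty=0$. $\mathcal{C}(\Omega)$ and $\mathcal{C}(\Omega,X)$ are the spaces of continuous $\mathbb{K}$-valued and $X$-valued functions on $\Omega$ with the supremum norm. $\mathcal{C}_p(\Omega,X)$, the Banach space of $p$-continuous $X$-valued functions, consists of all $f\in\mathcal{C}(\Omega,X)$ for which there is a sequence $(x_n)\in\ell_p(X)$ (or $(x_n)\in c_0(X)$ when $p=\infty$) with $f(\Omega)\subset\{\sum_n\alpha_nx_n:(\alpha_n)\in B_{\ell_{p'}}\}$, where $B_{\ell_{p'}}$ is the closed unit ball of $\ell_{p'}$; its norm is $\|f\|_{\mathcal{C}_p(\Omega,X)}=\inf\|(x_n)\|_p$ over all such sequences. For $\varphi\in\mathcal{C}(\Omega)$, $x\in X$, $\varphi x$ denotes the function $\omega\mapsto\varphi(\omega)x$. It is known that $\mathcal{C}_p(\Omega,X)=\mathcal{C}(\Omega)\hat{\otimes}_{d_p}X$ as Banach spaces via $\varphi x\leftrightarrow\varphi\otimes x$, and $\mathcal{C}_\infty(\Omega,X)=\mathcal{C}(\Omega,X)$. For $U\in\mathcal{L}(\mathcal{C}_p(\Omega,X),Y)$, the associated operator $U^{\#}\in\mathcal{L}(\mathcal{C}(\Omega),\mathcal{L}(X,Y))$ is $(U^{\#}\varphi)x=U(\varphi x)$. $\mathcal{P}_q$ ($1\le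 q\le\infty$) is the Banach operator ideal of absolutely $q$-summing operators, with $\mathcal{P}_\infty=\mathcal{L}$. $\pi$ is the projective tensor norm. $d_p$ is the right Chevet--Saphar tensor norm: for $u\in Z\otimes X$, $d_p(u)=\inf\{\|(z_i)\|_{p'}^w\,\|(x_i)\|_p: u=\sum_{i=1}^n z_i\otimes x_i\}$, where $\|(x_i)\|_p=(\sum\|x_i\|^p)^{1/p}$ and $\|(z_i)\|_{q}^w=\sup_{z^*\in B_{Z^*}}(\sum|z^*(z_i)|^{q})^{1/q}$ (usual suprema for the index $\infty$). *)

theory Defs
  imports "HOL-Analysis.Analysis" "HOL-Algebra.Module"
begin

subsection \<open>Scalars\<close>

text \<open>Up to isometric isomorphism, the types of the following class are exactly the fields of
  real and of complex numbers.\<close>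

class rc_field = real_normed_field +
  assumes real_or_complex:
    "(\<forall>z. \<exists>a. z = a *\<^sub>R 1) \<or>
     (\<exists>i. i * i = - 1 \<and>
        (\<forall>z. \<exists>a b. z = a *\<^sub>R 1 + b *\<^sub>R i) \<and>
        (\<forall>a b. norm (a *\<^sub>R 1 + b *\<^sub>R i) = sqrt (a\<^sup>2 + b\<^sup>2)))"

instance real :: rc_field
  by standard simp

instance complex :: rc_field
proof
  have "\<exists>i::complex. i * i = - 1 \<and>
        (\<forall>z. \<exists>a b. z = a *\<^sub>R 1 + b *\<^sub>R i) \<and>
        (\<forall>a b. norm (a *\<^sub>R 1 + b *\<^sub>R i) = sqrt (a\<^sup>2 + b\<^sup>2))"
  proof (intro exI[of _ \<i>] conjI allI)
    fix z :: complex
    show "\<exists>a b. z = a *\<^sub>R 1 + b *\<^sub>R \<i>"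
      by (intro exI[of _ "Re z"] exI[of _ "Im z"]) (simp add: complex_eq_iff)
  qed (simp_all add: cmod_def)
  then show "(\<forall>z::complex. \<exists>a. z = a *\<^sub>R 1) \<or>
     (\<exists>i::complex. i * i = - 1 \<and>
        (\<forall>z. \<exists>a b. z = a *\<^sub>R 1 + b *\<^sub>R i) \<and>
        (\<forall>a b. norm (a *\<^sub>R 1 + b *\<^sub>R i) = sqrt (a\<^sup>2 + b\<^sup>2)))"
    by blast
qed


subsection \<open>Banach spaces\<close>

text \<open>Normed spaces live on carrier sets, so that one can quantify over all Banach spaces inside
  a formula: ``every Banach space'' becomes every \<open>('k, 'u) nspace\<close> that is a Banach space,
  where \<open>'u\<close> is an arbitrary type large enough to carry the scalar field. As usual for modules in HOL-Algebra, the fields \<open>mult\<close> and \<open>one\<close> of the underlying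
  record carry no meaning.\<close>

record ('k, 'v) nspace = "('k, 'v) module" +
  vnorm :: "'v \<Rightarrow> real"

definition scalars :: "('k::rc_field, 'k) nspace" where
  "scalars = \<lparr>carrier = UNIV, mult = (*), one = 1, zero = 0, add = (+), smult = (*), vnorm = norm\<rparr>"

locale normed_space = Module.module scalars V
  for V :: "('k::rc_field, 'v) nspace" (structure) +
  assumes vnorm_eq_0: "x \<in> carrier V \<Longrightarrow> vnorm V x = 0 \<longleftrightarrow> x = \<zero>"
    and vnorm_smult: "x \<in> carrier V \<Longrightarrow> vnorm V (c \<odot> x) = norm c * vnorm V x"
    and vnorm_triangle:
      "\<lbrakk>x \<in> carrier V; y \<in> carrier V\<rbrakk> \<Longrightarrow> vnorm V (x \<oplus> y) \<le> vnorm V x + vnorm V y"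

text \<open>\<^locale>\<open>Metric_space\<close> requires nonnegativity and symmetry also off the carrier; hence the
  case distinction.\<close>

definition vdist :: "('k, 'v) nspace \<Rightarrow> 'v \<Rightarrow> 'v \<Rightarrow> real" where
  "vdist V x y =
    (if x \<in> carrier V \<and> y \<in> carrier V then vnorm V (x \<ominus>\<^bsub>V\<^esub> y) else 0)"

abbreviation vtopology :: "('k, 'v) nspace \<Rightarrow> 'v topology" where
  "vtopology V \<equiv> Metric_space.mtopology (carrier V) (vdist V)"

locale banach_space = normed_space +
  assumes complete: "Metric_space.mcomplete (carrier V) (vdist V)"


subsection \<open>Spaces of functions\<close>

text \<open>The pointwise operations on a set \<open>F\<close> of functions from \<open>D\<close> to \<open>W\<close>. Functions are
  extensional, i.e. \<^term>\<open>undefined\<close> outside \<open>D\<close>, so that they are determined by their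
  values on \<open>D\<close>.\<close>

definition fun_space ::
    "'d set \<Rightarrow> ('k, 'w) nspace \<Rightarrow> ('d \<Rightarrow> 'w) set \<Rightarrow> (('d \<Rightarrow> 'w) \<Rightarrow> real)
      \<Rightarrow> ('k, 'd \<Rightarrow> 'w) nspace" where
  "fun_space D W F N =
    \<lparr>carrier = F, mult = undefined, one = undefined,
     zero = (\<lambda>t\<in>D. \<zero>\<^bsub>W\<^esub>),
     add = (\<lambda>f g. \<lambda>t\<in>D. f t \<oplus>\<^bsub>W\<^esub> g t),
     smult = (\<lambda>c f. \<lambda>t\<in>D. c \<odot>\<^bsub>W\<^esub> f t),
     vnorm = N\<rparr>"

definition linear_maps :: "('k, 'v) nspace \<Rightarrow> ('k, 'w) nspace \<Rightarrow> ('v \<Rightarrow> 'w) set" where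
  "linear_maps V W =
    {T \<in> carrier V \<rightarrow>\<^sub>E carrier W.
      (\<forall>x\<in>carrier V. \<forall>y\<in>carrier V. T (x \<oplus>\<^bsub>V\<^esub> y) = T x \<oplus>\<^bsub>W\<^esub> T y) \<and>
      (\<forall>c. \<forall>x\<in>carrier V. T (c \<odot>\<^bsub>V\<^esub> x) = c \<odot>\<^bsub>W\<^esub> T x)}"

definition bounded_ops :: "('k, 'v) nspace \<Rightarrow> ('k, 'w) nspace \<Rightarrow> ('v \<Rightarrow> 'w) set" where
  "bounded_ops V W =
    {T \<in> linear_maps V W. \<exists>C. \<forall>x\<in>carrier V. vnorm W (T x) \<le> C * vnorm V x}"

definition unit_ball :: "('k, 'v) nspace \<Rightarrow> 'v set" where
  "unit_ball V = {x \<in> carrier V. vnorm V x \<le> 1}"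

definition op_space :: "('k, 'v) nspace \<Rightarrow> ('k, 'w) nspace \<Rightarrow> ('k, 'v \<Rightarrow> 'w) nspace" where
  "op_space V W =
    fun_space (carrier V) W (bounded_ops V W) (\<lambda>T. SUP x\<in>unit_ball V. vnorm W (T x))"

definition dual :: "('k::rc_field, 'v) nspace \<Rightarrow> ('k, 'v \<Rightarrow> 'k) nspace" where
  "dual V = op_space V scalars"

text \<open>The supremum norm; \<open>insert 0\<close> only matters for the empty space.\<close>

definition cont_space :: "'t topology \<Rightarrow> ('k, 'v) nspace \<Rightarrow> ('k, 't \<Rightarrow> 'v) nspace" where
  "cont_space \<Omega> X =
    fun_space (topspace \<Omega>) X
      {f \<in> extensional (topspace \<Omega>). continuous_map \<Omega> (vtopology X) f}
      (\<lambda>f. Sup (insert 0 ((\<lambda>\<omega>. vnorm X (f \<omega>)) ` topspace \<Omega>)))"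

abbreviation scalar_cont_space :: "'t topology \<Rightarrow> ('k::rc_field, 't \<Rightarrow> 'k) nspace" where
  "scalar_cont_space \<Omega> \<equiv> cont_space \<Omega> scalars"


subsection \<open>Conjugate indices and sequence spaces\<close>

definition conj_index :: "ennreal \<Rightarrow> ennreal" where
  "conj_index p = inverse (1 - inverse p)"

lemma conj_index:
  assumes "1 \<le> p"
  shows "inverse p + inverse (conj_index p) = 1"
proof (cases p)
  case (real r)
  then have "1 \<le> r"
    using assms by (metis ennreal_1 ennreal_le_iff2 not_one_le_zero order_trans zero_le_one)
  then have p: "inverse p = ennreal (inverse r)" and r: "inverse r \<le> 1"
    using real by (simp_all add: inverse_ennreal inverse_le_1_iff)
  have "1 - inverse p = ennreal (1 - inverse r)"
    using p \<open>1 \<le> r\<close> by (metis ennreal_1 ennreal_minus inverse_nonnegative_iff_nonnegative real(1))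
  moreover have "inverse (inverse (ennreal t)) = ennreal t" if "0 \<le> t" for t
    using that by (cases "t = 0") (simp_all add: inverse_ennreal)
  ultimately show ?thesis
    using p r \<open>1 \<le> r\<close> by (simp add: conj_index_def flip: ennreal_plus)
next
  case top
  then show ?thesis
    by (simp add: conj_index_def)
qed

definition lp_seq :: "ennreal \<Rightarrow> (nat \<Rightarrow> real) \<Rightarrow> bool" where
  "lp_seq p a \<longleftrightarrow>
    (if p = \<infinity> then bounded (range a) else summable (\<lambda>n. \<bar>a n\<bar> powr enn2real p))"

definition lp_norm :: "ennreal \<Rightarrow> (nat \<Rightarrow> real) \<Rightarrow> real" where
  "lp_norm p a =
    (if p = \<infinity> then (SUP n. \<bar>a n\<bar>)
     else (\<Sum>n. \<bar>a n\<bar> powr enn2real p) powr (1 / enn2real p))"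

text \<open>The norm of a finite family \<open>a 0, \<dots>, a (n - 1)\<close>.\<close>

definition lp_norm_fin :: "ennreal \<Rightarrow> nat \<Rightarrow> (nat \<Rightarrow> real) \<Rightarrow> real" where
  "lp_norm_fin p n a = lp_norm p (\<lambda>i. if i < n then a i else 0)"

definition lp_ball :: "ennreal \<Rightarrow> (nat \<Rightarrow> 'k::rc_field) set" where
  "lp_ball q = {\<alpha>. lp_seq q (\<lambda>n. norm (\<alpha> n)) \<and> lp_norm q (\<lambda>n. norm (\<alpha> n)) \<le> 1}"

text \<open>\<open>\<ell>\<^sub>p(X)\<close> for finite \<open>p\<close>, but \<open>c\<^sub>0(X)\<close> for \<open>p = \<infinity>\<close>.\<close>

definition lp_c0_seqs :: "ennreal \<Rightarrow> ('k, 'v) nspace \<Rightarrow> (nat \<Rightarrow> 'v) set" where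
  "lp_c0_seqs p X =
    {x. (\<forall>n. x n \<in> carrier X) \<and>
        (if p = \<infinity> then (\<lambda>n. vnorm X (x n)) \<longlonglongrightarrow> 0
         else lp_seq p (\<lambda>n. vnorm X (x n)))}"


subsection \<open>The space of \<open>p\<close>-continuous functions\<close>

definition p_hull :: "ennreal \<Rightarrow> ('k::rc_field, 'v) nspace \<Rightarrow> (nat \<Rightarrow> 'v) \<Rightarrow> 'v set" where
  "p_hull p X x =
    {y \<in> carrier X. \<exists>\<alpha>\<in>lp_ball (conj_index p).
      limitin (vtopology X) (\<lambda>N. finsum X (\<lambda>n. \<alpha> n \<odot>\<^bsub>X\<^esub> x n) {..<N}) y sequentially}"

definition cp_seqs ::
    "ennreal \<Rightarrow> 't topology \<Rightarrow> ('k::rc_field, 'v) nspace \<Rightarrow> ('t \<Rightarrow> 'v) \<Rightarrow> (nat \<Rightarrow> 'v) set" where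
  "cp_seqs p \<Omega> X f = {x \<in> lp_c0_seqs p X. f ` topspace \<Omega> \<subseteq> p_hull p X x}"

definition cp_space ::
    "ennreal \<Rightarrow> 't topology \<Rightarrow> ('k::rc_field, 'v) nspace \<Rightarrow> ('k, 't \<Rightarrow> 'v) nspace" where
  "cp_space p \<Omega> X =
    fun_space (topspace \<Omega>) X
      {f \<in> carrier (cont_space \<Omega> X). cp_seqs p \<Omega> X f \<noteq> {}}
      (\<lambda>f. INF x\<in>cp_seqs p \<Omega> X f. lp_norm p (\<lambda>n. vnorm X (x n)))"

text \<open>The operator \<open>U\<^sup>#\<close> associated with \<open>U\<close>, where \<open>(U\<^sup># \<phi>) x = U (\<phi> x)\<close>.\<close>

definition assoc_op ::
    "'t topology \<Rightarrow> ('k::rc_field, 'v) nspace \<Rightarrow> (('t \<Rightarrow> 'v) \<Rightarrow> 'y)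
      \<Rightarrow> ('t \<Rightarrow> 'k) \<Rightarrow> 'v \<Rightarrow> 'y" where
  "assoc_op \<Omega> X U =
    (\<lambda>\<phi>\<in>carrier (scalar_cont_space \<Omega>). \<lambda>x\<in>carrier X.
      U (\<lambda>\<omega>\<in>topspace \<Omega>. \<phi> \<omega> \<odot>\<^bsub>X\<^esub> x))"


subsection \<open>Absolutely summing operators\<close>

definition weak_lp_norm ::
    "ennreal \<Rightarrow> ('k::rc_field, 'v) nspace \<Rightarrow> nat \<Rightarrow> (nat \<Rightarrow> 'v) \<Rightarrow> real" where
  "weak_lp_norm q Z n z =
    (SUP f\<in>unit_ball (dual Z). lp_norm_fin q n (\<lambda>i. norm (f (z i))))"

text \<open>By convention, every bounded operator is absolutely \<open>\<infinity>\<close>-summing.\<close>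

definition summing_ops ::
    "ennreal \<Rightarrow> ('k::rc_field, 'v) nspace \<Rightarrow> ('k, 'w) nspace \<Rightarrow> ('v \<Rightarrow> 'w) set" where
  "summing_ops q V W =
    (if q = \<infinity> then bounded_ops V W
     else {T \<in> bounded_ops V W. \<exists>C. \<forall>n v. (\<forall>i<n. v i \<in> carrier V) \<longrightarrow>
        lp_norm_fin q n (\<lambda>i. vnorm W (T (v i))) \<le> C * weak_lp_norm q V n v})"


subsection \<open>Tensor products\<close>

text \<open>The algebraic tensor product \<open>Z \<otimes> X\<close>, realised as usual as a space of functionals on the
  (not necessarily bounded) bilinear forms on \<open>Z \<times> X\<close>: the elementary tensor \<open>z \<otimes> x\<close> is
  evaluation at \<open>(z, x)\<close>.\<close>

definition bilinear_forms ::
    "('k::rc_field, 'z) nspace \<Rightarrow> ('k, 'v) nspace \<Rightarrow> ('z \<Rightarrow> 'v \<Rightarrow> 'k) set" where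
  "bilinear_forms Z X =
    {A. (\<forall>x\<in>carrier X. (\<lambda>z\<in>carrier Z. A z x) \<in> linear_maps Z scalars) \<and>
        (\<forall>z\<in>carrier Z. (\<lambda>x\<in>carrier X. A z x) \<in> linear_maps X scalars)}"

definition tensor_sum ::
    "('k::rc_field, 'z) nspace \<Rightarrow> ('k, 'v) nspace \<Rightarrow> nat \<Rightarrow> (nat \<Rightarrow> 'z) \<Rightarrow> (nat \<Rightarrow> 'v)
      \<Rightarrow> ('z \<Rightarrow> 'v \<Rightarrow> 'k) \<Rightarrow> 'k" where
  "tensor_sum Z X n z x = (\<lambda>A\<in>bilinear_forms Z X. \<Sum>i<n. A (z i) (x i))"

definition tensor_reps ::
    "('k::rc_field, 'z) nspace \<Rightarrow> ('k, 'v) nspace \<Rightarrow> (('z \<Rightarrow> 'v \<Rightarrow> 'k) \<Rightarrow> 'k)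
      \<Rightarrow> (nat \<times> (nat \<Rightarrow> 'z) \<times> (nat \<Rightarrow> 'v)) set" where
  "tensor_reps Z X u =
    {(n, z, x). (\<forall>i<n. z i \<in> carrier Z \<and> x i \<in> carrier X) \<and> u = tensor_sum Z X n z x}"

definition tensor_product ::
    "('k::rc_field, 'z) nspace \<Rightarrow> ('k, 'v) nspace \<Rightarrow> (('z \<Rightarrow> 'v \<Rightarrow> 'k) \<Rightarrow> 'k) set" where
  "tensor_product Z X = {u. tensor_reps Z X u \<noteq> {}}"

definition proj_norm ::
    "('k::rc_field, 'z) nspace \<Rightarrow> ('k, 'v) nspace \<Rightarrow> (('z \<Rightarrow> 'v \<Rightarrow> 'k) \<Rightarrow> 'k) \<Rightarrow> real" where
  "proj_norm Z X u =
    (INF (n, z, x)\<in>tensor_reps Z X u. \<Sum>i<n. vnorm Z (z i) * vnorm X (x i))"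

definition chevet_saphar_norm ::
    "ennreal \<Rightarrow> ('k::rc_field, 'z) nspace \<Rightarrow> ('k, 'v) nspace
      \<Rightarrow> (('z \<Rightarrow> 'v \<Rightarrow> 'k) \<Rightarrow> 'k) \<Rightarrow> real" where
  "chevet_saphar_norm p Z X u =
    (INF (n, z, x)\<in>tensor_reps Z X u.
      weak_lp_norm (conj_index p) Z n z * lp_norm_fin p n (\<lambda>i. vnorm X (x i)))"

definition equivalent_norms_on :: "'a set \<Rightarrow> ('a \<Rightarrow> real) \<Rightarrow> ('a \<Rightarrow> real) \<Rightarrow> bool" where
  "equivalent_norms_on A M N \<longleftrightarrow>
    (\<exists>c>0. \<exists>C>0. \<forall>u\<in>A. c * N u \<le> M u \<and> M u \<le> C * N u)"

end

theory Submission
  imports Defs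
begin

text \<open>A bilinear operator \<open>S\<close> on \<open>\<C>(\<Omega>) \<times> X\<close> is \<open>U\<^sup>#\<close> for some bounded \<open>U\<close> on \<open>\<C>\<^sub>p(\<Omega>, X)\<close> iff
  \<open>\<parallel>\<Sum> S(\<phi>\<^sub>i, x\<^sub>i)\<parallel>\<close> is at most a multiple of \<open>\<parallel>(\<phi>\<^sub>i)\<parallel>\<^sub>p\<^sub>'\<^sup>w \<parallel>(x\<^sub>i)\<parallel>\<^sub>p\<close>. If it is, then
  \<open>U f\<close> is the limit of \<open>\<Sum> S(\<psi>\<^sub>j, f(\<omega>\<^sub>j))\<close> along partitions of unity \<open>\<psi>\<^sub>j\<close> adapted to \<open>f\<close>; the
  sums converge because differences of values of \<open>f\<close> that are small in \<open>X\<close> are small in the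
  gauge of a hull. By duality of \<open>\<ell>\<^sub>p\<close> and \<open>\<ell>\<^sub>p\<^sub>'\<close>, (c) says that all bounded bilinear forms
  satisfy such a bound. A gliding hump argument with norming forms from the Hahn--Banach theorem
  turns this into \<open>\<pi> \<le> C d\<^sub>p\<close>, and that inequality gives the bound for operators with values in any
  Banach space.\<close>

subsection \<open>The scalar field\<close>

text \<open>The norm of \<open>cp_space\<close> dominates the supremum norm, so uniform
  approximation of \<open>f\<close> by functions of finite rank does not by itself make the images
  under \<open>S\<close> converge. What makes the Riemann-type sums converge is a compactness
  property of one fixed hull: coefficient sequences in a ball of \<open>l_q\<close> have
  coordinatewise convergent subsequences, and Hoelder makes the tails of the series uniformly small
  because the generating sequence lies in \<open>l_p\<close>, or in \<open>c_0\<close> when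
  \<open>p = \<infinity>\<close>. The second obstacle is that (c) supplies a constant for each
  bilinear form separately, whereas (d) asks for one constant. If (d) failed, there would be tensors
  whose projective norms exceed \<open>4 ^ k\<close> times their Chevet-Saphar norms; their norming
  forms, summed with weights \<open>(1/3) ^ k\<close> and suitable signs, would give a single
  bounded form without any constant, because \<open>(4/3) ^ k\<close> is unbounded. Finally, (a) and
  (b) range over Banach spaces on prescribed types, so a nonzero space has to be exhibited on each
  of them.\<close>

lemma rc_cases:
  obtains (real) "\<And>z::'k::rc_field. \<exists>a. z = of_real a"
  | (complex) i :: "'k::rc_field" where "i * i = - 1"
      "\<And>z. \<exists>a b. z = of_real a + of_real b * i"
      "\<And>a b. norm (of_real a + of_real b * i) = sqrt (a\<^sup>2 + b\<^sup>2)"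
  using real_or_complex[where 'a='k] by (simp add: scaleR_conv_of_real) blast

lemma exists_unimodular_mult:
  fixes z :: "'k::rc_field"
  shows "\<exists>u. norm u = 1 \<and> u * z = of_real (norm z)"
proof (cases "z = 0")
  case True
  then show ?thesis by (intro exI[of _ 1]) auto
next
  case False
  then show ?thesis
    by (intro exI[of _ "of_real (norm z) / z"]) (auto simp: norm_divide)
qed

text \<open>The closed ball is the continuous image of a real interval or of a Euclidean disc under
  the coordinates from \<open>rc_cases\<close>. Completeness of the field and the extraction of
  coordinatewise limits both rest on this.\<close>

lemma rc_field_compact_cball: "compact (cball (0::'k::rc_field) R)"
proof (cases rule: rc_cases[where 'k='k])
  case real
  have "cball (0::'k) R = of_real ` cball (0::real) R"
  proof (intro equalityI subsetI)
    fix z :: 'k assume z: "z \<in> cball 0 R"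
    obtain a where "z = of_real a" using real by blast
    with z show "z \<in> of_real ` cball (0::real) R" by auto
  qed auto
  moreover have "compact (of_real ` cball (0::real) R :: 'k set)"
    by (intro compact_continuous_image continuous_intros) auto
  ultimately show ?thesis by simp
next
  case (complex i)
  define h where "h = (\<lambda>p. of_real (fst p) + of_real (snd p) * i)"
  have n: "norm (h p) = norm p" for p
    by (cases p) (simp add: h_def complex norm_Pair)
  have "cball (0::'k) R = h ` cball 0 R"
  proof (intro equalityI subsetI)
    fix z :: 'k assume z: "z \<in> cball 0 R"
    obtain a b where "z = of_real a + of_real b * i" using complex(2) by blast
    then have "z = h (a, b)" by (simp add: h_def)
    with z show "z \<in> h ` cball 0 R" by (auto simp: n)
  qed (auto simp: n)
  moreover have "compact (h ` cball 0 R)"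
    unfolding h_def by (intro compact_continuous_image continuous_intros) auto
  ultimately show ?thesis by simp
qed

lemma rc_field_Cauchy_convergent:
  fixes f :: "nat \<Rightarrow> 'k::rc_field"
  assumes "Cauchy f"
  shows "convergent f"
proof -
  obtain R where R: "\<And>n. norm (f n) \<le> R"
    using cauchy_imp_bounded[OF assms] by (auto simp: bounded_iff)
  have "complete (cball (0::'k) R)"
    by (intro compact_imp_complete rc_field_compact_cball)
  then show ?thesis
    unfolding complete_def convergent_def using R assms by fastforce
qed

lemma rc_field_summable:
  fixes f :: "nat \<Rightarrow> 'k::rc_field"
  assumes "summable g" "\<And>n. norm (f n) \<le> g n"
  shows "summable f"
proof -
  have "Cauchy (\<lambda>n. \<Sum>i<n. f i)"
  proof (rule metric_CauchyI)
    fix e :: real assume "e > 0"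
    obtain N where N: "\<And>m n. m \<ge> N \<Longrightarrow> norm (sum g {m..<n}) < e"
      using assms(1) \<open>e > 0\<close> unfolding summable_Cauchy by blast
    have *: "dist (\<Sum>i<m. f i) (\<Sum>i<n. f i) < e" if "m \<ge> N" "m \<le> n" for m n
    proof -
      have "{..<n} = {..<m} \<union> {m..<n}" using that by auto
      then have "(\<Sum>i<n. f i) = (\<Sum>i<m. f i) + sum f {m..<n}"
        by (simp add: sum.union_disjoint[symmetric] ivl_disj_int)
      then have "dist (\<Sum>i<m. f i) (\<Sum>i<n. f i) = norm (sum f {m..<n})"
        by (simp add: dist_norm norm_minus_commute)
      also have "\<dots> \<le> sum g {m..<n}" by (intro sum_norm_le assms)
      also have "\<dots> < e" using N[OF that(1), of n] by simp
      finally show ?thesis .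
    qed
    show "\<exists>M. \<forall>m\<ge>M. \<forall>n\<ge>M. dist (\<Sum>i<m. f i) (\<Sum>i<n. f i) < e"
      by (metis * dist_commute linear)
  qed
  then show ?thesis
    using rc_field_Cauchy_convergent summable_iff_convergent by blast
qed

text \<open>Tychonoff for a countable product of balls; the product is metrizable, so compactness
  yields convergent subsequences. In \<open>p_hull_small_differences\<close> this plays the role of
  weak-star compactness of a dual ball.\<close>

lemma coordinatewise_convergent_subsequence:
  fixes \<gamma> :: "nat \<Rightarrow> nat \<Rightarrow> 'k::rc_field"
  assumes "\<And>k i. norm (\<gamma> k i) \<le> R"
  obtains l r where "strict_mono r" "\<And>i. (\<lambda>k. \<gamma> (r k) i) \<longlonglongrightarrow> l i"
proof -
  let ?K = "PiE UNIV (\<lambda>_::nat. cball (0::'k) R)"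
  have "compactin (product_topology (\<lambda>_::nat. euclidean) UNIV) ?K"
    unfolding compactin_PiE by (auto simp: rc_field_compact_cball)
  then have "compact ?K" by (simp add: euclidean_product_topology)
  then have "seq_compact ?K" by (simp add: compact_eq_seq_compact_metric)
  moreover have "\<forall>k. \<gamma> k \<in> ?K" using assms by auto
  ultimately obtain l r where "l \<in> ?K" and r: "strict_mono r" "(\<gamma> \<circ> r) \<longlonglongrightarrow> l"
    unfolding seq_compact_def by metis
  have "(\<lambda>k. \<gamma> (r k) i) \<longlonglongrightarrow> l i" for i
  proof -
    have "isCont (\<lambda>x::nat \<Rightarrow> 'k. x i) l"
      using continuous_on_eq_continuous_at[OF open_UNIV, of "\<lambda>x::nat \<Rightarrow> 'k. x i"] by simp
    from isCont_tendsto_compose[OF this r(2)] show ?thesis by (simp add: o_def)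
  qed
  with r(1) show thesis by (rule that)
qed

section \<open>The field as a normed space over itself\<close>

lemma scalars_simps [simp]:
  "carrier scalars = UNIV" "mult scalars = (*)" "one scalars = 1" "zero scalars = 0"
  "add scalars = (+)" "smult scalars = (*)" "vnorm scalars = norm"
  by (simp_all add: scalars_def)

lemma cring_scalars: "cring (scalars :: ('k::rc_field, 'k) nspace)"
proof (rule cringI)
  show "abelian_group (scalars :: ('k, 'k) nspace)"
  proof (rule abelian_groupI)
    fix x :: 'k
    show "\<exists>y\<in>carrier scalars. y \<oplus>\<^bsub>scalars\<^esub> x = \<zero>\<^bsub>scalars\<^esub>"
      by (rule bexI[of _ "- x"]) auto
  qed (auto simp: algebra_simps)
  show "Group.comm_monoid (scalars :: ('k, 'k) nspace)"
    by (rule comm_monoidI) (auto simp: algebra_simps)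
qed (auto simp: algebra_simps)

lemma scalars_a_inv [simp]: "a_inv scalars x = - (x :: 'k::rc_field)"
proof -
  interpret cring "scalars :: ('k, 'k) nspace" by (rule cring_scalars)
  show ?thesis using minus_equality[of "-x" x] by simp
qed

lemma scalars_a_minus [simp]: "x \<ominus>\<^bsub>scalars\<^esub> y = x - (y :: 'k::rc_field)"
  by (simp add: a_minus_def)

lemma normed_space_scalars: "normed_space (scalars :: ('k::rc_field, 'k) nspace)"
proof (intro normed_space.intro normed_space_axioms.intro moduleI cring_scalars)
  interpret cring "scalars :: ('k, 'k) nspace" by (rule cring_scalars)
  show "abelian_group (scalars :: ('k, 'k) nspace)" ..
qed (auto simp: algebra_simps norm_mult norm_triangle_ineq)

lemma scalars_finsum [simp]:
  "finsum scalars f A = sum f A" for f :: "'a \<Rightarrow> 'k::rc_field"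
proof -
  interpret normed_space "scalars :: ('k, 'k) nspace" by (rule normed_space_scalars)
  show ?thesis
  proof (cases "finite A")
    case True
    then show ?thesis by (induction) (auto simp: finsum_insert)
  qed (simp add: finsum_infinite)
qed

lemma vdist_scalars: "vdist scalars = (dist :: 'k::rc_field \<Rightarrow> 'k \<Rightarrow> real)"
  by (auto simp: vdist_def dist_norm fun_eq_iff)

subsection \<open>Finite and infinite \<open>\<ell>\<^sub>p\<close> norms\<close>

lemma conj_index_1 [simp]: "conj_index 1 = \<infinity>"
  by (simp add: conj_index_def)

lemma conj_index_top [simp]: "conj_index top_class.top = 1"
  by (simp add: conj_index_def)

lemma conj_index_real:
  assumes "1 < r"
  shows "conj_index (ennreal r) = ennreal (r / (r - 1))"
proof -
  have "1 - inverse (ennreal r) = ennreal (1 - inverse r)"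
    using assms by (simp add: inverse_ennreal flip: ennreal_1 ennreal_minus)
  also have "inverse \<dots> = ennreal (inverse (1 - inverse r))"
    using assms by (intro inverse_ennreal) (simp add: inverse_less_1_iff)
  also have "inverse (1 - inverse r) = r / (r - 1)"
    using assms by (simp add: field_simps)
  finally show ?thesis by (simp add: conj_index_def)
qed

text \<open>Separating the two endpoint pairs keeps real powers away from infinite exponents; the
  third case supplies the real numbers with \<open>1 / r + 1 / s = 1\<close> that Young's inequality
  needs.\<close>

lemma conj_index_cases [consumes 1, case_names one top real]:
  assumes "1 \<le> p"
  obtains "p = 1" "conj_index p = \<infinity>"
  | "p = \<infinity>" "conj_index p = 1"
  | r s where "p = ennreal r" "conj_index p = ennreal s" "1 < r" "1 < s" "1 / r + 1 / s = 1"
proof (cases p)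
  case (real r)
  have "r \<ge> 1"
    using assms real by (metis ennreal_1 ennreal_le_iff2 not_one_le_zero order_trans zero_le_one)
  show thesis
  proof (cases "r = 1")
    case True
    then show ?thesis using real that(1) by simp
  next
    case False
    with \<open>r \<ge> 1\<close> have "1 < r" by simp
    show ?thesis
      by (rule that(3)[of r "r / (r - 1)"])
        (use \<open>1 < r\<close> real(2) conj_index_real[of r] in \<open>auto simp: field_simps\<close>)
  qed
qed (use that(2) in simp)

lemma conj_index_ge_1: "1 \<le> p \<Longrightarrow> 1 \<le> conj_index p"
  by (cases p rule: conj_index_cases) (auto simp: ennreal_ge_1)

lemma conj_index_involutive:
  assumes "1 \<le> p"
  shows "conj_index (conj_index p) = p"
  using assms
proof (cases rule: conj_index_cases)
  case (real r s)
  then have "s / (s - 1) = r" by (simp add: field_simps)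
  then show ?thesis using real conj_index_real[of s] by simp
qed auto

lemma lp_norm_fin_real:
  assumes "r \<ge> 1"
  shows "lp_norm_fin (ennreal r) n a = (\<Sum>i<n. \<bar>a i\<bar> powr r) powr (1 / r)"
proof -
  have "(\<Sum>i. \<bar>if i < n then a i else 0\<bar> powr r) = (\<Sum>i<n. \<bar>a i\<bar> powr r)"
    by (subst suminf_finite[of "{..<n}"]) auto
  then show ?thesis using assms by (simp add: lp_norm_fin_def lp_norm_def)
qed

lemma lp_norm_fin_1: "lp_norm_fin 1 n a = (\<Sum>i<n. \<bar>a i\<bar>)"
  using lp_norm_fin_real[of 1 n a] by (simp add: sum_nonneg)

text \<open>The zero extension puts \<open>0\<close> into the range of the supremum, whence the
  condition \<open>0 \<le> C\<close>; with it the equivalence also holds for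
  \<open>n = 0\<close>.\<close>

lemma lp_norm_fin_top_le_iff:
  assumes "0 \<le> C"
  shows "lp_norm_fin \<infinity> n a \<le> C \<longleftrightarrow> (\<forall>i<n. \<bar>a i\<bar> \<le> C)"
proof -
  have "finite (range (\<lambda>i. \<bar>if i < n then a i else 0\<bar>))"
    by (rule finite_subset[of _ "insert 0 ((\<lambda>i. \<bar>a i\<bar>) ` {..<n})"]) auto
  then have "bdd_above (range (\<lambda>i. \<bar>if i < n then a i else 0\<bar>))"
    by (rule bdd_above_finite)
  then show ?thesis
    unfolding lp_norm_fin_def lp_norm_def using assms
    by (subst if_P) (auto simp: cSUP_le_iff split: if_splits)
qed

lemma lp_norm_fin_top_nonneg: "0 \<le> lp_norm_fin \<infinity> n a"
proof -
  have "finite (range (\<lambda>i. \<bar>if i < n then a i else 0\<bar>))"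
    by (rule finite_subset[of _ "insert 0 ((\<lambda>i. \<bar>a i\<bar>) ` {..<n})"]) auto
  then have "0 \<le> (SUP i. \<bar>if i < n then a i else 0\<bar>)"
    by (intro cSUP_upper2[of _ _ n] bdd_above_finite) auto
  then show ?thesis by (simp add: lp_norm_fin_def lp_norm_def)
qed

lemma lp_norm_fin_nonneg: "1 \<le> p \<Longrightarrow> 0 \<le> lp_norm_fin p n a"
  by (cases p rule: conj_index_cases)
    (auto simp: lp_norm_fin_1 lp_norm_fin_real lp_norm_fin_top_nonneg[simplified] sum_nonneg)

lemma abs_le_lp_norm_fin_top: "i < n \<Longrightarrow> \<bar>a i\<bar> \<le> lp_norm_fin \<infinity> n a"
  using lp_norm_fin_top_le_iff[OF lp_norm_fin_top_nonneg, of n a n a] by blast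

text \<open>The common source of monotonicity, zero padding, passage to a single coordinate and
  interleaving. Injectivity is demanded only on the support of \<open>c\<close>, since vanishing
  entries contribute nothing.\<close>

lemma lp_norm_fin_reindex_le:
  assumes "1 \<le> p"
    and inj: "inj_on h {i. i < n \<and> c i \<noteq> 0}"
    and h: "\<And>i. i < n \<Longrightarrow> c i \<noteq> 0 \<Longrightarrow> h i < m \<and> \<bar>c i\<bar> \<le> \<bar>a (h i)\<bar>"
  shows "lp_norm_fin p n c \<le> lp_norm_fin p m a"
proof -
  have *: "(\<Sum>i<n. \<bar>c i\<bar> powr r) \<le> (\<Sum>i<m. \<bar>a i\<bar> powr r)" if "r \<ge> 1" for r
  proof -
    let ?I = "{i. i < n \<and> c i \<noteq> 0}"
    have "(\<Sum>i<n. \<bar>c i\<bar> powr r) = (\<Sum>i\<in>?I. \<bar>c i\<bar> powr r)"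
      by (rule sum.mono_neutral_right) auto
    also have "\<dots> \<le> (\<Sum>i\<in>?I. \<bar>a (h i)\<bar> powr r)"
      using that h by (intro sum_mono powr_mono2) auto
    also have "\<dots> = (\<Sum>j\<in>h ` ?I. \<bar>a j\<bar> powr r)"
      by (simp add: sum.reindex[OF inj])
    also have "\<dots> \<le> (\<Sum>i<m. \<bar>a i\<bar> powr r)"
      using h by (intro sum_mono2) auto
    finally show ?thesis .
  qed
  show ?thesis
    using assms(1)
  proof (cases rule: conj_index_cases)
    case one
    then show ?thesis using *[of 1] by (simp add: lp_norm_fin_1)
  next
    case top
    have "\<bar>c i\<bar> \<le> lp_norm_fin \<infinity> m a" if "i < n" for i
      using h[OF that] abs_le_lp_norm_fin_top[of "h i" m a] lp_norm_fin_top_nonneg[of m a]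
      by (cases "c i = 0") (auto intro: order_trans)
    then show ?thesis
      using top lp_norm_fin_top_le_iff[OF lp_norm_fin_top_nonneg, of n c m a] by simp
  next
    case (real r s)
    then show ?thesis using *[of r]
      by (auto simp: lp_norm_fin_real sum_nonneg intro!: powr_mono2)
  qed
qed

lemma lp_norm_fin_mono:
  assumes "1 \<le> p" "\<And>i. i < n \<Longrightarrow> \<bar>c i\<bar> \<le> \<bar>a i\<bar>"
  shows "lp_norm_fin p n c \<le> lp_norm_fin p n a"
  using assms by (intro lp_norm_fin_reindex_le[where h="\<lambda>i. i"]) auto

lemma lp_norm_fin_cong:
  "(\<And>i. i < n \<Longrightarrow> a i = b i) \<Longrightarrow> lp_norm_fin p n a = lp_norm_fin p n b"
  by (simp add: lp_norm_fin_def cong: if_cong)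

text \<open>Young's inequality is applied to the two families divided by their norms, and the
  resulting terms add up to \<open>1 / r + 1 / s = 1\<close>. A vanishing norm is treated apart: all
  products are then zero.\<close>

lemma lp_norm_fin_Hoelder:
  assumes "1 \<le> p"
  shows "(\<Sum>i<n. \<bar>a i\<bar> * \<bar>b i\<bar>) \<le> lp_norm_fin p n a * lp_norm_fin (conj_index p) n b"
proof -
  have 1: "(\<Sum>i<n. \<bar>a i\<bar> * \<bar>b i\<bar>) \<le> lp_norm_fin 1 n a * lp_norm_fin \<infinity> n b" for a b
    unfolding lp_norm_fin_1 sum_distrib_right
    by (intro sum_mono mult_left_mono abs_le_lp_norm_fin_top) auto
  show ?thesis
    using assms
  proof (cases rule: conj_index_cases)
    case one
    then show ?thesis using 1[of a b] by simp
  next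
    case top
    then show ?thesis using 1[of b a] by (simp add: mult.commute)
  next
    case (real r s)
    define A B where "A = (\<Sum>i<n. \<bar>a i\<bar> powr r)" and "B = (\<Sum>i<n. \<bar>b i\<bar> powr s)"
    have nn: "A \<ge> 0" "B \<ge> 0" by (auto simp: A_def B_def intro: sum_nonneg)
    have AB: "lp_norm_fin p n a = A powr (1/r)" "lp_norm_fin (conj_index p) n b = B powr (1/s)"
      using real by (auto simp: lp_norm_fin_real A_def B_def)
    show ?thesis
    proof (cases "A = 0 \<or> B = 0")
      case True
      then have "\<bar>a i\<bar> * \<bar>b i\<bar> = 0" if "i < n" for i
        using that by (auto simp: A_def B_def sum_nonneg_eq_0_iff)
      then have "(\<Sum>i<n. \<bar>a i\<bar> * \<bar>b i\<bar>) = 0" by (intro sum.neutral) auto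
      then show ?thesis using AB by simp
    next
      case False
      with nn have pos: "A > 0" "B > 0" by auto
      define A' B' where "A' = A powr (1/r)" and "B' = B powr (1/s)"
      have pos': "A' > 0" "B' > 0" using pos by (auto simp: A'_def B'_def)
      have AA: "A' powr r = A" "B' powr s = B"
        using pos real by (auto simp: A'_def B'_def powr_powr)
      have "(\<Sum>i<n. (\<bar>a i\<bar> / A') * (\<bar>b i\<bar> / B'))
          \<le> (\<Sum>i<n. (\<bar>a i\<bar> / A') powr r / r + (\<bar>b i\<bar> / B') powr s / s)"
        using real pos' by (intro sum_mono Youngs_inequality) auto
      also have "\<dots> = (\<Sum>i<n. \<bar>a i\<bar> powr r) / A / r + (\<Sum>i<n. \<bar>b i\<bar> powr s) / B / s"
        using pos' by (simp add: powr_divide AA sum.distrib sum_divide_distrib)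
      also have "\<dots> = 1" using pos real by (simp flip: A_def B_def)
      finally have "(\<Sum>i<n. \<bar>a i\<bar> * \<bar>b i\<bar>) / (A' * B') \<le> 1"
        by (simp add: sum_divide_distrib)
      then show ?thesis using pos' AB by (simp add: divide_le_eq A'_def B'_def)
    qed
  qed
qed

text \<open>The extremal family is the equality case of Hoelder: a unit vector at a largest entry
  for \<open>p = 1\<close>, the constant one for \<open>p = \<infinity>\<close>, and a normalised
  multiple of \<open>\<bar>a i\<bar> powr (s - 1)\<close> otherwise.\<close>

lemma lp_norm_fin_attained:
  assumes "1 \<le> p"
  shows "\<exists>b. (\<forall>i. 0 \<le> b i) \<and> lp_norm_fin p n b \<le> 1 \<and>
    (\<Sum>i<n. \<bar>a i\<bar> * b i) = lp_norm_fin (conj_index p) n a"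
  using assms
proof (cases rule: conj_index_cases)
  case one
  show ?thesis
  \<comment> \<open>The maximum used below exists only over a nonempty index set.\<close>
  proof (cases "n = 0")
    case True
    have "lp_norm_fin \<infinity> 0 a = 0"
      using lp_norm_fin_top_le_iff[of 0 0 a] lp_norm_fin_top_nonneg[of 0 a] by simp
    then show ?thesis
      using True one by (intro exI[of _ "\<lambda>_. 0"]) (simp add: lp_norm_fin_1)
  next
    case False
    define M where "M = Max ((\<lambda>i. \<bar>a i\<bar>) ` {..<n})"
    have "M \<in> (\<lambda>i. \<bar>a i\<bar>) ` {..<n}"
      unfolding M_def using False by (intro Max_in) auto
    then obtain j where j: "j < n" "M = \<bar>a j\<bar>" by auto
    have "\<bar>a i\<bar> \<le> \<bar>a j\<bar>" if "i < n" for i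
      using that unfolding j(2)[symmetric] M_def by (intro Max_ge) auto
    then have "lp_norm_fin \<infinity> n a = \<bar>a j\<bar>"
      using j abs_le_lp_norm_fin_top[of j n a] lp_norm_fin_top_le_iff[of "\<bar>a j\<bar>" n a] by fastforce
    then show ?thesis
      using j one
      by (intro exI[of _ "\<lambda>i. if i = j then 1 else 0"])
        (simp add: lp_norm_fin_1 if_distrib[of abs] if_distrib[of "(*) _"] cong: if_cong)
  qed
next
  case top
  then show ?thesis
    using lp_norm_fin_top_le_iff[of 1 n "\<lambda>_. 1"]
    by (intro exI[of _ "\<lambda>_. 1"]) (simp add: lp_norm_fin_1)
next
  case (real r s)
  define A where "A = (\<Sum>i<n. \<bar>a i\<bar> powr s)"
  have nn: "A \<ge> 0" by (auto simp: A_def intro: sum_nonneg)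
  have N: "lp_norm_fin (conj_index p) n a = A powr (1/s)"
    using real by (auto simp: lp_norm_fin_real A_def)
  show ?thesis
  proof (cases "A = 0")
    case True
    then show ?thesis
      using real N by (intro exI[of _ "\<lambda>_. 0"]) (simp add: lp_norm_fin_real)
  next
    case False
    with nn have pos: "A > 0" by simp
    \<comment> \<open>Since \<open>(s - 1) * r = s\<close>, the denominator is exactly the
      \<open>r\<close>-norm of the numerators.\<close>
    define b where "b i = \<bar>a i\<bar> powr (s - 1) / A powr (1/r)" for i
    have rs: "(s - 1) * r = s" using real by (simp add: field_simps)
    have "\<bar>b i\<bar> powr r = \<bar>a i\<bar> powr s / A" for i
      using real pos by (simp add: b_def powr_divide powr_powr rs)
    then have "(\<Sum>i<n. \<bar>b i\<bar> powr r) = 1"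
      using pos by (simp add: A_def flip: sum_divide_distrib)
    then have b1: "lp_norm_fin p n b = 1" using real by (simp add: lp_norm_fin_real)
    have "\<bar>a i\<bar> * b i = \<bar>a i\<bar> powr s / A powr (1/r)" for i
      by (cases "a i = 0") (simp_all add: b_def powr_diff)
    then have "(\<Sum>i<n. \<bar>a i\<bar> * b i) = A / A powr (1/r)"
      by (simp add: A_def sum_divide_distrib)
    also have "\<dots> = A powr (1 - 1/r)" using pos by (simp add: powr_diff)
    also have "1 - 1/r = 1/s" using real by simp
    finally have "(\<Sum>i<n. \<bar>a i\<bar> * b i) = A powr (1/s)" .
    then show ?thesis using b1 N by (intro exI[of _ b]) (auto simp: b_def)
  qed
qed

text \<open>The right-hand side tests against finite sums that are linear in the absolute values of
  \<open>a\<close>. Such tests pass through sums and limits, so later bounds in \<open>l_q\<close>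
  are proved in this form.\<close>

lemma lp_norm_fin_le_iff_dual:
  assumes "1 \<le> p" and "0 \<le> C"
  shows "lp_norm_fin (conj_index p) n a \<le> C \<longleftrightarrow>
    (\<forall>b. (\<forall>i. 0 \<le> b i) \<longrightarrow> lp_norm_fin p n b \<le> 1 \<longrightarrow> (\<Sum>i<n. \<bar>a i\<bar> * b i) \<le> C)"
proof
  assume L: "lp_norm_fin (conj_index p) n a \<le> C"
  show "\<forall>b. (\<forall>i. 0 \<le> b i) \<longrightarrow> lp_norm_fin p n b \<le> 1 \<longrightarrow> (\<Sum>i<n. \<bar>a i\<bar> * b i) \<le> C"
  proof (intro allI impI)
    fix b :: "nat \<Rightarrow> real" assume b: "\<forall>i. 0 \<le> b i" "lp_norm_fin p n b \<le> 1"
    have "(\<Sum>i<n. \<bar>a i\<bar> * b i) = (\<Sum>i<n. \<bar>b i\<bar> * \<bar>a i\<bar>)"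
      using b by (simp add: mult.commute)
    also have "\<dots> \<le> lp_norm_fin p n b * lp_norm_fin (conj_index p) n a"
      by (rule lp_norm_fin_Hoelder[OF assms(1)])
    also have "\<dots> \<le> 1 * C"
      using b L lp_norm_fin_nonneg[OF conj_index_ge_1[OF assms(1)]] by (intro mult_mono) auto
    finally show "(\<Sum>i<n. \<bar>a i\<bar> * b i) \<le> C" by simp
  qed
next
  assume "\<forall>b. (\<forall>i. 0 \<le> b i) \<longrightarrow> lp_norm_fin p n b \<le> 1 \<longrightarrow> (\<Sum>i<n. \<bar>a i\<bar> * b i) \<le> C"
  then show "lp_norm_fin (conj_index p) n a \<le> C"
    using lp_norm_fin_attained[OF assms(1), of n a] by metis
qed

text \<open>Minkowski's inequality by duality: pairing with an extremal \<open>b\<close> for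
  \<open>c\<close> turns the norm of \<open>c\<close> into a sum, from which the sum over
  \<open>J\<close> can be taken outside. The weights \<open>t\<close> are meant for the values of
  partition functions.\<close>

lemma lp_norm_fin_sum_le:
  assumes "1 \<le> p" and "finite J" and "\<And>j. j \<in> J \<Longrightarrow> 0 \<le> t j"
    and "\<And>i. i < n \<Longrightarrow> \<bar>c i\<bar> \<le> (\<Sum>j\<in>J. t j * \<bar>a j i\<bar>)"
  shows "lp_norm_fin p n c \<le> (\<Sum>j\<in>J. t j * lp_norm_fin p n (a j))"
proof -
  let ?q = "conj_index p"
  have q: "1 \<le> ?q" "conj_index ?q = p"
    using assms(1) by (simp_all add: conj_index_ge_1 conj_index_involutive)
  obtain b where b: "\<And>i. 0 \<le> b i" "lp_norm_fin ?q n b \<le> 1"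
      "(\<Sum>i<n. \<bar>c i\<bar> * b i) = lp_norm_fin p n c"
    using lp_norm_fin_attained[OF q(1), of n c] q(2) by auto
  have le: "(\<Sum>i<n. \<bar>a j i\<bar> * b i) \<le> lp_norm_fin p n (a j)" for j
    using lp_norm_fin_le_iff_dual[OF q(1) lp_norm_fin_nonneg[OF assms(1)], of n "a j" n "a j"] b q(2)
    by simp
  have "lp_norm_fin p n c \<le> (\<Sum>i<n. (\<Sum>j\<in>J. t j * \<bar>a j i\<bar>) * b i)"
    unfolding b(3)[symmetric] using assms(4) b(1) by (intro sum_mono mult_right_mono) auto
  also have "\<dots> = (\<Sum>j\<in>J. t j * (\<Sum>i<n. \<bar>a j i\<bar> * b i))"
    by (simp add: sum_distrib_right sum_distrib_left mult.assoc sum.swap[of _ J])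
  also have "\<dots> \<le> (\<Sum>j\<in>J. t j * lp_norm_fin p n (a j))"
    using assms(3) le by (intro sum_mono mult_left_mono) auto
  finally show ?thesis .
qed

lemma lp_norm_fin_add_le:
  assumes "1 \<le> p" and "0 \<le> s" and "0 \<le> t"
    and "\<And>i. i < n \<Longrightarrow> \<bar>c i\<bar> \<le> s * \<bar>a i\<bar> + t * \<bar>b i\<bar>"
  shows "lp_norm_fin p n c \<le> s * lp_norm_fin p n a + t * lp_norm_fin p n b"
  using lp_norm_fin_sum_le[OF assms(1), of "{True, False}" "\<lambda>j. if j then s else t" n c
      "\<lambda>j. if j then a else b"] assms by simp

lemma lp_norm_fin_scale_le:
  assumes "1 \<le> p" and "0 \<le> s" and "\<And>i. i < n \<Longrightarrow> \<bar>c i\<bar> \<le> s * \<bar>a i\<bar>"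
  shows "lp_norm_fin p n c \<le> s * lp_norm_fin p n a"
  using lp_norm_fin_add_le[OF assms(1,2), of 0 n c a a] assms(3) by simp

lemma lp_norm_fin_le_lp_norm:
  assumes "1 \<le> p" "lp_seq p a"
  shows "lp_norm_fin p n a \<le> lp_norm p a"
proof (cases p)
  case (real r)
  then have r: "r \<ge> 1"
    using assms by (metis ennreal_1 ennreal_le_iff2 not_one_le_zero order_trans zero_le_one)
  have "summable (\<lambda>n. \<bar>a n\<bar> powr r)" using assms(2) real r by (simp add: lp_seq_def)
  then have "(\<Sum>i<n. \<bar>a i\<bar> powr r) \<le> (\<Sum>i. \<bar>a i\<bar> powr r)"
    by (rule sum_le_suminf) auto
  then show ?thesis
    using real r lp_norm_fin_real[OF r]
    by (auto simp: lp_norm_def sum_nonneg intro!: powr_mono2)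
next
  case top
  then have "bdd_above (range (\<lambda>n. \<bar>a n\<bar>))"
    using assms(2) unfolding lp_seq_def bounded_iff bdd_above_def by auto
  then have "\<bar>a i\<bar> \<le> (SUP n. \<bar>a n\<bar>)" for i by (intro cSUP_upper) auto
  then show ?thesis using top lp_norm_fin_top_le_iff[of "SUP n. \<bar>a n\<bar>" n a]
    by (simp add: lp_norm_def) (meson abs_ge_zero order_trans)
qed

text \<open>Norms of sequences are controlled through their finite sections throughout; the section
  with \<open>n = 0\<close> already shows that \<open>C\<close> is nonnegative.\<close>

lemma lp_norm_leI:
  assumes "1 \<le> p" and C: "\<And>n. lp_norm_fin p n a \<le> C"
  shows "lp_seq p a" "lp_norm p a \<le> C"
proof -
  have C0: "0 \<le> C" using C[of 0] lp_norm_fin_nonneg[OF assms(1)] order_trans by blast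
  have "lp_seq p a \<and> lp_norm p a \<le> C"
  proof (cases p)
    case (real r)
    then have r: "r \<ge> 1"
      using assms by (metis ennreal_1 ennreal_le_iff2 not_one_le_zero order_trans zero_le_one)
    have *: "(\<Sum>i<n. \<bar>a i\<bar> powr r) \<le> C powr r" for n
    proof -
      have "((\<Sum>i<n. \<bar>a i\<bar> powr r) powr (1/r)) powr r \<le> C powr r"
        using C[of n] real r by (intro powr_mono2) (auto simp: lp_norm_fin_real)
      then show ?thesis using r by (simp add: powr_powr sum_nonneg)
    qed
    have s: "summable (\<lambda>n. \<bar>a n\<bar> powr r)"
      by (rule summableI_nonneg_bounded[OF _ *]) auto
    have "(\<Sum>i. \<bar>a i\<bar> powr r) \<le> C powr r" by (rule suminf_le_const[OF s *])
    then have "(\<Sum>i. \<bar>a i\<bar> powr r) powr (1/r) \<le> (C powr r) powr (1/r)"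
      using r by (intro powr_mono2 suminf_nonneg s) auto
    then show ?thesis using s real r C0 by (simp add: lp_seq_def lp_norm_def powr_powr)
  next
    case top
    have "\<bar>a n\<bar> \<le> C" for n
      using C[of "Suc n"] top lp_norm_fin_top_le_iff[OF C0, of "Suc n" a] by simp
    then show ?thesis using top
      by (auto simp: lp_seq_def lp_norm_def bounded_iff intro!: cSUP_least)
  qed
  then show "lp_seq p a" "lp_norm p a \<le> C" by auto
qed

lemma lp_norm_nonneg: "1 \<le> p \<Longrightarrow> lp_seq p a \<Longrightarrow> 0 \<le> lp_norm p a"
  using lp_norm_fin_nonneg[of p 0 a] lp_norm_fin_le_lp_norm[of p a 0] by simp

lemma lp_ball_iff:
  assumes "1 \<le> q"
  shows "\<alpha> \<in> lp_ball q \<longleftrightarrow> (\<forall>n. lp_norm_fin q n (\<lambda>i. norm (\<alpha> i)) \<le> 1)"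
  unfolding lp_ball_def mem_Collect_eq
  using lp_norm_leI[OF assms, of "\<lambda>i. norm (\<alpha> i)" 1]
    order_trans[OF lp_norm_fin_le_lp_norm[OF assms]] by blast

text \<open>Here \<open>c_0\<close> is indispensable at the infinite exponent: tails of a merely
  bounded sequence need not become small.\<close>

lemma lp_norm_fin_tail:
  assumes "1 \<le> p" and x: "if p = \<infinity> then x \<longlonglongrightarrow> 0 else lp_seq p x" and "e > 0"
  shows "\<exists>N. \<forall>m. lp_norm_fin p m (\<lambda>i. if i < N then 0 else x i) \<le> e"
proof (cases p)
  case (real r)
  then have r: "r \<ge> 1"
    using assms by (metis ennreal_1 ennreal_le_iff2 not_one_le_zero order_trans zero_le_one)
  have s: "summable (\<lambda>n. \<bar>x n\<bar> powr r)" using x real r by (simp add: lp_seq_def)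
  have "e powr r > 0" using \<open>e > 0\<close> by simp
  then obtain N where N: "\<And>m n. m \<ge> N \<Longrightarrow> norm (\<Sum>i=m..<n. \<bar>x i\<bar> powr r) < e powr r"
    using s unfolding summable_Cauchy by blast
  have "lp_norm_fin p m (\<lambda>i. if i < N then 0 else x i) \<le> e" for m
  proof -
    have "(\<Sum>i<m. \<bar>if i < N then 0 else x i\<bar> powr r) = (\<Sum>i=N..<m. \<bar>x i\<bar> powr r)"
      by (rule sum.mono_neutral_cong_right) auto
    also have "\<dots> \<le> e powr r" using N[of N m] by simp
    finally have "(\<Sum>i<m. \<bar>if i < N then 0 else x i\<bar> powr r) powr (1/r) \<le> (e powr r) powr (1/r)"
      using r by (intro powr_mono2) (auto intro: sum_nonneg)
    then show ?thesis using real r \<open>e > 0\<close> by (simp add: lp_norm_fin_real powr_powr)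
  qed
  then show ?thesis by blast
next
  case top
  then obtain N where N: "\<And>n. n \<ge> N \<Longrightarrow> \<bar>x n\<bar> < e"
    using x LIMSEQ_D[of x 0 e] \<open>e > 0\<close> by auto
  then have "lp_norm_fin p m (\<lambda>i. if i < N then 0 else x i) \<le> e" for m
    using lp_norm_fin_top_le_iff[of e m] \<open>e > 0\<close> top by (auto simp: less_imp_le)
  then show ?thesis by blast
qed

lemma abs_le_lp_norm_fin:
  assumes "1 \<le> p" "i < n"
  shows "\<bar>a i\<bar> \<le> lp_norm_fin p n a"
proof -
  have "lp_norm_fin p 1 (\<lambda>_. a i) = \<bar>a i\<bar>"
    using assms(1)
  proof (cases rule: conj_index_cases)
    case top
    then show ?thesis
      using lp_norm_fin_top_le_iff[of "\<bar>a i\<bar>" 1 "\<lambda>_. a i"] abs_le_lp_norm_fin_top[of 0 1 "\<lambda>_. a i"]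
      by simp
  qed (auto simp: lp_norm_fin_1 lp_norm_fin_real powr_powr)
  moreover have "lp_norm_fin p 1 (\<lambda>_. a i) \<le> lp_norm_fin p n a"
    using assms by (intro lp_norm_fin_reindex_le[where h="\<lambda>_. i"]) (auto simp: inj_on_def)
  ultimately show ?thesis by simp
qed

text \<open>Puts the generating sequences of two hulls into one, so that the sum of two p-continuous
  functions has its values in a single hull.\<close>

definition interleave :: "(nat \<Rightarrow> 'a) \<Rightarrow> (nat \<Rightarrow> 'a) \<Rightarrow> nat \<Rightarrow> 'a" where
  "interleave a b n = (if even n then a (n div 2) else b (n div 2))"

text \<open>The map \<open>i div 2\<close> is injective on even and on odd indices, so each half is
  a reindexing, and the triangle inequality joins them. The bound is crude, but it yields membership
  in the sequence space and, with \<open>s = 1/2\<close>, coefficients in the unit ball.\<close>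

lemma lp_norm_fin_interleave_le:
  assumes "1 \<le> p" "0 \<le> s"
    and a: "\<And>m. lp_norm_fin p m a \<le> A" and b: "\<And>m. lp_norm_fin p m b \<le> B"
    and c: "\<And>i. \<bar>c i\<bar> \<le> s * \<bar>interleave a b i\<bar>"
  shows "lp_norm_fin p n c \<le> s * A + s * B"
proof -
  let ?a = "\<lambda>i. if even i then a (i div 2) else 0" and ?b = "\<lambda>i. if odd i then b (i div 2) else 0"
  have *: "lp_norm_fin p n c \<le> s * lp_norm_fin p n ?a + s * lp_norm_fin p n ?b"
    using assms(1,2) order_trans[OF c] by (intro lp_norm_fin_add_le) (auto simp: interleave_def)
  have "i div 2 < n" if "i < n" for i using that by simp
  moreover have "inj_on (\<lambda>i::nat. i div 2) {i. even i}"
    by (rule inj_onI) (metis mem_Collect_eq dvd_mult_div_cancel)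
  then have "inj_on (\<lambda>i. i div 2) {i. i < n \<and> ?a i \<noteq> 0}"
    by (rule inj_on_subset) (auto split: if_splits)
  moreover have "inj_on (\<lambda>i::nat. i div 2) {i. odd i}"
    by (rule inj_onI) (metis mem_Collect_eq odd_two_times_div_two_succ)
  then have "inj_on (\<lambda>i. i div 2) {i. i < n \<and> ?b i \<noteq> 0}"
    by (rule inj_on_subset) (auto split: if_splits)
  ultimately have "lp_norm_fin p n ?a \<le> lp_norm_fin p n a" "lp_norm_fin p n ?b \<le> lp_norm_fin p n b"
    by (auto intro!: lp_norm_fin_reindex_le[OF assms(1), where h="\<lambda>i. i div 2"])
  then have "lp_norm_fin p n ?a \<le> A" "lp_norm_fin p n ?b \<le> B"
    using a[of n] b[of n] by simp_all
  then show ?thesis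
    using * assms(2) by (smt (verit) mult_left_mono)
qed

subsection \<open>Normed spaces on carrier sets\<close>

text \<open>Kept apart from \<open>normed_space\<close> because the Hahn-Banach argument also runs
  on the algebraic tensor product, where the projective norm enters as a seminorm.\<close>

locale rc_module = Module.module scalars V for V :: "('k::rc_field, 'v) nspace" (structure)
begin

lemma smult_in [simp, intro]: "x \<in> carrier V \<Longrightarrow> c \<odot> x \<in> carrier V"
  by simp

lemma smult_add_left: "x \<in> carrier V \<Longrightarrow> (a + b) \<odot> x = a \<odot> x \<oplus> b \<odot> x"
  using smult_l_distr[of a b x] by simp

lemma smult_add_right:
  "x \<in> carrier V \<Longrightarrow> y \<in> carrier V \<Longrightarrow> a \<odot> (x \<oplus> y) = a \<odot> x \<oplus> a \<odot> y"
  using smult_r_distr[of a x y] by simp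

lemma smult_mult: "x \<in> carrier V \<Longrightarrow> (a * b) \<odot> x = a \<odot> (b \<odot> x)"
  using smult_assoc1[of a b x] by simp

lemma smult_1 [simp]: "x \<in> carrier V \<Longrightarrow> 1 \<odot> x = x"
  using smult_one[of x] by simp

lemma smult_0 [simp]: "x \<in> carrier V \<Longrightarrow> 0 \<odot> x = \<zero>"
  using smult_l_null[of x] by simp

lemma smult_zero [simp]: "c \<odot> \<zero> = \<zero>"
  using smult_r_null[of c] by simp

lemma smult_uminus: "x \<in> carrier V \<Longrightarrow> (- a) \<odot> x = \<ominus> (a \<odot> x)"
  using smult_l_minus[of a x] by simp

lemma a_inv_eq_smult: "x \<in> carrier V \<Longrightarrow> \<ominus> x = (- 1) \<odot> x"
  using smult_uminus[of x 1] by simp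

lemma smult_diff_left: "x \<in> carrier V \<Longrightarrow> (a - b) \<odot> x = a \<odot> x \<ominus> b \<odot> x"
  using smult_add_left[of x a "- b"] by (simp add: smult_uminus a_minus_def)

lemma smult_diff_right:
  "x \<in> carrier V \<Longrightarrow> y \<in> carrier V \<Longrightarrow> a \<odot> (x \<ominus> y) = a \<odot> x \<ominus> a \<odot> y"
  using smult_r_minus[of a y] by (simp add: a_minus_def smult_add_right)

lemma minus_self [simp]: "x \<in> carrier V \<Longrightarrow> x \<ominus> x = \<zero>"
  by (simp add: a_minus_def M.r_neg)

lemma minus_zero [simp]: "x \<in> carrier V \<Longrightarrow> x \<ominus> \<zero> = x"
  by (simp add: a_minus_def)

lemma minus_swap: "x \<in> carrier V \<Longrightarrow> y \<in> carrier V \<Longrightarrow> \<ominus> (x \<ominus> y) = y \<ominus> x"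
  by (simp add: a_minus_def M.minus_add M.a_comm)

lemma diff_add_cancel [simp]: "x \<in> carrier V \<Longrightarrow> y \<in> carrier V \<Longrightarrow> x \<ominus> y \<oplus> y = x"
  by (simp add: a_minus_def M.a_assoc M.l_neg)

lemma diff_add_diff:
  "x \<in> carrier V \<Longrightarrow> y \<in> carrier V \<Longrightarrow> z \<in> carrier V \<Longrightarrow> (x \<ominus> y) \<oplus> (y \<ominus> z) = x \<ominus> z"
  by (simp add: a_minus_def M.a_assoc[symmetric]) (simp add: M.a_assoc M.l_neg)

lemma add_diff_add:
  "x \<in> carrier V \<Longrightarrow> y \<in> carrier V \<Longrightarrow> z \<in> carrier V \<Longrightarrow> w \<in> carrier V \<Longrightarrow>
    (x \<oplus> y) \<ominus> (z \<oplus> w) = (x \<ominus> z) \<oplus> (y \<ominus> w)"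
  by (simp add: a_minus_def M.minus_add M.a_ac)

lemma diff_eq_zero_iff: "x \<in> carrier V \<Longrightarrow> y \<in> carrier V \<Longrightarrow> x \<ominus> y = \<zero> \<longleftrightarrow> x = y"
  by (metis M.l_zero diff_add_cancel minus_self)

lemma finsum_in [intro]: "(\<And>i. i \<in> A \<Longrightarrow> f i \<in> carrier V) \<Longrightarrow> finsum V f A \<in> carrier V"
  by (rule M.finsum_closed) auto

lemma finsum_lessThan_Suc:
  "(\<And>i. i \<le> n \<Longrightarrow> f i \<in> carrier V) \<Longrightarrow> finsum V f {..<Suc n} = finsum V f {..<n} \<oplus> f n"
  by (subst lessThan_Suc, subst M.finsum_insert) (auto intro!: M.a_comm finsum_in)

lemma smult_finsum:
  assumes "\<And>i. i \<in> A \<Longrightarrow> f i \<in> carrier V"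
  shows "c \<odot> finsum V f A = finsum V (\<lambda>i. c \<odot> f i) A"
proof (cases "finite A")
  case True
  then show ?thesis using assms by (intro finsum_smult_ldistr) auto
qed (simp add: M.finsum_infinite)

lemma sum_smult:
  assumes "x \<in> carrier V"
  shows "sum f A \<odot> x = finsum V (\<lambda>i. f i \<odot> x) A"
proof (induction A rule: infinite_finite_induct)
  case (insert a A)
  then show ?case
    using assms by (subst M.finsum_insert) (auto simp: smult_add_left)
qed (use assms in \<open>auto simp: M.finsum_infinite\<close>)

lemma finsum_add:
  assumes "\<And>i. i \<in> A \<Longrightarrow> f i \<in> carrier V" "\<And>i. i \<in> A \<Longrightarrow> g i \<in> carrier V"
  shows "finsum V (\<lambda>i. f i \<oplus> g i) A = finsum V f A \<oplus> finsum V g A"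
  using assms by (intro M.finsum_addf) auto

lemma finsum_a_inv:
  assumes "\<And>i. i \<in> A \<Longrightarrow> f i \<in> carrier V"
  shows "finsum V (\<lambda>i. \<ominus> f i) A = \<ominus> finsum V f A"
proof -
  have "finsum V (\<lambda>i. \<ominus> f i) A = finsum V (\<lambda>i. (- 1) \<odot> f i) A"
    using assms by (intro M.finsum_cong') (auto simp: a_inv_eq_smult)
  then show ?thesis
    using assms by (simp add: smult_finsum[symmetric] a_inv_eq_smult finsum_in)
qed

lemma finsum_diff:
  assumes "\<And>i. i \<in> A \<Longrightarrow> f i \<in> carrier V" "\<And>i. i \<in> A \<Longrightarrow> g i \<in> carrier V"
  shows "finsum V (\<lambda>i. f i \<ominus> g i) A = finsum V f A \<ominus> finsum V g A"
  using assms by (simp add: a_minus_def finsum_add finsum_a_inv)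

lemma finsum_eq:
  assumes "\<And>i. i \<in> A \<Longrightarrow> f i = g i" "\<And>i. i \<in> A \<Longrightarrow> g i \<in> carrier V"
  shows "finsum V f A = finsum V g A"
  using assms by (intro M.finsum_cong') auto

lemma finsum_swap:
  assumes "finite A" "finite B" "\<And>i j. i \<in> A \<Longrightarrow> j \<in> B \<Longrightarrow> f i j \<in> carrier V"
  shows "finsum V (\<lambda>i. finsum V (\<lambda>j. f i j) B) A = finsum V (\<lambda>j. finsum V (\<lambda>i. f i j) A) B"
  using assms(1,3)
proof (induction A)
  case empty
  then show ?case by simp
next
  case (insert a A)
  have "finsum V (\<lambda>j. finsum V (\<lambda>i. f i j) (insert a A)) B
      = finsum V (\<lambda>j. f a j \<oplus> finsum V (\<lambda>i. f i j) A) B"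
    using insert by (intro finsum_eq) (auto simp: M.finsum_insert Pi_def intro!: finsum_in)
  also have "\<dots> = finsum V (f a) B \<oplus> finsum V (\<lambda>j. finsum V (\<lambda>i. f i j) A) B"
    using insert by (intro finsum_add) auto
  also have "\<dots> = finsum V (\<lambda>i. finsum V (\<lambda>j. f i j) B) (insert a A)"
    using insert by (subst M.finsum_insert) (auto intro!: finsum_in)
  finally show ?case by simp
qed

lemma finsum_product:
  assumes "finite A" "finite B" "\<And>i j. i \<in> A \<Longrightarrow> j \<in> B \<Longrightarrow> f i j \<in> carrier V"
  shows "finsum V (\<lambda>i. finsum V (\<lambda>j. f i j) B) A = finsum V (\<lambda>(i, j). f i j) (A \<times> B)"
  using assms(1,3)
proof (induction A)
  case empty
  then show ?case by simp
next
  case (insert a A)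
  have "finsum V (\<lambda>(i, j). f i j) (insert a A \<times> B)
      = finsum V (\<lambda>(i, j). f i j) (Pair a ` B \<union> A \<times> B)"
    by (rule arg_cong[of _ _ "finsum V _"]) auto
  also have "\<dots> = finsum V (\<lambda>(i, j). f i j) (Pair a ` B) \<oplus> finsum V (\<lambda>(i, j). f i j) (A \<times> B)"
    using insert assms(2) by (intro M.finsum_Un_disjoint) auto
  also have "finsum V (\<lambda>(i, j). f i j) (Pair a ` B) = finsum V (f a) B"
    using insert by (subst M.finsum_reindex) (auto simp: inj_on_def)
  also have "finsum V (\<lambda>(i, j). f i j) (A \<times> B) = finsum V (\<lambda>i. finsum V (\<lambda>j. f i j) B) A"
    using insert by simp
  also have "finsum V (f a) B \<oplus> \<dots> = finsum V (\<lambda>i. finsum V (\<lambda>j. f i j) B) (insert a A)"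
    using insert by (subst M.finsum_insert) (auto intro!: finsum_in)
  finally show ?case by simp
qed

end

sublocale normed_space \<subseteq> rc_module ..

context normed_space
begin

lemma vnorm_zero [simp]: "vnorm V \<zero> = 0"
  by (simp add: vnorm_eq_0)

lemma vnorm_minus [simp]: "x \<in> carrier V \<Longrightarrow> vnorm V (\<ominus> x) = vnorm V x"
  by (simp add: a_inv_eq_smult vnorm_smult)

lemma vnorm_nonneg [simp]: "x \<in> carrier V \<Longrightarrow> 0 \<le> vnorm V x"
  using vnorm_triangle[of x "\<ominus> x"] by (simp add: M.r_neg)

lemma vnorm_diff_le: "x \<in> carrier V \<Longrightarrow> y \<in> carrier V \<Longrightarrow> vnorm V (x \<ominus> y) \<le> vnorm V x + vnorm V y"
  using vnorm_triangle[of x "\<ominus> y"] by (simp add: a_minus_def)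

lemma vnorm_minus_commute:
  "x \<in> carrier V \<Longrightarrow> y \<in> carrier V \<Longrightarrow> vnorm V (x \<ominus> y) = vnorm V (y \<ominus> x)"
  by (metis M.minus_closed minus_swap vnorm_minus)

lemma vnorm_diff_triangle:
  "x \<in> carrier V \<Longrightarrow> y \<in> carrier V \<Longrightarrow> z \<in> carrier V \<Longrightarrow>
    vnorm V (x \<ominus> z) \<le> vnorm V (x \<ominus> y) + vnorm V (y \<ominus> z)"
  using vnorm_triangle[of "x \<ominus> y" "y \<ominus> z"] by (simp add: diff_add_diff)

lemma vnorm_le_add_diff:
  "x \<in> carrier V \<Longrightarrow> y \<in> carrier V \<Longrightarrow> vnorm V x \<le> vnorm V y + vnorm V (x \<ominus> y)"
  using vnorm_triangle[of "x \<ominus> y" y] by simp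

lemma vnorm_finsum_le:
  assumes "\<And>i. i \<in> A \<Longrightarrow> f i \<in> carrier V"
  shows "vnorm V (finsum V f A) \<le> (\<Sum>i\<in>A. vnorm V (f i))"
  using assms
proof (induction A rule: infinite_finite_induct)
  case (insert a A)
  then have "vnorm V (finsum V f (insert a A)) \<le> vnorm V (f a) + vnorm V (finsum V f A)"
    by (subst M.finsum_insert) (auto intro!: vnorm_triangle finsum_in)
  with insert show ?case by force
qed (auto simp: M.finsum_infinite)

sublocale metric: Metric_space "carrier V" "vdist V"
proof
  fix x y z
  show "0 \<le> vdist V x y" by (simp add: vdist_def)
  show "vdist V x y = vdist V y x" by (simp add: vdist_def vnorm_minus_commute)
  assume [simp]: "x \<in> carrier V" "y \<in> carrier V"
  show "vdist V x y = 0 \<longleftrightarrow> x = y"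
    by (simp add: vdist_def vnorm_eq_0 diff_eq_zero_iff)
  assume [simp]: "z \<in> carrier V"
  show "vdist V x z \<le> vdist V x y + vdist V y z"
    by (simp add: vdist_def vnorm_diff_triangle)
qed

section \<open>Convergence and continuity with respect to the norm\<close>

lemma limitin_iff:
  assumes "\<And>n. f n \<in> carrier V"
  shows "limitin (vtopology V) f l sequentially \<longleftrightarrow>
    l \<in> carrier V \<and> (\<lambda>n. vnorm V (f n \<ominus> l)) \<longlonglongrightarrow> 0"
proof (cases "l \<in> carrier V")
  case True
  then have "vdist V (f n) l = vnorm V (f n \<ominus> l)" for n
    using assms by (simp add: vdist_def)
  then show ?thesis
    using True assms by (simp add: metric.limitin_metric_dist_null)
qed (simp add: metric.limitin_metric)

lemma continuous_map_iff:
  "continuous_map T (vtopology V) f \<longleftrightarrow>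
    (\<forall>x\<in>topspace T. f x \<in> carrier V) \<and>
    (\<forall>x\<in>topspace T. \<forall>e>0. \<exists>U. openin T U \<and> x \<in> U \<and> (\<forall>y\<in>U. vnorm V (f y \<ominus> f x) < e))"
  (is "?L \<longleftrightarrow> ?R1 \<and> ?R2")
proof
  assume L: ?L
  then have 1: ?R1 by (auto simp: continuous_map_def)
  have ?R2
  proof (intro ballI allI impI)
    fix x and e :: real assume x: "x \<in> topspace T" and "e > 0"
    then obtain U where U: "openin T U" "x \<in> U" "\<And>y. y \<in> U \<Longrightarrow> f y \<in> metric.mball (f x) e"
      using L unfolding metric.continuous_map_to_metric by meson
    have "vnorm V (f y \<ominus> f x) < e" if "y \<in> U" for y
      using U(3)[OF that] by (auto simp: vdist_def vnorm_minus_commute)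
    with U show "\<exists>U. openin T U \<and> x \<in> U \<and> (\<forall>y\<in>U. vnorm V (f y \<ominus> f x) < e)" by blast
  qed
  with 1 show "?R1 \<and> ?R2" ..
next
  assume R: "?R1 \<and> ?R2"
  show ?L
    unfolding metric.continuous_map_to_metric
  proof (intro ballI allI impI)
    fix x and e :: real assume x: "x \<in> topspace T" and "e > 0"
    then obtain U where U: "openin T U" "x \<in> U" "\<And>y. y \<in> U \<Longrightarrow> vnorm V (f y \<ominus> f x) < e"
      using R by meson
    have "f y \<in> metric.mball (f x) e" if "y \<in> U" for y
    proof -
      have "y \<in> topspace T" using that U(1) openin_subset by blast
      then show ?thesis
        using U(3)[OF that] R x by (auto simp: vdist_def vnorm_minus_commute)
    qed
    with U show "\<exists>U. openin T U \<and> x \<in> U \<and> (\<forall>y\<in>U. f y \<in> metric.mball (f x) e)" by blast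
  qed
qed

lemma continuous_map_add:
  assumes "continuous_map T (vtopology V) f" "continuous_map T (vtopology V) g"
  shows "continuous_map T (vtopology V) (\<lambda>t. f t \<oplus> g t)"
  unfolding continuous_map_iff
proof (intro conjI ballI allI impI)
  fix x and e :: real assume x: "x \<in> topspace T"
  note f = assms(1)[unfolded continuous_map_iff] and g = assms(2)[unfolded continuous_map_iff]
  show "f x \<oplus> g x \<in> carrier V" using f g x by blast
  assume "e > 0"
  then have "e/2 > 0" by simp
  obtain U where U: "openin T U" "x \<in> U" "\<And>y. y \<in> U \<Longrightarrow> vnorm V (f y \<ominus> f x) < e/2"
    using f x \<open>e/2 > 0\<close> by meson
  obtain U' where U': "openin T U'" "x \<in> U'" "\<And>y. y \<in> U' \<Longrightarrow> vnorm V (g y \<ominus> g x) < e/2"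
    using g x \<open>e/2 > 0\<close> by meson
  have "vnorm V ((f y \<oplus> g y) \<ominus> (f x \<oplus> g x)) < e" if "y \<in> U \<inter> U'" for y
  proof -
    have y: "y \<in> topspace T" using that U(1) openin_subset by blast
    have in': "f x \<in> carrier V" "g x \<in> carrier V" "f y \<in> carrier V" "g y \<in> carrier V"
      using f g x y by auto
    then have "vnorm V ((f y \<oplus> g y) \<ominus> (f x \<oplus> g x)) \<le> vnorm V (f y \<ominus> f x) + vnorm V (g y \<ominus> g x)"
      by (simp add: add_diff_add vnorm_triangle)
    also have "\<dots> < e/2 + e/2" using U(3)[of y] U'(3)[of y] that by auto
    finally show ?thesis by simp
  qed
  then show "\<exists>U. openin T U \<and> x \<in> U \<and> (\<forall>y\<in>U. vnorm V ((f y \<oplus> g y) \<ominus> (f x \<oplus> g x)) < e)"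
    using U U' by (intro exI[of _ "U \<inter> U'"]) auto
qed

lemma continuous_map_smult_const:
  assumes "continuous_map T (vtopology V) f"
  shows "continuous_map T (vtopology V) (\<lambda>t. c \<odot> f t)"
  unfolding continuous_map_iff
proof (intro conjI ballI allI impI)
  fix x and e :: real assume x: "x \<in> topspace T"
  note f = assms(1)[unfolded continuous_map_iff]
  show "c \<odot> f x \<in> carrier V" using f x by blast
  assume "e > 0"
  then have "e / (norm c + 1) > 0" by (simp add: add_nonneg_pos)
  then obtain U where U: "openin T U" "x \<in> U"
      "\<And>y. y \<in> U \<Longrightarrow> vnorm V (f y \<ominus> f x) < e / (norm c + 1)"
    using f x by meson
  have "vnorm V (c \<odot> f y \<ominus> c \<odot> f x) < e" if "y \<in> U" for y
  proof -
    have y: "y \<in> topspace T" using that U(1) openin_subset by blast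
    have in': "f x \<in> carrier V" "f y \<in> carrier V" using f x y by auto
    then have "vnorm V (c \<odot> f y \<ominus> c \<odot> f x) = norm c * vnorm V (f y \<ominus> f x)"
      by (simp add: smult_diff_right[symmetric] vnorm_smult)
    also have "\<dots> \<le> (norm c + 1) * vnorm V (f y \<ominus> f x)"
      using in' by (intro mult_right_mono) auto
    also have "\<dots> < e" using U(3)[OF that] by (simp add: pos_less_divide_eq add_nonneg_pos mult.commute)
    finally show ?thesis .
  qed
  then show "\<exists>U. openin T U \<and> x \<in> U \<and> (\<forall>y\<in>U. vnorm V (c \<odot> f y \<ominus> c \<odot> f x) < e)"
    using U by blast
qed

lemma continuous_map_smult_vector:
  assumes "continuous_map T euclidean \<phi>" and v: "v \<in> carrier V"
  shows "continuous_map T (vtopology V) (\<lambda>t. \<phi> t \<odot> v)"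
  unfolding continuous_map_iff
proof (intro conjI ballI allI impI)
  fix x and e :: real assume x: "x \<in> topspace T"
  show "\<phi> x \<odot> v \<in> carrier V" using v by simp
  assume "e > 0"
  interpret S: normed_space scalars by (rule normed_space_scalars)
  have "e / (vnorm V v + 1) > 0" using \<open>e > 0\<close> v by (simp add: add_nonneg_pos)
  then obtain U where U: "openin T U" "x \<in> U"
      "\<And>y. y \<in> U \<Longrightarrow> norm (\<phi> y - \<phi> x) < e / (vnorm V v + 1)"
    using assms(1) x S.continuous_map_iff[of T \<phi>] by (simp add: vdist_scalars) meson
  have "vnorm V (\<phi> y \<odot> v \<ominus> \<phi> x \<odot> v) < e" if "y \<in> U" for y
  proof -
    have "vnorm V (\<phi> y \<odot> v \<ominus> \<phi> x \<odot> v) = norm (\<phi> y - \<phi> x) * vnorm V v"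
      using v by (simp add: smult_diff_left[symmetric] vnorm_smult)
    also have "\<dots> \<le> norm (\<phi> y - \<phi> x) * (vnorm V v + 1)"
      using v by (intro mult_left_mono) auto
    also have "\<dots> < e" using U(3)[OF that] v by (simp add: pos_less_divide_eq add_nonneg_pos)
    finally show ?thesis .
  qed
  then show "\<exists>U. openin T U \<and> x \<in> U \<and> (\<forall>y\<in>U. vnorm V (\<phi> y \<odot> v \<ominus> \<phi> x \<odot> v) < e)"
    using U by blast
qed

lemma continuous_map_finsum:
  assumes "\<And>i. i \<in> A \<Longrightarrow> continuous_map T (vtopology V) (f i)"
  shows "continuous_map T (vtopology V) (\<lambda>t. finsum V (\<lambda>i. f i t) A)"
  using assms
proof (induction A rule: infinite_finite_induct)
  case (insert a A)
  have c: "f i t \<in> carrier V" if "i \<in> insert a A" "t \<in> topspace T" for i t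
    using insert.prems[OF that(1)] that(2) by (auto simp: continuous_map_iff)
  have "continuous_map T (vtopology V) (\<lambda>t. f a t \<oplus> finsum V (\<lambda>i. f i t) A)"
    using insert by (intro continuous_map_add) auto
  then show ?case
  proof (rule continuous_map_eq)
    fix t assume "t \<in> topspace T"
    then show "f a t \<oplus> finsum V (\<lambda>i. f i t) A = finsum V (\<lambda>i. f i t) (insert a A)"
      using insert c by (subst M.finsum_insert) auto
  qed
qed (auto simp: M.finsum_infinite)

lemma continuous_map_vnorm_diff:
  assumes "continuous_map T (vtopology V) f" and v: "v \<in> carrier V"
  shows "continuous_map T euclideanreal (\<lambda>t. vnorm V (f t \<ominus> v))"
proof -
  \<comment> \<open>Viewing the reals as a normed space over themselves brings real-valued functions
    under the same epsilon criterion.\<close>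
  interpret S: normed_space "scalars :: (real, real) nspace" by (rule normed_space_scalars)
  note f = assms(1)[unfolded continuous_map_iff]
  have "continuous_map T (vtopology scalars) (\<lambda>t. vnorm V (f t \<ominus> v))"
    unfolding S.continuous_map_iff
  proof (intro conjI ballI allI impI)
    fix x and e :: real assume x: "x \<in> topspace T" and "e > 0"
    then obtain U where U: "openin T U" "x \<in> U" "\<And>y. y \<in> U \<Longrightarrow> vnorm V (f y \<ominus> f x) < e"
      using f by meson
    have "\<bar>vnorm V (f y \<ominus> v) - vnorm V (f x \<ominus> v)\<bar> < e" if "y \<in> U" for y
    proof -
      have y: "y \<in> topspace T" using that U(1) openin_subset by blast
      have in': "f x \<in> carrier V" "f y \<in> carrier V" using f x y by auto
      then show ?thesis
        using U(3)[OF that] vnorm_diff_triangle[of "f y" "f x" v]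
          vnorm_diff_triangle[of "f x" "f y" v] vnorm_minus_commute[of "f x" "f y"] v by linarith
    qed
    then show "\<exists>U. openin T U \<and> x \<in> U \<and> (\<forall>y\<in>U. vnorm scalars
        (vnorm V (f y \<ominus> v) \<ominus>\<^bsub>scalars\<^esub> vnorm V (f x \<ominus> v)) < e)"
      using U by auto
  qed auto
  then show ?thesis by (simp add: vdist_scalars)
qed

end

subsection \<open>Spaces of functions and operators\<close>

lemma fun_space_simps [simp]:
  "carrier (fun_space D W F N) = F"
  "zero (fun_space D W F N) = (\<lambda>t\<in>D. \<zero>\<^bsub>W\<^esub>)"
  "add (fun_space D W F N) = (\<lambda>f g. \<lambda>t\<in>D. f t \<oplus>\<^bsub>W\<^esub> g t)"
  "smult (fun_space D W F N) = (\<lambda>c f. \<lambda>t\<in>D. c \<odot>\<^bsub>W\<^esub> f t)"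
  "vnorm (fun_space D W F N) = N"
  by (simp_all add: fun_space_def)

text \<open>Shared by the space of continuous scalar functions and by the tensor product;
  \<open>N\<close> is arbitrary because the module laws do not involve it.\<close>

lemma module_fun_space:
  assumes "normed_space W" and F: "F \<subseteq> D \<rightarrow>\<^sub>E carrier W"
    and zero: "(\<lambda>t\<in>D. \<zero>\<^bsub>W\<^esub>) \<in> F"
    and add: "\<And>f g. f \<in> F \<Longrightarrow> g \<in> F \<Longrightarrow> (\<lambda>t\<in>D. f t \<oplus>\<^bsub>W\<^esub> g t) \<in> F"
    and smult: "\<And>c f. f \<in> F \<Longrightarrow> (\<lambda>t\<in>D. c \<odot>\<^bsub>W\<^esub> f t) \<in> F"
  shows "Module.module scalars (fun_space D W F N)"
proof -
  interpret W: normed_space W by fact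
  have in_W: "f t \<in> carrier W" if "f \<in> F" "t \<in> D" for f t
    using F that by auto
  have ext: "(\<lambda>t\<in>D. f t) = f" if "f \<in> F" for f
    using F that by (metis PiE_restrict subsetD)
  show ?thesis
  proof (rule moduleI[OF cring_scalars])
    show "abelian_group (fun_space D W F N)"
    proof (rule abelian_groupI)
      fix f assume f: "f \<in> carrier (fun_space D W F N)"
      then have "(\<lambda>t\<in>D. (- 1) \<odot>\<^bsub>W\<^esub> f t) \<in> F" using smult by simp
      moreover have "(- 1) \<odot>\<^bsub>W\<^esub> f t \<oplus>\<^bsub>W\<^esub> f t = \<zero>\<^bsub>W\<^esub>" if "t \<in> D" for t
        using f that in_W by (simp flip: W.a_inv_eq_smult add: W.M.l_neg)
      ultimately show "\<exists>g\<in>carrier (fun_space D W F N).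
          g \<oplus>\<^bsub>fun_space D W F N\<^esub> f = \<zero>\<^bsub>fun_space D W F N\<^esub>"
        by (intro bexI[of _ "\<lambda>t\<in>D. (- 1) \<odot>\<^bsub>W\<^esub> f t"]) (auto simp: fun_eq_iff)
      show "\<zero>\<^bsub>fun_space D W F N\<^esub> \<oplus>\<^bsub>fun_space D W F N\<^esub> f = f"
        using f in_W ext by (simp cong: restrict_cong)
    next
      fix f g h
      assume "f \<in> carrier (fun_space D W F N)" "g \<in> carrier (fun_space D W F N)"
        "h \<in> carrier (fun_space D W F N)"
      then show "f \<oplus>\<^bsub>fun_space D W F N\<^esub> g \<oplus>\<^bsub>fun_space D W F N\<^esub> h =
          f \<oplus>\<^bsub>fun_space D W F N\<^esub> (g \<oplus>\<^bsub>fun_space D W F N\<^esub> h)"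
        using in_W by (auto simp: W.M.a_assoc fun_eq_iff)
    next
      fix f g
      assume "f \<in> carrier (fun_space D W F N)" "g \<in> carrier (fun_space D W F N)"
      then show "f \<oplus>\<^bsub>fun_space D W F N\<^esub> g = g \<oplus>\<^bsub>fun_space D W F N\<^esub> f"
        using in_W by (auto simp: W.M.a_comm fun_eq_iff)
    qed (use zero add in auto)
  next
    fix f assume "f \<in> carrier (fun_space D W F N)"
    then show "\<one>\<^bsub>scalars\<^esub> \<odot>\<^bsub>fun_space D W F N\<^esub> f = f"
      using in_W ext by (simp cong: restrict_cong)
  qed (use smult in_W in \<open>auto simp: fun_eq_iff W.smult_add_left W.smult_add_right W.smult_mult\<close>)
qed

lemma normed_space_fun_space:
  assumes "normed_space W" and "F \<subseteq> D \<rightarrow>\<^sub>E carrier W"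
    and "(\<lambda>t\<in>D. \<zero>\<^bsub>W\<^esub>) \<in> F"
    and "\<And>f g. f \<in> F \<Longrightarrow> g \<in> F \<Longrightarrow> (\<lambda>t\<in>D. f t \<oplus>\<^bsub>W\<^esub> g t) \<in> F"
    and "\<And>c f. f \<in> F \<Longrightarrow> (\<lambda>t\<in>D. c \<odot>\<^bsub>W\<^esub> f t) \<in> F"
    and "\<And>f. f \<in> F \<Longrightarrow> N f = 0 \<longleftrightarrow> (\<forall>t\<in>D. f t = \<zero>\<^bsub>W\<^esub>)"
    and "\<And>c f. f \<in> F \<Longrightarrow> N (\<lambda>t\<in>D. c \<odot>\<^bsub>W\<^esub> f t) = norm c * N f"
    and "\<And>f g. f \<in> F \<Longrightarrow> g \<in> F \<Longrightarrow> N (\<lambda>t\<in>D. f t \<oplus>\<^bsub>W\<^esub> g t) \<le> N f + N g"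
  shows "normed_space (fun_space D W F N)"
proof (intro normed_space.intro normed_space_axioms.intro)
  show "Module.module scalars (fun_space D W F N)"
    by (rule module_fun_space[OF assms(1-5)])
  fix f assume "f \<in> carrier (fun_space D W F N)"
  moreover from this have "(\<forall>t\<in>D. f t = \<zero>\<^bsub>W\<^esub>) \<longleftrightarrow> f = (\<lambda>t\<in>D. \<zero>\<^bsub>W\<^esub>)"
    using assms(2) by (auto simp: fun_eq_iff PiE_def extensional_def)
  ultimately show "vnorm (fun_space D W F N) f = 0 \<longleftrightarrow> f = \<zero>\<^bsub>fun_space D W F N\<^esub>"
    using assms(6) by simp
qed (use assms in auto)

lemma finsum_fun_space:
  assumes "normed_space W" and "Module.module scalars (fun_space D W F N)"
    and F: "F \<subseteq> D \<rightarrow>\<^sub>E carrier W" and f: "\<And>i. i \<in> A \<Longrightarrow> f i \<in> F"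
  shows "finsum (fun_space D W F N) f A = (\<lambda>t\<in>D. finsum W (\<lambda>i. f i t) A)"
proof -
  interpret W: normed_space W by fact
  interpret M: Module.module scalars "fun_space D W F N" by fact
  have in_W: "f i t \<in> carrier W" if "i \<in> A" "t \<in> D" for i t
    using F f that by auto
  show ?thesis
    using f in_W
  proof (induction A rule: infinite_finite_induct)
    case (insert a A)
    have "finsum (fun_space D W F N) f (insert a A)
        = (\<lambda>t\<in>D. f a t \<oplus>\<^bsub>W\<^esub> finsum W (\<lambda>i. f i t) A)"
      using insert by (subst M.M.finsum_insert) (auto simp: fun_eq_iff)
    also have "\<dots> = (\<lambda>t\<in>D. finsum W (\<lambda>i. f i t) (insert a A))"
      using insert by (intro restrict_ext) (subst W.M.finsum_insert, auto)
    finally show ?case .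
  qed (auto simp: M.M.finsum_infinite W.M.finsum_infinite)
qed

section \<open>Linear maps, bounded operators and bilinear maps\<close>

lemma linear_maps_closed: "T \<in> linear_maps V W \<Longrightarrow> x \<in> carrier V \<Longrightarrow> T x \<in> carrier W"
  by (auto simp: linear_maps_def)

lemma linear_maps_add:
  "T \<in> linear_maps V W \<Longrightarrow> x \<in> carrier V \<Longrightarrow> y \<in> carrier V \<Longrightarrow>
    T (x \<oplus>\<^bsub>V\<^esub> y) = T x \<oplus>\<^bsub>W\<^esub> T y"
  by (auto simp: linear_maps_def)

lemma linear_maps_smult:
  "T \<in> linear_maps V W \<Longrightarrow> x \<in> carrier V \<Longrightarrow> T (c \<odot>\<^bsub>V\<^esub> x) = c \<odot>\<^bsub>W\<^esub> T x"
  by (auto simp: linear_maps_def)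

lemma bounded_ops_linear: "T \<in> bounded_ops V W \<Longrightarrow> T \<in> linear_maps V W"
  by (auto simp: bounded_ops_def)

lemma linear_maps_zero:
  assumes "normed_space V" "normed_space W" "T \<in> linear_maps V W"
  shows "T \<zero>\<^bsub>V\<^esub> = \<zero>\<^bsub>W\<^esub>"
proof -
  interpret V: normed_space V by fact
  interpret W: normed_space W by fact
  have "T (0 \<odot>\<^bsub>V\<^esub> \<zero>\<^bsub>V\<^esub>) = 0 \<odot>\<^bsub>W\<^esub> T \<zero>\<^bsub>V\<^esub>"
    by (rule linear_maps_smult[OF assms(3)]) simp
  then show ?thesis using linear_maps_closed[OF assms(3)] by simp
qed

lemma linear_maps_finsum:
  assumes "normed_space V" "normed_space W" "T \<in> linear_maps V W"
    and "\<And>i. i \<in> A \<Longrightarrow> f i \<in> carrier V"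
  shows "T (finsum V f A) = finsum W (\<lambda>i. T (f i)) A"
proof -
  interpret V: normed_space V by fact
  interpret W: normed_space W by fact
  note T = linear_maps_closed[OF assms(3)] linear_maps_add[OF assms(3)]
    linear_maps_zero[OF assms(1-3)]
  show ?thesis
    using assms(4)
  proof (induction A rule: infinite_finite_induct)
    case (insert a A)
    then show ?case
      by (subst V.M.finsum_insert, simp, simp, force, simp, subst W.M.finsum_insert)
        (auto simp: T V.finsum_in)
  qed (auto simp: V.M.finsum_infinite W.M.finsum_infinite T)
qed

lemma linear_maps_diff:
  assumes "normed_space V" "normed_space W" "T \<in> linear_maps V W"
    and "x \<in> carrier V" "y \<in> carrier V"
  shows "T (x \<ominus>\<^bsub>V\<^esub> y) = T x \<ominus>\<^bsub>W\<^esub> T y"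
proof -
  interpret V: normed_space V by fact
  interpret W: normed_space W by fact
  show ?thesis
    using assms(4,5) linear_maps_closed[OF assms(3)]
    by (simp add: a_minus_def V.a_inv_eq_smult W.a_inv_eq_smult linear_maps_add[OF assms(3)]
        linear_maps_smult[OF assms(3)])
qed

lemma bounded_ops_bound:
  assumes "normed_space V" "T \<in> bounded_ops V W"
  obtains C where "0 \<le> C" "\<And>x. x \<in> carrier V \<Longrightarrow> vnorm W (T x) \<le> C * vnorm V x"
proof -
  interpret V: normed_space V by fact
  obtain C where C: "\<And>x. x \<in> carrier V \<Longrightarrow> vnorm W (T x) \<le> C * vnorm V x"
    using assms(2) unfolding bounded_ops_def by blast
  show thesis
  proof (rule that[of "\<bar>C\<bar>"])
    fix x assume "x \<in> carrier V"
    then show "vnorm W (T x) \<le> \<bar>C\<bar> * vnorm V x"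
      using C[of x] mult_right_mono[OF abs_ge_self[of C], of "vnorm V x"] V.vnorm_nonneg[of x]
      by linarith
  qed simp
qed

lemma op_space_simps:
  "carrier (op_space V W) = bounded_ops V W"
  "add (op_space V W) = (\<lambda>f g. \<lambda>t\<in>carrier V. f t \<oplus>\<^bsub>W\<^esub> g t)"
  "smult (op_space V W) = (\<lambda>c f. \<lambda>t\<in>carrier V. c \<odot>\<^bsub>W\<^esub> f t)"
  by (simp_all add: op_space_def)

lemma op_norm_le:
  assumes "normed_space V" "0 \<le> C" "\<And>x. x \<in> carrier V \<Longrightarrow> vnorm W (T x) \<le> C * vnorm V x"
  shows "vnorm (op_space V W) T \<le> C"
proof -
  interpret V: normed_space V by fact
  show ?thesis
    unfolding op_space_def fun_space_simps
  proof (rule cSUP_least)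
    show "unit_ball V \<noteq> {}" using V.vnorm_zero by (auto simp: unit_ball_def intro!: exI[of _ "\<zero>\<^bsub>V\<^esub>"])
    fix x assume "x \<in> unit_ball V"
    then show "vnorm W (T x) \<le> C"
      using assms(3)[of x] mult_left_mono[OF _ assms(2), of "vnorm V x" 1]
      by (auto simp: unit_ball_def)
  qed
qed

lemma op_norm_ge:
  assumes "normed_space V" "T \<in> bounded_ops V W" "x \<in> carrier V" "vnorm V x \<le> 1"
  shows "vnorm W (T x) \<le> vnorm (op_space V W) T"
proof -
  interpret V: normed_space V by fact
  obtain C where C: "0 \<le> C" "\<And>x. x \<in> carrier V \<Longrightarrow> vnorm W (T x) \<le> C * vnorm V x"
    using bounded_ops_bound[OF assms(1,2)] by metis
  have "vnorm W (T x) \<le> C" if "x \<in> unit_ball V" for x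
    using C(2)[of x] that mult_left_mono[OF _ C(1), of "vnorm V x" 1] by (auto simp: unit_ball_def)
  then have "bdd_above ((\<lambda>x. vnorm W (T x)) ` unit_ball V)" by (rule bdd_aboveI2)
  then show ?thesis
    unfolding op_space_def fun_space_simps using assms(3,4)
    by (intro cSUP_upper) (auto simp: unit_ball_def)
qed

lemma op_norm_nonneg:
  assumes "normed_space V" "normed_space W" "T \<in> bounded_ops V W"
  shows "0 \<le> vnorm (op_space V W) T"
proof -
  interpret V: normed_space V by fact
  interpret W: normed_space W by fact
  have "vnorm W (T \<zero>\<^bsub>V\<^esub>) \<le> vnorm (op_space V W) T"
    by (rule op_norm_ge[OF assms(1,3)]) auto
  then show ?thesis
    using linear_maps_zero[OF assms(1,2) bounded_ops_linear[OF assms(3)]] by simp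
qed

lemma op_norm_bound:
  assumes "normed_space V" "normed_space W" "T \<in> bounded_ops V W" "x \<in> carrier V"
  shows "vnorm W (T x) \<le> vnorm (op_space V W) T * vnorm V x"
proof -
  interpret V: normed_space V by fact
  interpret W: normed_space W by fact
  note T = bounded_ops_linear[OF assms(3)]
  show ?thesis
  proof (cases "x = \<zero>\<^bsub>V\<^esub>")
    case True
    then show ?thesis using linear_maps_zero[OF assms(1,2) T] by simp
  next
    case False
    define t where "t = vnorm V x"
    have t: "t > 0" using False V.vnorm_nonneg[OF assms(4)] V.vnorm_eq_0[OF assms(4)]
      by (simp add: t_def)
    define y where "y = (of_real (1/t)) \<odot>\<^bsub>V\<^esub> x"
    have "x = of_real t \<odot>\<^bsub>V\<^esub> y"
      using t assms(4) by (simp add: y_def flip: V.smult_mult of_real_mult)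
    moreover have y: "y \<in> carrier V" "vnorm V y \<le> 1"
      using assms(4) t by (auto simp: y_def V.vnorm_smult norm_divide t_def[symmetric] simp del: of_real_divide)
    ultimately have "vnorm W (T x) = t * vnorm W (T y)"
      using t linear_maps_closed[OF T y(1)]
      by (simp add: linear_maps_smult[OF T] W.vnorm_smult)
    also have "\<dots> \<le> t * vnorm (op_space V W) T"
      using t op_norm_ge[OF assms(1,3) y] by (intro mult_left_mono) auto
    finally show ?thesis by (simp add: t_def mult.commute)
  qed
qed

text \<open>The uncurried form of an operator from \<open>Z\<close> into
  \<open>op_space X Y\<close>, with its bound carried along as \<open>M\<close>. \<open>B\<close> is
  arbitrary off the carriers, whereas \<open>linear_maps\<close> consists of extensional functions;
  hence the restrictions.\<close>

definition bilinear_op ::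
    "('k::rc_field, 'z) nspace \<Rightarrow> ('k, 'v) nspace \<Rightarrow> ('k, 'y) nspace \<Rightarrow> real
      \<Rightarrow> ('z \<Rightarrow> 'v \<Rightarrow> 'y) \<Rightarrow> bool" where
  "bilinear_op Z X Y M B \<longleftrightarrow>
    (\<forall>x\<in>carrier X. (\<lambda>z\<in>carrier Z. B z x) \<in> linear_maps Z Y) \<and>
    (\<forall>z\<in>carrier Z. (\<lambda>x\<in>carrier X. B z x) \<in> linear_maps X Y) \<and>
    (\<forall>z\<in>carrier Z. \<forall>x\<in>carrier X. vnorm Y (B z x) \<le> M * vnorm Z z * vnorm X x)"

lemma bilinear_op_closed:
  "bilinear_op Z X Y M B \<Longrightarrow> z \<in> carrier Z \<Longrightarrow> x \<in> carrier X \<Longrightarrow> B z x \<in> carrier Y"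
  unfolding bilinear_op_def using linear_maps_closed[of "\<lambda>z\<in>carrier Z. B z x" Z Y z] by auto

lemma bilinear_op_bound:
  "bilinear_op Z X Y M B \<Longrightarrow> z \<in> carrier Z \<Longrightarrow> x \<in> carrier X \<Longrightarrow>
    vnorm Y (B z x) \<le> M * vnorm Z z * vnorm X x"
  unfolding bilinear_op_def by blast

lemma bilinear_op_sum_left:
  assumes "normed_space Z" "normed_space Y" "bilinear_op Z X Y M B" "x \<in> carrier X"
    and "\<And>i. i \<in> A \<Longrightarrow> f i \<in> carrier Z"
  shows "B (finsum Z f A) x = finsum Y (\<lambda>i. B (f i) x) A"
proof -
  interpret Z: normed_space Z by fact
  interpret Y: normed_space Y by fact
  have "(\<lambda>z\<in>carrier Z. B z x) \<in> linear_maps Z Y"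
    using assms(3,4) by (auto simp: bilinear_op_def)
  then have "(\<lambda>z\<in>carrier Z. B z x) (finsum Z f A)
      = finsum Y (\<lambda>i. (\<lambda>z\<in>carrier Z. B z x) (f i)) A"
    using assms(5) by (rule linear_maps_finsum[OF assms(1,2)])
  then have "B (finsum Z f A) x = finsum Y (\<lambda>i. (\<lambda>z\<in>carrier Z. B z x) (f i)) A"
    using Z.finsum_in[of A f, OF assms(5)] by simp
  also have "\<dots> = finsum Y (\<lambda>i. B (f i) x) A"
    using assms(3-5) by (intro Y.finsum_eq) (auto simp: bilinear_op_closed)
  finally show ?thesis .
qed

lemma bilinear_op_sum_right:
  assumes "normed_space X" "normed_space Y" "bilinear_op Z X Y M B" "z \<in> carrier Z"
    and "\<And>i. i \<in> A \<Longrightarrow> f i \<in> carrier X"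
  shows "B z (finsum X f A) = finsum Y (\<lambda>i. B z (f i)) A"
proof -
  interpret X: normed_space X by fact
  interpret Y: normed_space Y by fact
  have "(\<lambda>x\<in>carrier X. B z x) \<in> linear_maps X Y"
    using assms(3,4) by (auto simp: bilinear_op_def)
  then have "(\<lambda>x\<in>carrier X. B z x) (finsum X f A)
      = finsum Y (\<lambda>i. (\<lambda>x\<in>carrier X. B z x) (f i)) A"
    using assms(5) by (rule linear_maps_finsum[OF assms(1,2)])
  then have "B z (finsum X f A) = finsum Y (\<lambda>i. (\<lambda>x\<in>carrier X. B z x) (f i)) A"
    using X.finsum_in[of A f, OF assms(5)] by simp
  also have "\<dots> = finsum Y (\<lambda>i. B z (f i)) A"
    using assms(3-5) by (intro Y.finsum_eq) (auto simp: bilinear_op_closed)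
  finally show ?thesis .
qed

lemma bilinear_op_add_left:
  assumes "bilinear_op Z X Y M B" "x \<in> carrier X" "z \<in> carrier Z" "w \<in> carrier Z"
    "z \<oplus>\<^bsub>Z\<^esub> w \<in> carrier Z"
  shows "B (z \<oplus>\<^bsub>Z\<^esub> w) x = B z x \<oplus>\<^bsub>Y\<^esub> B w x"
  using assms linear_maps_add[of "\<lambda>z\<in>carrier Z. B z x" Z Y z w] by (simp add: bilinear_op_def)

lemma bilinear_op_add_right:
  assumes "bilinear_op Z X Y M B" "z \<in> carrier Z" "x \<in> carrier X" "y \<in> carrier X"
    "x \<oplus>\<^bsub>X\<^esub> y \<in> carrier X"
  shows "B z (x \<oplus>\<^bsub>X\<^esub> y) = B z x \<oplus>\<^bsub>Y\<^esub> B z y"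
  using assms linear_maps_add[of "\<lambda>x\<in>carrier X. B z x" X Y x y] by (simp add: bilinear_op_def)

lemma bilinear_op_smult_left:
  assumes "bilinear_op Z X Y M B" "x \<in> carrier X" "z \<in> carrier Z" "c \<odot>\<^bsub>Z\<^esub> z \<in> carrier Z"
  shows "B (c \<odot>\<^bsub>Z\<^esub> z) x = c \<odot>\<^bsub>Y\<^esub> B z x"
  using assms linear_maps_smult[of "\<lambda>z\<in>carrier Z. B z x" Z Y z c] by (simp add: bilinear_op_def)

lemma bilinear_op_smult_right:
  assumes "bilinear_op Z X Y M B" "z \<in> carrier Z" "x \<in> carrier X" "c \<odot>\<^bsub>X\<^esub> x \<in> carrier X"
  shows "B z (c \<odot>\<^bsub>X\<^esub> x) = c \<odot>\<^bsub>Y\<^esub> B z x"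
  using assms linear_maps_smult[of "\<lambda>x\<in>carrier X. B z x" X Y x c] by (simp add: bilinear_op_def)

lemma bilinear_op_of_bounded_ops:
  assumes "normed_space Z" "normed_space X" "normed_space Y" "S \<in> bounded_ops Z (op_space X Y)"
  obtains M where "0 \<le> M" "bilinear_op Z X Y M S"
proof -
  interpret Z: normed_space Z by fact
  interpret X: normed_space X by fact
  obtain M where M: "0 \<le> M" "\<And>z. z \<in> carrier Z \<Longrightarrow> vnorm (op_space X Y) (S z) \<le> M * vnorm Z z"
    using bounded_ops_bound[OF assms(1,4)] by metis
  note lin = bounded_ops_linear[OF assms(4)]
  have S: "S z \<in> bounded_ops X Y" if "z \<in> carrier Z" for z
    using linear_maps_closed[OF lin that] by (simp add: op_space_simps)
  have "bilinear_op Z X Y M S"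
    unfolding bilinear_op_def
  proof (intro conjI ballI)
    fix x assume x: "x \<in> carrier X"
    have "S (z \<oplus>\<^bsub>Z\<^esub> w) x = S z x \<oplus>\<^bsub>Y\<^esub> S w x" if "z \<in> carrier Z" "w \<in> carrier Z" for z w
      using linear_maps_add[OF lin that] x by (simp add: op_space_simps)
    moreover have "S (c \<odot>\<^bsub>Z\<^esub> z) x = c \<odot>\<^bsub>Y\<^esub> S z x" if "z \<in> carrier Z" for c z
      using linear_maps_smult[OF lin that] x by (simp add: op_space_simps)
    ultimately show "(\<lambda>z\<in>carrier Z. S z x) \<in> linear_maps Z Y"
      unfolding linear_maps_def
      using x by (auto intro: linear_maps_closed[OF bounded_ops_linear[OF S]])
  next
    fix z assume z: "z \<in> carrier Z"
    have "S z \<in> linear_maps X Y" by (rule bounded_ops_linear[OF S[OF z]])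
    moreover from this have "(\<lambda>x\<in>carrier X. S z x) = S z"
      by (intro ext) (auto simp: linear_maps_def PiE_def extensional_def)
    ultimately show "(\<lambda>x\<in>carrier X. S z x) \<in> linear_maps X Y" by simp
    fix x assume x: "x \<in> carrier X"
    have "vnorm Y (S z x) \<le> vnorm (op_space X Y) (S z) * vnorm X x"
      by (rule op_norm_bound[OF assms(2,3) S[OF z] x])
    also have "\<dots> \<le> M * vnorm Z z * vnorm X x"
      using M(2)[OF z] x by (intro mult_right_mono) auto
    finally show "vnorm Y (S z x) \<le> M * vnorm Z z * vnorm X x" .
  qed
  with M(1) show thesis by (rule that)
qed

lemma bounded_ops_of_bilinear_op:
  assumes "normed_space Z" "normed_space X" "normed_space Y" "0 \<le> M" "bilinear_op Z X Y M B"
  shows "(\<lambda>z\<in>carrier Z. \<lambda>x\<in>carrier X. B z x) \<in> bounded_ops Z (op_space X Y)" (is "?S \<in> _")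
proof -
  interpret Z: normed_space Z by fact
  interpret X: normed_space X by fact
  have S: "(\<lambda>x\<in>carrier X. B z x) \<in> bounded_ops X Y" if "z \<in> carrier Z" for z
    unfolding bounded_ops_def using assms(5) that
    by (auto simp: bilinear_op_def intro!: exI[of _ "M * vnorm Z z"])
  have "?S \<in> linear_maps Z (op_space X Y)"
    unfolding linear_maps_def op_space_simps
    using assms(5) S by (auto simp: fun_eq_iff bilinear_op_add_left bilinear_op_smult_left)
  moreover have "vnorm (op_space X Y) (?S z) \<le> M * vnorm Z z" if "z \<in> carrier Z" for z
    using assms that by (intro op_norm_le) (auto simp: bilinear_op_bound)
  ultimately show ?thesis
    unfolding bounded_ops_def by blast
qed

subsection \<open>Scalar continuous functions\<close>

lemma cont_space_simps:
  "carrier (cont_space \<Omega> X) = {f \<in> extensional (topspace \<Omega>). continuous_map \<Omega> (vtopology X) f}"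
  "zero (cont_space \<Omega> X) = (\<lambda>\<omega>\<in>topspace \<Omega>. \<zero>\<^bsub>X\<^esub>)"
  "add (cont_space \<Omega> X) = (\<lambda>f g. \<lambda>\<omega>\<in>topspace \<Omega>. f \<omega> \<oplus>\<^bsub>X\<^esub> g \<omega>)"
  "smult (cont_space \<Omega> X) = (\<lambda>c f. \<lambda>\<omega>\<in>topspace \<Omega>. c \<odot>\<^bsub>X\<^esub> f \<omega>)"
  by (simp_all add: cont_space_def)

lemma scalar_cont_carrier:
  "\<phi> \<in> carrier (scalar_cont_space \<Omega>) \<longleftrightarrow>
    \<phi> \<in> extensional (topspace \<Omega>) \<and> continuous_map \<Omega> euclidean \<phi>"
  by (simp add: cont_space_simps vdist_scalars)

text \<open>Compactness makes the set of absolute values bounded; for an unbounded set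
  \<open>Sup\<close> would say nothing.\<close>

lemma scalar_cont_norm_ge:
  assumes "compact_space \<Omega>" "\<phi> \<in> carrier (scalar_cont_space \<Omega>)" "\<omega> \<in> topspace \<Omega>"
  shows "norm (\<phi> \<omega>) \<le> vnorm (scalar_cont_space \<Omega>) \<phi>"
proof -
  have "compactin euclidean (\<phi> ` topspace \<Omega>)"
    using assms by (intro image_compactin[of \<Omega>]) (auto simp: compact_space_def scalar_cont_carrier)
  then have "compact (\<phi> ` topspace \<Omega>)" by simp
  then obtain R where R: "\<And>z. z \<in> \<phi> ` topspace \<Omega> \<Longrightarrow> norm z \<le> R"
    using compact_imp_bounded bounded_iff by metis
  have "bdd_above (insert 0 ((\<lambda>\<omega>. norm (\<phi> \<omega>)) ` topspace \<Omega>))"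
    by (simp, rule bdd_aboveI2[of _ _ R]) (use R in auto)
  then show ?thesis
    using assms(3) by (auto simp: cont_space_def intro!: cSup_upper)
qed

lemma scalar_cont_norm_le:
  assumes "0 \<le> C" "\<And>\<omega>. \<omega> \<in> topspace \<Omega> \<Longrightarrow> norm (\<phi> \<omega>) \<le> C"
  shows "vnorm (scalar_cont_space \<Omega>) \<phi> \<le> C"
  using assms by (auto simp: cont_space_def intro!: cSup_least)

lemma scalar_cont_norm_nonneg:
  assumes "compact_space \<Omega>" "\<phi> \<in> carrier (scalar_cont_space \<Omega>)"
  shows "0 \<le> vnorm (scalar_cont_space \<Omega>) \<phi>"
proof (cases "topspace \<Omega> = {}")
  case True
  then show ?thesis by (simp add: cont_space_def)
next
  case False
  then obtain \<omega> where "\<omega> \<in> topspace \<Omega>" by blast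
  from scalar_cont_norm_ge[OF assms this] show ?thesis
    using norm_ge_zero order_trans by blast
qed

lemma restrict_scalar_cont:
  "continuous_map \<Omega> euclidean \<phi> \<Longrightarrow> (\<lambda>\<omega>\<in>topspace \<Omega>. \<phi> \<omega>) \<in> carrier (scalar_cont_space \<Omega>)"
  unfolding scalar_cont_carrier by (auto intro: continuous_map_eq)

lemma normed_space_scalar_cont:
  assumes "compact_space (\<Omega> :: 't topology)"
  shows "normed_space (scalar_cont_space \<Omega> :: ('k::rc_field, 't \<Rightarrow> 'k) nspace)"
proof -
  let ?Z = "scalar_cont_space \<Omega> :: ('k, 't \<Rightarrow> 'k) nspace"
  let ?F = "carrier ?Z" and ?N = "vnorm ?Z"
  interpret S: normed_space "scalars :: ('k, 'k) nspace" by (rule normed_space_scalars)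
  note ge = scalar_cont_norm_ge[OF assms] and nn = scalar_cont_norm_nonneg[OF assms]
  have cont: "continuous_map \<Omega> euclidean \<phi>" if "\<phi> \<in> ?F" for \<phi>
    using that by (simp add: scalar_cont_carrier)
  have add: "(\<lambda>t\<in>topspace \<Omega>. f t + g t) \<in> ?F" if "f \<in> ?F" "g \<in> ?F" for f g
    using S.continuous_map_add[of \<Omega> f g] cont[OF that(1)] cont[OF that(2)]
    by (intro restrict_scalar_cont) (simp add: vdist_scalars)
  have smult: "(\<lambda>t\<in>topspace \<Omega>. c * f t) \<in> ?F" if "f \<in> ?F" for c f
    using S.continuous_map_smult_const[of \<Omega> f c] cont[OF that]
    by (intro restrict_scalar_cont) (simp add: vdist_scalars)
  have le: "?N (\<lambda>t\<in>topspace \<Omega>. c * f t) \<le> norm c * ?N f" if "f \<in> ?F" for c f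
    using ge[OF that] nn[OF that]
    by (intro scalar_cont_norm_le) (auto simp: norm_mult intro!: mult_left_mono)
  have "normed_space (fun_space (topspace \<Omega>) scalars ?F ?N)"
  proof (rule normed_space_fun_space[OF normed_space_scalars])
    show "?F \<subseteq> topspace \<Omega> \<rightarrow>\<^sub>E carrier scalars" by (auto simp: scalar_cont_carrier PiE_def)
    show "(\<lambda>t\<in>topspace \<Omega>. \<zero>\<^bsub>scalars\<^esub>) \<in> ?F" by (intro restrict_scalar_cont) simp
    fix f :: "'t \<Rightarrow> 'k" assume f: "f \<in> ?F"
    show "?N f = 0 \<longleftrightarrow> (\<forall>t\<in>topspace \<Omega>. f t = \<zero>\<^bsub>scalars\<^esub>)"
    proof
      assume "?N f = 0"
      then show "\<forall>t\<in>topspace \<Omega>. f t = \<zero>\<^bsub>scalars\<^esub>" using ge[OF f] by auto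
    next
      assume "\<forall>t\<in>topspace \<Omega>. f t = \<zero>\<^bsub>scalars\<^esub>"
      then have "?N f \<le> 0" by (intro scalar_cont_norm_le) auto
      then show "?N f = 0" using nn[OF f] by simp
    qed
    fix c :: 'k
    show "?N (\<lambda>t\<in>topspace \<Omega>. c \<odot>\<^bsub>scalars\<^esub> f t) = norm c * ?N f"
    proof (rule antisym)
      show "norm c * ?N f \<le> ?N (\<lambda>t\<in>topspace \<Omega>. c \<odot>\<^bsub>scalars\<^esub> f t)"
      proof (cases "c = 0")
        case True
        then show ?thesis using nn[OF smult[OF f, of 0]] by simp
      next
        case False
        \<comment> \<open>The remaining inequality is \<open>le\<close> for the function
          \<open>c * f\<close> and the inverse scalar.\<close>
        have "(\<lambda>t\<in>topspace \<Omega>. inverse c * (\<lambda>t\<in>topspace \<Omega>. c * f t) t) = f"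
          using f False by (auto simp: fun_eq_iff scalar_cont_carrier extensional_def)
        then have "?N f \<le> norm (inverse c) * ?N (\<lambda>t\<in>topspace \<Omega>. c * f t)"
          using le[OF smult[OF f], of "inverse c" c] by simp
        then show ?thesis using False by (simp add: norm_divide field_simps)
      qed
    qed (use le[OF f] in simp)
    fix g :: "'t \<Rightarrow> 'k" assume g: "g \<in> ?F"
    show "?N (\<lambda>t\<in>topspace \<Omega>. f t \<oplus>\<^bsub>scalars\<^esub> g t) \<le> ?N f + ?N g"
      using ge[OF f] ge[OF g] nn[OF f] nn[OF g]
      by (intro scalar_cont_norm_le) (auto intro!: norm_triangle_mono)
  qed (use add smult in auto)
  moreover have "fun_space (topspace \<Omega>) scalars ?F ?N = ?Z"
    by (simp add: cont_space_def fun_space_def)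
  ultimately show ?thesis by simp
qed

lemma scalar_cont_finsum:
  assumes "compact_space \<Omega>" and "\<And>i. i \<in> A \<Longrightarrow> f i \<in> carrier (scalar_cont_space \<Omega>)"
  shows "finsum (scalar_cont_space \<Omega>) f A = (\<lambda>\<omega>\<in>topspace \<Omega>. \<Sum>i\<in>A. f i \<omega>)"
proof -
  interpret Z: normed_space "scalar_cont_space \<Omega>" by (rule normed_space_scalar_cont[OF assms(1)])
  have *: "{f \<in> extensional (topspace \<Omega>). continuous_map \<Omega> (vtopology scalars) f}
      \<subseteq> topspace \<Omega> \<rightarrow>\<^sub>E carrier scalars"
    by (auto simp: PiE_def)
  show ?thesis
    using finsum_fun_space[OF normed_space_scalars Z.module_axioms[unfolded cont_space_def] *, of A f] assms(2)
    by (simp add: cont_space_def)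
qed

subsection \<open>The Hahn--Banach theorem\<close>

context rc_module
begin

text \<open>One-sided homogeneity is what passes easily to an infimum; equality follows by applying
  it to \<open>1 / t\<close>. Admitting \<open>t = 0\<close>, together with subadditivity, forces
  the value \<open>0\<close> at the origin.\<close>

definition sublinear :: "('v \<Rightarrow> real) \<Rightarrow> bool" where
  "sublinear q \<longleftrightarrow>
    (\<forall>x\<in>carrier V. \<forall>y\<in>carrier V. q (x \<oplus> y) \<le> q x + q y) \<and>
    (\<forall>x\<in>carrier V. \<forall>t\<ge>0. q (of_real t \<odot> x) \<le> t * q x)"

lemma sublinear_add: "sublinear q \<Longrightarrow> x \<in> carrier V \<Longrightarrow> y \<in> carrier V \<Longrightarrow> q (x \<oplus> y) \<le> q x + q y"
  by (auto simp: sublinear_def)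

lemma sublinear_smult_le:
  "sublinear q \<Longrightarrow> x \<in> carrier V \<Longrightarrow> 0 \<le> t \<Longrightarrow> q (of_real t \<odot> x) \<le> t * q x"
  by (auto simp: sublinear_def)

lemma sublinear_zero: "sublinear q \<Longrightarrow> q \<zero> = 0"
  using sublinear_smult_le[of q \<zero> 0] sublinear_add[of q \<zero> \<zero>] by simp

lemma sublinear_smult:
  assumes "sublinear q" "x \<in> carrier V" "0 \<le> t"
  shows "q (of_real t \<odot> x) = t * q x"
proof (cases "t = 0")
  case True
  then show ?thesis using assms sublinear_zero by simp
next
  case False
  with assms have "t > 0" by simp
  have "q (of_real (1 / t) \<odot> (of_real t \<odot> x)) \<le> (1 / t) * q (of_real t \<odot> x)"
    using assms \<open>t > 0\<close> by (intro sublinear_smult_le) auto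
  then have "t * q x \<le> q (of_real t \<odot> x)"
    using \<open>t > 0\<close> assms by (simp flip: smult_mult of_real_mult add: field_simps)
  with sublinear_smult_le[OF assms] show ?thesis by simp
qed

lemma sublinear_minus: "sublinear q \<Longrightarrow> x \<in> carrier V \<Longrightarrow> - q (\<ominus> x) \<le> q x"
  using sublinear_add[of q x "\<ominus> x"] sublinear_zero[of q] by (simp add: M.r_neg)

text \<open>The infimum of \<open>q (x + t y) - t q y\<close> over \<open>t \<ge> 0\<close> is a
  smaller sublinear functional, and \<open>t = 1\<close> at \<open>- y\<close> gives the last claim.
  Prescribing \<open>0\<close> off the carrier makes comparison on the carrier the same as
  comparison everywhere, as the minimality argument requires.\<close>

lemma sublinear_reduce:
  assumes q: "sublinear q" and y: "y \<in> carrier V"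
  obtains q' where "sublinear q'" "\<And>x. x \<in> carrier V \<Longrightarrow> q' x \<le> q x"
    "\<And>x. x \<notin> carrier V \<Longrightarrow> q' x = 0" "q' (\<ominus> y) \<le> - q y"
proof -
  define g where "g x t = q (x \<oplus> of_real t \<odot> y) - t * q y" for x t
  define q' where "q' x = (if x \<in> carrier V then INF t\<in>{0..}. g x t else 0)" for x
  \<comment> \<open>This bound does not depend on \<open>t\<close> and makes the infimum
    meaningful.\<close>
  have lower: "- q (\<ominus> x) \<le> g x t" if "x \<in> carrier V" "0 \<le> t" for x t
  proof -
    have "(x \<oplus> of_real t \<odot> y) \<oplus> \<ominus> x = of_real t \<odot> y"
      using that y by (simp add: M.a_assoc M.a_comm[of "of_real t \<odot> y"])
        (simp add: M.a_assoc[symmetric] M.r_neg)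
    then have "t * q y \<le> q (x \<oplus> of_real t \<odot> y) + q (\<ominus> x)"
      using that y sublinear_smult[OF q y that(2)]
        sublinear_add[OF q, of "x \<oplus> of_real t \<odot> y" "\<ominus> x"] by simp
    then show ?thesis by (simp add: g_def)
  qed
  have bdd: "bdd_below (g x ` {0..})" if "x \<in> carrier V" for x
    using lower[OF that] by (intro bdd_belowI2) auto
  have le: "q' x \<le> g x t" if "x \<in> carrier V" "0 \<le> t" for x t
    using that bdd by (auto simp: q'_def intro!: cINF_lower)
  have ge: "z \<le> q' x" if "x \<in> carrier V" "\<And>t. 0 \<le> t \<Longrightarrow> z \<le> g x t" for x z
    using that by (auto simp: q'_def intro!: cINF_greatest)
  have "sublinear q'"
    unfolding sublinear_def
  proof (intro conjI ballI allI impI)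
    fix x z assume xz: "x \<in> carrier V" "z \<in> carrier V"
    \<comment> \<open>Parameters \<open>s\<close> and \<open>t\<close> for the summands combine to
      \<open>s + t\<close> for the sum; the two infima are then taken one after the other.\<close>
    have *: "q' (x \<oplus> z) \<le> g x s + g z t" if "0 \<le> s" "0 \<le> t" for s t
    proof -
      have "(x \<oplus> z) \<oplus> of_real (s + t) \<odot> y = (x \<oplus> of_real s \<odot> y) \<oplus> (z \<oplus> of_real t \<odot> y)"
        using xz y by (simp add: smult_add_left M.a_ac)
      then have "q ((x \<oplus> z) \<oplus> of_real (s + t) \<odot> y)
          \<le> q (x \<oplus> of_real s \<odot> y) + q (z \<oplus> of_real t \<odot> y)"
        using xz y by (simp add: sublinear_add[OF q])
      then have "g (x \<oplus> z) (s + t) \<le> g x s + g z t"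
        by (simp add: g_def algebra_simps)
      then show ?thesis using le[of "x \<oplus> z" "s + t"] xz that by simp
    qed
    have "q' (x \<oplus> z) - g x s \<le> q' z" if "0 \<le> s" for s
      using *[OF that] xz by (intro ge) (auto simp: algebra_simps)
    then have "q' (x \<oplus> z) - q' z \<le> q' x"
      using xz by (intro ge) (auto simp: algebra_simps)
    then show "q' (x \<oplus> z) \<le> q' x + q' z" by simp
  next
    fix x and s :: real assume x: "x \<in> carrier V" and s: "0 \<le> s"
    show "q' (of_real s \<odot> x) \<le> s * q' x"
    proof (cases "s = 0")
      case True
      then show ?thesis using x y le[of \<zero> 0] sublinear_zero[OF q] by (simp add: g_def)
    next
      case False
      with s have "s > 0" by simp
      have "q' (of_real s \<odot> x) / s \<le> q' x"
      proof (rule ge[OF x])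
        fix t :: real assume t: "0 \<le> t"
        have "of_real s \<odot> x \<oplus> of_real (s * t) \<odot> y = of_real s \<odot> (x \<oplus> of_real t \<odot> y)"
          using x y by (simp add: smult_add_right smult_mult)
        then have "g (of_real s \<odot> x) (s * t) = s * g x t"
          using x y s sublinear_smult[OF q, of "x \<oplus> of_real t \<odot> y" s]
          by (simp add: g_def algebra_simps)
        then show "q' (of_real s \<odot> x) / s \<le> g x t"
          using le[of "of_real s \<odot> x" "s * t"] x s t \<open>s > 0\<close> by (simp add: field_simps)
      qed
      then show ?thesis using \<open>s > 0\<close> by (simp add: field_simps)
    qed
  qed
  moreover have "q' x \<le> q x" if "x \<in> carrier V" for x
    using le[OF that, of 0] that y by (simp add: g_def)
  moreover have "q' (\<ominus> y) \<le> - q y"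
    using le[of "\<ominus> y" 1] y sublinear_zero[OF q] by (simp add: g_def M.l_neg)
  ultimately show thesis using that[of q'] by (simp add: q'_def)
qed

text \<open>Subadditivity survives the infimum because, of two members of a chain, the smaller one
  may be used for both arguments. The values at \<open>x\<close> are bounded below by
  \<open>- p (- x)\<close>, since each member is sublinear and below \<open>p\<close>.\<close>

lemma sublinear_chain_Inf:
  assumes "C \<noteq> {}" and sub: "\<And>q. q \<in> C \<Longrightarrow> sublinear q"
    and le_p: "\<And>q x. q \<in> C \<Longrightarrow> x \<in> carrier V \<Longrightarrow> q x \<le> p x"
    and chain: "\<And>q r. q \<in> C \<Longrightarrow> r \<in> C \<Longrightarrow> (\<forall>x. q x \<le> r x) \<or> (\<forall>x. r x \<le> q x)"
  shows "bdd_below ((\<lambda>q. q x) ` C) \<or> x \<notin> carrier V"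
    and "sublinear (\<lambda>x. if x \<in> carrier V then INF q\<in>C. q x else 0)"
proof -
  have bdd: "bdd_below ((\<lambda>q. q x) ` C)" if "x \<in> carrier V" for x
  proof (rule bdd_belowI2)
    fix q assume "q \<in> C"
    then show "- p (\<ominus> x) \<le> q x"
      using sublinear_minus[OF sub that, of q] le_p[of q "\<ominus> x"] that by simp
  qed
  then show "bdd_below ((\<lambda>q. q x) ` C) \<or> x \<notin> carrier V" by metis
  define u where "u x = (INF q\<in>C. q x)" for x
  have le: "u x \<le> q x" if "x \<in> carrier V" "q \<in> C" for x q
    unfolding u_def using that bdd by (intro cINF_lower) auto
  have ge: "z \<le> u x" if "\<And>q. q \<in> C \<Longrightarrow> z \<le> q x" for x z
    unfolding u_def using that \<open>C \<noteq> {}\<close> by (intro cINF_greatest) auto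
  have "u (x \<oplus> y) \<le> u x + u y" if xy: "x \<in> carrier V" "y \<in> carrier V" for x y
  proof -
    have *: "u (x \<oplus> y) \<le> q x + r y" if qr: "q \<in> C" "r \<in> C" for q r
    proof -
      consider "\<forall>x. q x \<le> r x" | "\<forall>x. r x \<le> q x" using chain[OF qr] by metis
      then show ?thesis
      proof cases
        case 1
        then have "q y \<le> r y" by blast
        then show ?thesis
          using le[of "x \<oplus> y" q] sublinear_add[OF sub[OF qr(1)] xy] xy qr by simp
      next
        case 2
        then have "r x \<le> q x" by blast
        then show ?thesis
          using le[of "x \<oplus> y" r] sublinear_add[OF sub[OF qr(2)] xy] xy qr by simp
      qed
    qed
    have "u (x \<oplus> y) - q x \<le> u y" if "q \<in> C" for q
      using *[OF that] by (intro ge) (auto simp: algebra_simps)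
    then have "u (x \<oplus> y) - u y \<le> u x" by (intro ge) (auto simp: algebra_simps)
    then show ?thesis by simp
  qed
  moreover have "u (of_real t \<odot> x) \<le> t * u x" if x: "x \<in> carrier V" and t: "0 \<le> t" for x t
  proof (cases "t = 0")
    case True
    obtain q where q: "q \<in> C" using \<open>C \<noteq> {}\<close> by blast
    then show ?thesis using True x le[of \<zero> q] sublinear_zero[OF sub[OF q]] by simp
  next
    case False
    with t have "t > 0" by simp
    have "u (of_real t \<odot> x) / t \<le> u x"
      using le[of "of_real t \<odot> x"] sublinear_smult[OF sub x t] x \<open>t > 0\<close>
      by (intro ge) (simp add: field_simps)
    then show ?thesis using \<open>t > 0\<close> by (simp add: field_simps)
  qed
  ultimately show "sublinear (\<lambda>x. if x \<in> carrier V then INF q\<in>C. q x else 0)"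
    by (auto simp: sublinear_def u_def)
qed

text \<open>A minimal sublinear functional is linear: otherwise the reduction above makes it
  smaller.\<close>

lemma Hahn_Banach_real:
  assumes p: "sublinear p" and u: "u \<in> carrier V"
  shows "\<exists>f. (\<forall>x\<in>carrier V. \<forall>y\<in>carrier V. f (x \<oplus> y) = f x + f y) \<and>
    (\<forall>x\<in>carrier V. \<forall>t. f (of_real t \<odot> x) = t * f x) \<and>
    (\<forall>x\<in>carrier V. f x \<le> p x) \<and> f u = p u"
proof -
  \<comment> \<open>Reducing at \<open>u\<close> beforehand secures the value at \<open>u\<close>: a
    linear \<open>f \<le> p'\<close> satisfies \<open>- f u \<le> p' (- u) \<le> - p u\<close>, so
    \<open>f u\<close> cannot be less than \<open>p u\<close>.\<close>
  obtain p' where p': "sublinear p'" "\<And>x. x \<in> carrier V \<Longrightarrow> p' x \<le> p x"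
      "\<And>x. x \<notin> carrier V \<Longrightarrow> p' x = 0" "p' (\<ominus> u) \<le> - p u"
    using sublinear_reduce[OF p u] by metis
  define A where "A = {q. sublinear q \<and> (\<forall>x\<in>carrier V. q x \<le> p' x) \<and> (\<forall>x. x \<notin> carrier V \<longrightarrow> q x = 0)}"
  \<comment> \<open>The reversed pointwise order, so that the maximal element delivered by Zorn's
    lemma is a minimal functional.\<close>
  define P :: "('v \<Rightarrow> real) \<Rightarrow> ('v \<Rightarrow> real) \<Rightarrow> bool" where "P q r \<longleftrightarrow> (\<forall>x. r x \<le> q x)" for q r
  have "\<exists>m\<in>A. \<forall>q\<in>A. P m q \<longrightarrow> q = m"
  proof (rule predicate_Zorn)
    show "partial_order_on A (relation_of P A)"
      unfolding partial_order_on_def preorder_on_def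
    proof (intro conjI)
      show "antisym (relation_of P A)"
        by (intro antisymI ext) (auto simp: relation_of_def P_def intro: order_antisym)
      show "trans (relation_of P A)"
        unfolding trans_def relation_of_def P_def by clarsimp (meson order_trans)
    qed (auto simp: relation_of_def refl_on_def P_def)
    fix C assume "C \<in> Chains (relation_of P A)"
    then have C: "C \<subseteq> A" "\<And>q r. q \<in> C \<Longrightarrow> r \<in> C \<Longrightarrow> P q r \<or> P r q"
      by (auto simp: Chains_def relation_of_def)
    show "\<exists>u\<in>A. \<forall>q\<in>C. P q u"
    proof (cases "C = {}")
      case True
      then show ?thesis using p' by (intro bexI[of _ p']) (auto simp: A_def)
    next
      case False
      let ?u = "\<lambda>x. if x \<in> carrier V then INF q\<in>C. q x else 0"
      have C': "\<And>q. q \<in> C \<Longrightarrow> sublinear q" "\<And>q x. q \<in> C \<Longrightarrow> x \<in> carrier V \<Longrightarrow> q x \<le> p' x"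
        "\<And>q r. q \<in> C \<Longrightarrow> r \<in> C \<Longrightarrow> (\<forall>x. q x \<le> r x) \<or> (\<forall>x. r x \<le> q x)"
        using C unfolding A_def P_def by blast+
      have *: "bdd_below ((\<lambda>q. q x) ` C) \<or> x \<notin> carrier V" for x
        using False C' by (rule sublinear_chain_Inf(1))
      have sub_u: "sublinear ?u"
        using False C' by (rule sublinear_chain_Inf(2))
      have le: "?u x \<le> q x" if "q \<in> C" for q x
        using *[of x] that C by (auto simp: A_def intro: cINF_lower)
      moreover have "?u \<in> A"
      proof -
        obtain q where q: "q \<in> C" using False by blast
        have "?u x \<le> p' x" if "x \<in> carrier V" for x
          using le[OF q, of x] q C(1) that by (auto simp: A_def intro: order_trans)
        then show ?thesis using sub_u by (simp add: A_def)
      qed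
      ultimately show ?thesis by (intro bexI[of _ ?u]) (auto simp: P_def)
    qed
  qed
  then obtain m where m: "m \<in> A" and min: "\<And>q. q \<in> A \<Longrightarrow> (\<And>x. q x \<le> m x) \<Longrightarrow> q = m"
    by (auto simp: P_def)
  have sub: "sublinear m" and le_p': "\<And>x. x \<in> carrier V \<Longrightarrow> m x \<le> p' x"
    and off: "\<And>x. x \<notin> carrier V \<Longrightarrow> m x = 0"
    using m by (auto simp: A_def)
  have neg: "m (\<ominus> y) = - m y" if y: "y \<in> carrier V" for y
  proof -
    obtain q where q: "sublinear q" "\<And>x. x \<in> carrier V \<Longrightarrow> q x \<le> m x"
      "\<And>x. x \<notin> carrier V \<Longrightarrow> q x = 0" "q (\<ominus> y) \<le> - m y"
      using sublinear_reduce[OF sub y] by metis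
    have "q \<in> A" using q le_p' by (auto simp: A_def intro: order_trans)
    moreover have "q x \<le> m x" for x using q off by (cases "x \<in> carrier V") auto
    ultimately have "q = m" by (rule min)
    then show ?thesis using q(4) sublinear_minus[OF sub y] by simp
  qed
  have add: "m (x \<oplus> y) = m x + m y" if "x \<in> carrier V" "y \<in> carrier V" for x y
  proof -
    have "(x \<oplus> y) \<oplus> \<ominus> y = x" using that by (simp add: M.a_assoc M.r_neg)
    then show ?thesis
      using sublinear_add[OF sub that] sublinear_add[OF sub, of "x \<oplus> y" "\<ominus> y"] that neg
      by simp
  qed
  have smult: "m (of_real t \<odot> x) = t * m x" if "x \<in> carrier V" for t x
  proof (cases "t \<ge> 0")
    case False
    have "of_real t \<odot> x = \<ominus> (of_real (- t) \<odot> x)"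
      using that by (simp add: smult_uminus)
    then show ?thesis
      using False that neg[of "of_real (- t) \<odot> x"] sublinear_smult[OF sub that, of "- t"] by simp
  qed (use sublinear_smult[OF sub that] in simp)
  have "m u = p u"
    using neg[OF u] le_p'[of "\<ominus> u"] p'(4) le_p'[OF u] p'(2)[OF u] u by simp
  moreover have "m x \<le> p x" if "x \<in> carrier V" for x
    using le_p' p'(2) that order_trans by blast
  ultimately show ?thesis using add smult by blast
qed

text \<open>In the complex case the dominated real-linear \<open>f\<close> is the real part of
  \<open>f x - i f (i x)\<close>, and rotating the argument carries the bound on the real part over
  to the absolute value. The result provides the norming functionals for tensors and for target
  spaces.\<close>

lemma Hahn_Banach_seminorm:
  assumes add: "\<And>x y. x \<in> carrier V \<Longrightarrow> y \<in> carrier V \<Longrightarrow> p (x \<oplus> y) \<le> p x + p y"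
    and smult: "\<And>c x. x \<in> carrier V \<Longrightarrow> p (c \<odot> x) = norm c * p x"
    and u: "u \<in> carrier V"
  obtains T where "T \<in> linear_maps V scalars"
    "\<And>x. x \<in> carrier V \<Longrightarrow> norm (T x) \<le> p x" "T u = of_real (p u)"
proof -
  have "sublinear p" using add smult by (simp add: sublinear_def)
  then obtain f where f: "\<And>x y. x \<in> carrier V \<Longrightarrow> y \<in> carrier V \<Longrightarrow> f (x \<oplus> y) = f x + f y"
    "\<And>x t. x \<in> carrier V \<Longrightarrow> f (of_real t \<odot> x) = t * f x"
    "\<And>x. x \<in> carrier V \<Longrightarrow> f x \<le> p x" "f u = p u"
    using Hahn_Banach_real[OF _ u] by blast
  show thesis
  proof (cases rule: rc_cases[where 'k='k])
    case real
    define T where "T = (\<lambda>x\<in>carrier V. of_real (f x) :: 'k)"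
    have "T (c \<odot> x) = c * T x" if "x \<in> carrier V" for c x
      using real[of c] f(2)[OF that] that by (auto simp: T_def)
    then have "T \<in> linear_maps V scalars"
      using f(1) by (auto simp: linear_maps_def T_def)
    moreover have "norm (T x) \<le> p x" if "x \<in> carrier V" for x
      using f(3)[OF that] f(3)[of "\<ominus> x"] f(2)[OF that, of "- 1"] smult[OF that, of "- 1"] that
      by (auto simp: T_def a_inv_eq_smult abs_le_iff)
    moreover have "T u = of_real (p u)" using f(4) u by (simp add: T_def)
    ultimately show thesis by (rule that)
  next
    case (complex i)
    define T where "T = (\<lambda>x\<in>carrier V. of_real (f x) - of_real (f (i \<odot> x)) * i :: 'k)"
    have ii: "f (i \<odot> (i \<odot> x)) = - f x" if "x \<in> carrier V" for x
      using f(2)[OF that, of "- 1"] that complex(1) by (simp flip: smult_mult)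
    have T_add: "T (x \<oplus> y) = T x + T y" if "x \<in> carrier V" "y \<in> carrier V" for x y
      using that f(1) by (simp add: T_def smult_add_right algebra_simps)
    have T_real: "T (of_real t \<odot> x) = of_real t * T x" if "x \<in> carrier V" for t x
    proof -
      have "i \<odot> (of_real t \<odot> x) = of_real t \<odot> (i \<odot> x)"
        using that by (metis smult_mult mult.commute)
      then show ?thesis using that f(2) by (simp add: T_def algebra_simps)
    qed
    have T_i: "T (i \<odot> x) = i * T x" if "x \<in> carrier V" for x
    proof -
      have "i * (of_real (f (i \<odot> x)) * i) = of_real (f (i \<odot> x)) * (i * i)"
        by (simp only: mult_ac)
      then have "i * (of_real (f (i \<odot> x)) * i) = - of_real (f (i \<odot> x))"
        using complex(1) by simp
      then show ?thesis
        using that ii[OF that] by (simp add: T_def right_diff_distrib mult.commute)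
    qed
    have T_smult: "T (c \<odot> x) = c * T x" if x: "x \<in> carrier V" for c x
    proof -
      obtain a b where c: "c = of_real a + of_real b * i" using complex(2) by blast
      have "T (c \<odot> x) = T (of_real a \<odot> x) + T (of_real b \<odot> (i \<odot> x))"
        using x by (simp add: c smult_add_left smult_mult T_add)
      also have "\<dots> = c * T x"
        using x by (simp add: T_real T_i c algebra_simps)
      finally show ?thesis .
    qed
    have norm_eq: "norm (of_real a - of_real b * i) = sqrt (a\<^sup>2 + b\<^sup>2)" for a b
      using complex(3)[of a "- b"] by simp
    have f_le: "f x \<le> norm (T x)" if "x \<in> carrier V" for x
      using that norm_eq[of "f x" "f (i \<odot> x)"] real_le_rsqrt[of "f x" "(f x)\<^sup>2 + (f (i \<odot> x))\<^sup>2"]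
      by (simp add: T_def)
    have norm_T: "norm (T x) \<le> p x" if x: "x \<in> carrier V" for x
    proof -
      \<comment> \<open>At the vector rotated by \<open>w\<close> the value of \<open>T\<close> is
        real and nonnegative, hence equal to \<open>f\<close> there.\<close>
      obtain w where w: "norm w = 1" "w * T x = of_real (norm (T x))"
        using exists_unimodular_mult by blast
      let ?y = "w \<odot> x"
      have y: "?y \<in> carrier V" using x by simp
      have "T ?y = of_real (norm (T x))" using T_smult[OF x] w by simp
      moreover have "T ?y = of_real (f ?y) - of_real (f (i \<odot> ?y)) * i"
        using y by (simp add: T_def)
      ultimately have "of_real (f ?y - norm (T x)) - of_real (f (i \<odot> ?y)) * i = 0"
        by (simp add: algebra_simps)
      then have "(f ?y - norm (T x))\<^sup>2 + (f (i \<odot> ?y))\<^sup>2 = 0"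
        using norm_eq[of "f ?y - norm (T x)" "f (i \<odot> ?y)"] by simp
      then have "norm (T x) = f ?y" by (simp add: sum_power2_eq_zero_iff)
      also have "\<dots> \<le> p ?y" by (rule f(3)[OF y])
      also have "\<dots> = p x" using smult[OF x] w by simp
      finally show ?thesis .
    qed
    \<comment> \<open>The real part of \<open>T u\<close> is already \<open>p u\<close>, so the
      bound on the absolute value leaves no imaginary part.\<close>
    have "sqrt ((p u)\<^sup>2 + (f (i \<odot> u))\<^sup>2) \<le> p u"
      using norm_T[OF u] u norm_eq[of "f u" "f (i \<odot> u)"] f(4) by (simp add: T_def)
    then have "(p u)\<^sup>2 + (f (i \<odot> u))\<^sup>2 \<le> (p u)\<^sup>2"
      by (rule sqrt_le_D)
    then have "f (i \<odot> u) = 0" by simp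
    then have "T u = of_real (p u)" using u f(4) by (simp add: T_def)
    moreover have "T \<in> linear_maps V scalars"
      using T_add T_smult by (auto simp: linear_maps_def T_def)
    ultimately show thesis using norm_T that by blast
  qed
qed

end

subsection \<open>Weak \<open>\<ell>\<^sub>q\<close> norms\<close>

lemma unit_ball_dual_bound:
  assumes "normed_space Z" "f \<in> unit_ball (dual Z)" "z \<in> carrier Z"
  shows "norm (f z) \<le> vnorm Z z"
proof -
  interpret Z: normed_space Z by fact
  have f: "f \<in> bounded_ops Z scalars" "vnorm (op_space Z scalars) f \<le> 1"
    using assms(2) by (auto simp: unit_ball_def dual_def op_space_simps)
  have "norm (f z) \<le> vnorm (op_space Z scalars) f * vnorm Z z"
    using op_norm_bound[OF assms(1) normed_space_scalars f(1) assms(3)] by simp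
  also have "\<dots> \<le> 1 * vnorm Z z"
    using f(2) assms(3) by (intro mult_right_mono) auto
  finally show ?thesis by simp
qed

lemma unit_ball_dualI:
  assumes "normed_space Z" "f \<in> linear_maps Z scalars"
    and "\<And>z. z \<in> carrier Z \<Longrightarrow> norm (f z) \<le> vnorm Z z"
  shows "f \<in> unit_ball (dual Z)"
proof -
  have "f \<in> bounded_ops Z scalars"
    using assms(2,3) by (auto simp: bounded_ops_def intro!: exI[of _ 1])
  moreover have "vnorm (op_space Z scalars) f \<le> 1"
    using assms(3) by (intro op_norm_le[OF assms(1)]) auto
  ultimately show ?thesis by (simp add: unit_ball_def dual_def op_space_simps)
qed

lemma zero_in_unit_ball_dual:
  assumes "normed_space Z"
  shows "(\<lambda>z\<in>carrier Z. 0) \<in> unit_ball (dual Z)"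
proof -
  interpret Z: normed_space Z by fact
  show ?thesis
    by (rule unit_ball_dualI[OF assms]) (auto simp: linear_maps_def)
qed

lemma weak_lp_norm_le_strong_aux:
  assumes "normed_space Z" "1 \<le> q" "\<And>i. i < n \<Longrightarrow> z i \<in> carrier Z" "f \<in> unit_ball (dual Z)"
  shows "lp_norm_fin q n (\<lambda>i. norm (f (z i))) \<le> lp_norm_fin q n (\<lambda>i. vnorm Z (z i))"
  using unit_ball_dual_bound[OF assms(1,4) assms(3)] assms(2)
  by (intro lp_norm_fin_mono) (auto intro: order_trans abs_ge_self)

lemma weak_lp_norm_ge:
  assumes "normed_space Z" "1 \<le> q" "\<And>i. i < n \<Longrightarrow> z i \<in> carrier Z" "f \<in> unit_ball (dual Z)"
  shows "lp_norm_fin q n (\<lambda>i. norm (f (z i))) \<le> weak_lp_norm q Z n z"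
  unfolding weak_lp_norm_def
  using weak_lp_norm_le_strong_aux[OF assms(1-3)] assms(4)
  by (intro cSUP_upper bdd_aboveI2) auto

lemma weak_lp_norm_le:
  assumes "normed_space Z"
    and "\<And>f. f \<in> unit_ball (dual Z) \<Longrightarrow> lp_norm_fin q n (\<lambda>i. norm (f (z i))) \<le> C"
  shows "weak_lp_norm q Z n z \<le> C"
  unfolding weak_lp_norm_def
  using zero_in_unit_ball_dual[OF assms(1)] assms(2) by (intro cSUP_least) auto

lemma weak_lp_norm_le_strong:
  assumes "normed_space Z" "1 \<le> q" "\<And>i. i < n \<Longrightarrow> z i \<in> carrier Z"
  shows "weak_lp_norm q Z n z \<le> lp_norm_fin q n (\<lambda>i. vnorm Z (z i))"
  using weak_lp_norm_le_strong_aux[OF assms] by (rule weak_lp_norm_le[OF assms(1)])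

lemma weak_lp_norm_nonneg:
  assumes "normed_space Z" "1 \<le> q" "\<And>i. i < n \<Longrightarrow> z i \<in> carrier Z"
  shows "0 \<le> weak_lp_norm q Z n z"
  using weak_lp_norm_ge[OF assms zero_in_unit_ball_dual[OF assms(1)]] lp_norm_fin_nonneg[OF assms(2)]
  by (meson order_trans)

text \<open>Evaluation at a point is a functional of norm at most one. The converse estimate that
  follows shows that evaluations already determine the weak norm.\<close>

lemma weak_lp_norm_ge_point:
  assumes "compact_space \<Omega>" "1 \<le> q" "\<And>i. i < n \<Longrightarrow> \<phi> i \<in> carrier (scalar_cont_space \<Omega>)"
    and "\<omega> \<in> topspace \<Omega>"
  shows "lp_norm_fin q n (\<lambda>i. norm (\<phi> i \<omega>)) \<le> weak_lp_norm q (scalar_cont_space \<Omega>) n \<phi>"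
proof -
  let ?Z = "scalar_cont_space \<Omega>"
  let ?e = "\<lambda>\<phi>\<in>carrier ?Z. \<phi> \<omega>"
  interpret Z: normed_space ?Z by (rule normed_space_scalar_cont[OF assms(1)])
  have "?e \<in> linear_maps ?Z scalars"
    unfolding linear_maps_def
    using assms(4) Z.M.a_closed Z.smult_in by (auto simp: cont_space_simps)
  then have "?e \<in> unit_ball (dual ?Z)"
    by (rule unit_ball_dualI[OF Z.normed_space_axioms])
      (simp add: scalar_cont_norm_ge[OF assms(1) _ assms(4)])
  from weak_lp_norm_ge[OF Z.normed_space_axioms assms(2) assms(3) this]
  have "lp_norm_fin q n (\<lambda>i. norm (?e (\<phi> i))) \<le> weak_lp_norm q ?Z n \<phi>" by simp
  moreover have "lp_norm_fin q n (\<lambda>i. norm (?e (\<phi> i))) = lp_norm_fin q n (\<lambda>i. norm (\<phi> i \<omega>))"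
    using assms(3) by (intro lp_norm_fin_cong) auto
  ultimately show ?thesis by simp
qed

text \<open>By duality of \<open>\<ell>\<^sub>p\<close> and \<open>\<ell>\<^sub>q\<close>, the norm of \<open>(f \<phi>\<^sub>i)\<close> is a value of \<open>f\<close> at a combination
  \<open>\<Sum> c\<^sub>i \<phi>\<^sub>i\<close>.\<close>

lemma weak_lp_norm_le_point:
  fixes \<Omega> :: "'t topology" and \<phi> :: "nat \<Rightarrow> 't \<Rightarrow> 'k::rc_field"
  assumes "compact_space \<Omega>" "1 \<le> p" "\<And>i. i < n \<Longrightarrow> \<phi> i \<in> carrier (scalar_cont_space \<Omega>)" "0 \<le> W"
    and W: "\<And>\<omega>. \<omega> \<in> topspace \<Omega> \<Longrightarrow> lp_norm_fin (conj_index p) n (\<lambda>i. norm (\<phi> i \<omega>)) \<le> W"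
  shows "weak_lp_norm (conj_index p) (scalar_cont_space \<Omega>) n \<phi> \<le> W"
proof (rule weak_lp_norm_le)
  let ?Z = "scalar_cont_space \<Omega> :: ('k, 't \<Rightarrow> 'k) nspace"
  interpret Z: normed_space ?Z by (rule normed_space_scalar_cont[OF assms(1)])
  show "normed_space ?Z" ..
  fix f assume f: "f \<in> unit_ball (dual ?Z)"
  then have f_lin: "f \<in> linear_maps ?Z scalars"
    by (auto simp: unit_ball_def dual_def op_space_simps bounded_ops_def)
  show "lp_norm_fin (conj_index p) n (\<lambda>i. norm (f (\<phi> i))) \<le> W"
    unfolding lp_norm_fin_le_iff_dual[OF assms(2,4)]
  proof (intro allI impI)
    fix b :: "nat \<Rightarrow> real" assume b: "\<forall>i. 0 \<le> b i" "lp_norm_fin p n b \<le> 1"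
    \<comment> \<open>The unimodular factors make each \<open>f (g i)\<close> real and nonnegative,
      so no cancellation occurs in the sum.\<close>
    obtain u where u: "\<And>i. norm (u i) = 1" "\<And>i. u i * f (\<phi> i) = of_real (norm (f (\<phi> i)))"
      using exists_unimodular_mult[of "f (\<phi> _)"] by metis
    define g where "g i = (u i * of_real (b i)) \<odot>\<^bsub>?Z\<^esub> \<phi> i" for i
    have g: "g i \<in> carrier ?Z" if "i < n" for i
      using assms(3)[OF that] by (simp add: g_def)
    have "f (finsum ?Z g {..<n}) = (\<Sum>i<n. f (g i))"
      using g linear_maps_finsum[OF Z.normed_space_axioms normed_space_scalars f_lin, of "{..<n}" g]
      by simp
    also have "\<dots> = (\<Sum>i<n. of_real (norm (f (\<phi> i)) * b i))"
    proof (intro sum.cong refl)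
      fix i assume "i \<in> {..<n}"
      then have "f (g i) = u i * f (\<phi> i) * of_real (b i)"
        using linear_maps_smult[OF f_lin, of "\<phi> i" "u i * of_real (b i)"] assms(3)[of i]
        by (simp add: g_def mult_ac)
      then show "f (g i) = of_real (norm (f (\<phi> i)) * b i)" using u by simp
    qed
    finally have "f (finsum ?Z g {..<n}) = of_real (\<Sum>i<n. norm (f (\<phi> i)) * b i)"
      by (simp only: of_real_sum)
    moreover have "0 \<le> (\<Sum>i<n. norm (f (\<phi> i)) * b i)" using b by (simp add: sum_nonneg)
    ultimately have "(\<Sum>i<n. norm (f (\<phi> i)) * b i) = norm (f (finsum ?Z g {..<n}))"
      by (simp only: norm_of_real abs_of_nonneg)
    also have "\<dots> \<le> vnorm ?Z (finsum ?Z g {..<n})"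
      using g by (intro unit_ball_dual_bound[OF Z.normed_space_axioms f] Z.finsum_in) auto
    also have "\<dots> \<le> W"
    proof (rule scalar_cont_norm_le[OF assms(4)])
      fix \<omega> assume \<omega>: "\<omega> \<in> topspace \<Omega>"
      have "finsum ?Z g {..<n} = (\<lambda>\<omega>\<in>topspace \<Omega>. \<Sum>i<n. g i \<omega>)"
        using g by (intro scalar_cont_finsum[OF assms(1)]) auto
      then have "norm (finsum ?Z g {..<n} \<omega>) \<le> (\<Sum>i<n. norm (g i \<omega>))"
        using \<omega> by (simp add: norm_sum)
      also have "\<dots> = (\<Sum>i<n. \<bar>norm (\<phi> i \<omega>)\<bar> * b i)"
        using \<omega> b u by (intro sum.cong) (auto simp: g_def cont_space_simps norm_mult)
      also have "\<dots> \<le> W"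
        using W[OF \<omega>] b unfolding lp_norm_fin_le_iff_dual[OF assms(2,4)] by blast
      finally show "norm (finsum ?Z g {..<n} \<omega>) \<le> W" .
    qed
    finally show "(\<Sum>i<n. \<bar>norm (f (\<phi> i))\<bar> * b i) \<le> W" by simp
  qed
qed

subsection \<open>From operators on \<open>\<C>\<^sub>p(\<Omega>, X)\<close> to the Chevet--Saphar bound\<close>

text \<open>Boundedness of the linearisation of \<open>B\<close> for the norm \<open>d_p\<close>,
  stated on representations so that it makes sense for values in any \<open>Y\<close>. The sign of
  \<open>C\<close> is left open.\<close>

definition chevet_saphar_bounded ::
    "ennreal \<Rightarrow> ('k::rc_field, 'z) nspace \<Rightarrow> ('k, 'v) nspace \<Rightarrow> ('k, 'y) nspace
      \<Rightarrow> ('z \<Rightarrow> 'v \<Rightarrow> 'y) \<Rightarrow> real \<Rightarrow> bool" where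
  "chevet_saphar_bounded p Z X Y B C \<longleftrightarrow>
    (\<forall>n z x. (\<forall>i<n. z i \<in> carrier Z \<and> x i \<in> carrier X) \<longrightarrow>
      vnorm Y (finsum Y (\<lambda>i. B (z i) (x i)) {..<n}) \<le>
        C * (weak_lp_norm (conj_index p) Z n z * lp_norm_fin p n (\<lambda>i. vnorm X (x i))))"

lemma cp_space_simps:
  "carrier (cp_space p \<Omega> X) = {f \<in> carrier (cont_space \<Omega> X). cp_seqs p \<Omega> X f \<noteq> {}}"
  "zero (cp_space p \<Omega> X) = (\<lambda>\<omega>\<in>topspace \<Omega>. \<zero>\<^bsub>X\<^esub>)"
  "add (cp_space p \<Omega> X) = (\<lambda>f g. \<lambda>\<omega>\<in>topspace \<Omega>. f \<omega> \<oplus>\<^bsub>X\<^esub> g \<omega>)"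
  "smult (cp_space p \<Omega> X) = (\<lambda>c f. \<lambda>\<omega>\<in>topspace \<Omega>. c \<odot>\<^bsub>X\<^esub> f \<omega>)"
  "vnorm (cp_space p \<Omega> X) f = (INF x\<in>cp_seqs p \<Omega> X f. lp_norm p (\<lambda>n. vnorm X (x n)))"
  by (simp_all add: cp_space_def)

locale cp_setup = normed_space X
  for X :: "('k::rc_field, 'x) nspace" (structure) +
  fixes \<Omega> :: "'t topology" and p :: ennreal
  assumes compact: "compact_space \<Omega>" and p_ge_1: "1 \<le> p"
begin

abbreviation "q \<equiv> conj_index p"
abbreviation Z :: "('k, 't \<Rightarrow> 'k) nspace" where "Z \<equiv> scalar_cont_space \<Omega>"
abbreviation "Cp \<equiv> cp_space p \<Omega> X"

lemma q_ge_1: "1 \<le> q"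
  using conj_index_ge_1[OF p_ge_1] .

lemma normed_Z: "normed_space Z"
  by (rule normed_space_scalar_cont[OF compact])

lemma normed_X: "normed_space X" ..

lemma lp_c0_seqs_carrier: "x \<in> lp_c0_seqs p X \<Longrightarrow> x n \<in> carrier X"
  by (simp add: lp_c0_seqs_def)

lemma lp_c0_seqs_lp_seq:
  assumes "x \<in> lp_c0_seqs p X"
  shows "lp_seq p (\<lambda>n. vnorm X (x n))"
proof (cases "p = \<infinity>")
  case True
  then have "(\<lambda>n. vnorm X (x n)) \<longlonglongrightarrow> 0" using assms by (simp add: lp_c0_seqs_def)
  then show ?thesis
    using True convergent_imp_bounded by (auto simp: lp_seq_def)
next
  case False
  then show ?thesis using assms by (simp add: lp_c0_seqs_def)
qed

lemma lp_c0_seqs_fin_le: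
  "x \<in> lp_c0_seqs p X \<Longrightarrow> lp_norm_fin p n (\<lambda>i. vnorm X (x i)) \<le> lp_norm p (\<lambda>i. vnorm X (x i))"
  by (intro lp_norm_fin_le_lp_norm p_ge_1 lp_c0_seqs_lp_seq)

lemma cp_norm_le: "x \<in> cp_seqs p \<Omega> X f \<Longrightarrow> vnorm Cp f \<le> lp_norm p (\<lambda>n. vnorm X (x n))"
  unfolding cp_space_simps
  by (rule cINF_lower)
    (auto intro!: bdd_belowI2[of _ 0] lp_norm_nonneg p_ge_1 lp_c0_seqs_lp_seq simp: cp_seqs_def)

lemma cp_norm_nonneg: "f \<in> carrier Cp \<Longrightarrow> 0 \<le> vnorm Cp f"
  unfolding cp_space_simps
  by (rule cINF_greatest)
    (auto intro!: lp_norm_nonneg p_ge_1 lp_c0_seqs_lp_seq simp: cp_seqs_def)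

lemma finite_support_lp_c0:
  assumes "\<And>n. x n \<in> carrier X" "\<And>i. i \<ge> n \<Longrightarrow> x i = \<zero>"
  shows "x \<in> lp_c0_seqs p X"
    and "lp_norm p (\<lambda>i. vnorm X (x i)) \<le> lp_norm_fin p n (\<lambda>i. vnorm X (x i))"
proof -
  have "i < n" if "vnorm X (x i) \<noteq> 0" for i
    using assms(2)[of i] that by (cases "i < n") auto
  then have "lp_norm_fin p m (\<lambda>i. vnorm X (x i)) \<le> lp_norm_fin p n (\<lambda>i. vnorm X (x i))" for m
    by (intro lp_norm_fin_reindex_le[where h="\<lambda>i. i"] p_ge_1) auto
  from lp_norm_leI[OF p_ge_1 this]
  have *: "lp_seq p (\<lambda>i. vnorm X (x i))"
    and "lp_norm p (\<lambda>i. vnorm X (x i)) \<le> lp_norm_fin p n (\<lambda>i. vnorm X (x i))" .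
  then show "lp_norm p (\<lambda>i. vnorm X (x i)) \<le> lp_norm_fin p n (\<lambda>i. vnorm X (x i))" by simp
  have "(\<lambda>n. vnorm X (x n)) \<longlonglongrightarrow> 0"
    by (rule tendsto_eventually, rule eventually_sequentiallyI[of n]) (simp add: assms(2))
  with * show "x \<in> lp_c0_seqs p X" using assms(1) by (simp add: lp_c0_seqs_def)
qed

text \<open>The factor \<open>W\<close> is moved into the sequence, leaving coefficients
  \<open>\<phi> i \<omega> / W\<close> in the unit ball of \<open>l_q\<close>. This division is why
  \<open>W\<close> has to be strictly positive.\<close>

lemma finite_rank_in_Cp:
  assumes \<phi>: "\<And>i. i < n \<Longrightarrow> \<phi> i \<in> carrier Z" and x: "\<And>i. i < n \<Longrightarrow> x i \<in> carrier X"
    and "0 < W" and W: "\<And>\<omega>. \<omega> \<in> topspace \<Omega> \<Longrightarrow> lp_norm_fin q n (\<lambda>i. norm (\<phi> i \<omega>)) \<le> W"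
  defines "f \<equiv> (\<lambda>\<omega>\<in>topspace \<Omega>. finsum X (\<lambda>i. \<phi> i \<omega> \<odot> x i) {..<n})"
  shows "f \<in> carrier Cp" "vnorm Cp f \<le> W * lp_norm_fin p n (\<lambda>i. vnorm X (x i))"
proof -
  define y where "y i = (if i < n then of_real W \<odot> x i else \<zero>)" for i
  have y: "y i \<in> carrier X" for i using x by (simp add: y_def)
  have y0: "y i = \<zero>" if "i \<ge> n" for i using that by (simp add: y_def)
  have y_seq: "y \<in> lp_c0_seqs p X"
    and "lp_norm p (\<lambda>i. vnorm X (y i)) \<le> lp_norm_fin p n (\<lambda>i. vnorm X (y i))"
    using finite_support_lp_c0[OF y y0] by auto
  note this(2)
  also have "lp_norm_fin p n (\<lambda>i. vnorm X (y i)) \<le> W * lp_norm_fin p n (\<lambda>i. vnorm X (x i))"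
    using \<open>0 < W\<close> x by (intro lp_norm_fin_scale_le p_ge_1) (auto simp: y_def vnorm_smult)
  finally have le: "lp_norm p (\<lambda>i. vnorm X (y i)) \<le> W * lp_norm_fin p n (\<lambda>i. vnorm X (x i))" .
  have "f \<omega> \<in> p_hull p X y" if \<omega>: "\<omega> \<in> topspace \<Omega>" for \<omega>
  proof -
    define \<alpha> where "\<alpha> i = (if i < n then \<phi> i \<omega> / of_real W else 0)" for i
    have "lp_norm_fin q m (\<lambda>i. norm (\<alpha> i)) \<le> 1" for m
    proof -
      have "lp_norm_fin q m (\<lambda>i. norm (\<alpha> i)) \<le> lp_norm_fin q n (\<lambda>i. norm (\<alpha> i))"
        by (intro lp_norm_fin_reindex_le[where h="\<lambda>i. i"] q_ge_1) (auto simp: \<alpha>_def split: if_splits)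
      also have "\<dots> \<le> (1 / W) * lp_norm_fin q n (\<lambda>i. norm (\<phi> i \<omega>))"
        using \<open>0 < W\<close> by (intro lp_norm_fin_scale_le q_ge_1) (auto simp: \<alpha>_def norm_divide)
      also have "\<dots> \<le> 1" using W[OF \<omega>] \<open>0 < W\<close> by (simp add: field_simps)
      finally show ?thesis .
    qed
    then have \<alpha>: "\<alpha> \<in> lp_ball q" by (simp add: lp_ball_iff q_ge_1)
    have in_X: "\<alpha> i \<odot> y i \<in> carrier X" for i using y by simp
    have f\<omega>: "f \<omega> \<in> carrier X" using \<omega> x by (auto simp: f_def)
    have sums: "finsum X (\<lambda>i. \<alpha> i \<odot> y i) {..<N} = f \<omega>" if "n \<le> N" for N
    proof -
      have "{..<N} = {..<n} \<union> {n..<N}" using that by auto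
      then have "finsum X (\<lambda>i. \<alpha> i \<odot> y i) {..<N} =
          finsum X (\<lambda>i. \<alpha> i \<odot> y i) {..<n} \<oplus> finsum X (\<lambda>i. \<alpha> i \<odot> y i) {n..<N}"
        using in_X by (simp add: M.finsum_Un_disjoint Pi_def ivl_disj_int)
      also have "finsum X (\<lambda>i. \<alpha> i \<odot> y i) {n..<N} = finsum X (\<lambda>i. \<zero>) {n..<N}"
        by (intro finsum_eq) (auto simp: \<alpha>_def y_def)
      also have "finsum X (\<lambda>i. \<alpha> i \<odot> y i) {..<n} = finsum X (\<lambda>i. \<phi> i \<omega> \<odot> x i) {..<n}"
        using x \<open>0 < W\<close> by (intro finsum_eq) (auto simp: \<alpha>_def y_def simp flip: smult_mult)
      finally show ?thesis using \<omega> f\<omega> by (simp add: f_def M.finsum_zero)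
    qed
    have "limitin (vtopology X) (\<lambda>N. finsum X (\<lambda>i. \<alpha> i \<odot> y i) {..<N}) (f \<omega>) sequentially"
    proof (subst limitin_iff)
      have "(\<lambda>N. vnorm X (finsum X (\<lambda>i. \<alpha> i \<odot> y i) {..<N} \<ominus> f \<omega>)) \<longlonglongrightarrow> 0"
        using f\<omega> sums
        by (intro tendsto_eventually eventually_sequentiallyI[of n]) (simp add: sums)
      then show "f \<omega> \<in> carrier X \<and> (\<lambda>N. vnorm X (finsum X (\<lambda>i. \<alpha> i \<odot> y i) {..<N} \<ominus> f \<omega>)) \<longlonglongrightarrow> 0"
        using f\<omega> by simp
    qed (use in_X in auto)
    then show ?thesis using f\<omega> \<alpha> by (auto simp: p_hull_def)
  qed
  then have y_cp: "y \<in> cp_seqs p \<Omega> X f" using y_seq by (auto simp: cp_seqs_def)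
  have "continuous_map \<Omega> (vtopology X) (\<lambda>\<omega>. finsum X (\<lambda>i. \<phi> i \<omega> \<odot> x i) {..<n})"
    using \<phi> x
    by (intro continuous_map_finsum continuous_map_smult_vector) (auto simp: scalar_cont_carrier)
  then have "continuous_map \<Omega> (vtopology X) f"
    unfolding f_def by (rule continuous_map_eq) simp
  then have "f \<in> carrier (cont_space \<Omega> X)"
    by (simp add: cont_space_simps f_def)
  then show "f \<in> carrier Cp" using y_cp by (auto simp: cp_space_simps)
  show "vnorm Cp f \<le> W * lp_norm_fin p n (\<lambda>i. vnorm X (x i))"
    using cp_norm_le[OF y_cp] le by simp
qed

lemma elementary_in_Cp:
  assumes "\<phi> \<in> carrier Z" "x \<in> carrier X"
  shows "(\<lambda>\<omega>\<in>topspace \<Omega>. \<phi> \<omega> \<odot> x) \<in> carrier Cp"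
proof -
  have "(\<lambda>\<omega>\<in>topspace \<Omega>. finsum X (\<lambda>i. \<phi> \<omega> \<odot> x) {..<Suc 0}) \<in> carrier Cp"
  proof (rule finite_rank_in_Cp)
    \<comment> \<open>Adding one provides a positive bound even for a vanishing function.\<close>
    have "0 \<le> weak_lp_norm q Z (Suc 0) (\<lambda>_. \<phi>)"
      using assms by (intro weak_lp_norm_nonneg normed_Z q_ge_1)
    then show "0 < weak_lp_norm q Z (Suc 0) (\<lambda>_. \<phi>) + 1" by simp
    show "lp_norm_fin q (Suc 0) (\<lambda>i. norm (\<phi> \<omega>)) \<le> weak_lp_norm q Z (Suc 0) (\<lambda>_. \<phi>) + 1"
      if "\<omega> \<in> topspace \<Omega>" for \<omega>
      using weak_lp_norm_ge_point[OF compact q_ge_1 _ that, of "Suc 0" "\<lambda>_. \<phi>"] assms by simp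
  qed (use assms in auto)
  then show ?thesis using assms by (simp add: lessThan_Suc cong: restrict_cong)
qed

lemma assoc_op_apply:
  "\<phi> \<in> carrier Z \<Longrightarrow> x \<in> carrier X \<Longrightarrow>
    assoc_op \<Omega> X U \<phi> x = U (\<lambda>\<omega>\<in>topspace \<Omega>. \<phi> \<omega> \<odot> x)"
  by (simp add: assoc_op_def)

text \<open>The finite sum is the value of \<open>U\<close> at a function of finite rank, whose norm
  in \<open>Cp\<close> is at most the weak norm of the scalar functions times the \<open>l_p\<close>
  norm of the vectors.\<close>

lemma chevet_saphar_bounded_assoc_op:
  assumes "normed_space Y" and U: "U \<in> bounded_ops Cp Y"
  shows "\<exists>C\<ge>0. chevet_saphar_bounded p Z X Y (assoc_op \<Omega> X U) C"
proof -
  interpret Y: normed_space Y by fact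
  interpret Z: normed_space Z by (rule normed_Z)
  let ?S = "assoc_op \<Omega> X U"
  note lin = bounded_ops_linear[OF U]
  obtain C0 where C0: "\<And>f. f \<in> carrier Cp \<Longrightarrow> vnorm Y (U f) \<le> C0 * vnorm Cp f"
    using U unfolding bounded_ops_def by blast
  define C where "C = \<bar>C0\<bar>"
  have C: "0 \<le> C" "\<And>f. f \<in> carrier Cp \<Longrightarrow> vnorm Y (U f) \<le> C * vnorm Cp f"
    using order_trans[OF C0 mult_right_mono[OF abs_ge_self[of C0] cp_norm_nonneg]]
    by (auto simp: C_def)
  have "vnorm Y (finsum Y (\<lambda>i. ?S (\<phi> i) (x i)) {..<n})
      \<le> C * (weak_lp_norm q Z n \<phi> * lp_norm_fin p n (\<lambda>i. vnorm X (x i)))"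
    if \<phi>x: "\<forall>i<n. \<phi> i \<in> carrier Z \<and> x i \<in> carrier X" for n \<phi> x
  proof -
    \<comment> \<open>Linearity of \<open>U\<close> is used one summand at a time, so every initial
      sum has to be known to lie in \<open>Cp\<close>.\<close>
    define f where "f m = (\<lambda>\<omega>\<in>topspace \<Omega>. finsum X (\<lambda>i. \<phi> i \<omega> \<odot> x i) {..<m})" for m
    define w where "w m = weak_lp_norm q Z m \<phi>" for m
    define K where "K = lp_norm_fin p n (\<lambda>i. vnorm X (x i))"
    have w: "0 \<le> w m" if "m \<le> n" for m
      unfolding w_def using \<phi>x that by (intro weak_lp_norm_nonneg normed_Z q_ge_1) auto
    have pt: "lp_norm_fin q m (\<lambda>i. norm (\<phi> i \<omega>)) \<le> w m" if "m \<le> n" "\<omega> \<in> topspace \<Omega>" for m \<omega>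
      unfolding w_def using \<phi>x that by (intro weak_lp_norm_ge_point compact q_ge_1) auto
    have f: "f m \<in> carrier Cp" if "m \<le> n" for m
      unfolding f_def
    proof (rule finite_rank_in_Cp)
      show "0 < w m + 1" using w[OF that] by simp
      show "lp_norm_fin q m (\<lambda>i. norm (\<phi> i \<omega>)) \<le> w m + 1" if "\<omega> \<in> topspace \<Omega>" for \<omega>
        using pt[OF \<open>m \<le> n\<close> that] by simp
    qed (use \<phi>x that in auto)
    have Uf: "U (f m) = finsum Y (\<lambda>i. ?S (\<phi> i) (x i)) {..<m}" if "m \<le> n" for m
      using that
    proof (induction m)
      case 0
      have "f 0 = 0 \<odot>\<^bsub>Cp\<^esub> f 0" by (simp add: f_def cp_space_simps fun_eq_iff)
      then have "U (f 0) = 0 \<odot>\<^bsub>Y\<^esub> U (f 0)"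
        using linear_maps_smult[OF lin f[of 0], of 0] by simp
      then show ?case using linear_maps_closed[OF lin f[of 0]] by simp
    next
      case (Suc m)
      let ?g = "\<lambda>\<omega>\<in>topspace \<Omega>. \<phi> m \<omega> \<odot> x m"
      have g: "?g \<in> carrier Cp" using \<phi>x Suc.prems by (intro elementary_in_Cp) auto
      have "f (Suc m) = f m \<oplus>\<^bsub>Cp\<^esub> ?g"
        unfolding f_def cp_space_simps
        using \<phi>x Suc.prems by (intro restrict_ext) (auto intro!: finsum_lessThan_Suc)
      then have "U (f (Suc m)) = U (f m) \<oplus>\<^bsub>Y\<^esub> U ?g"
        using linear_maps_add[OF lin f g, of m] Suc.prems by simp
      also have "U ?g = ?S (\<phi> m) (x m)" using \<phi>x Suc.prems by (simp add: assoc_op_apply)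
      also have "U (f m) = finsum Y (\<lambda>i. ?S (\<phi> i) (x i)) {..<m}" using Suc by simp
      also have "\<dots> \<oplus>\<^bsub>Y\<^esub> ?S (\<phi> m) (x m) = finsum Y (\<lambda>i. ?S (\<phi> i) (x i)) {..<Suc m}"
        using \<phi>x Suc.prems
        by (intro Y.finsum_lessThan_Suc[symmetric])
          (auto simp: assoc_op_apply intro!: linear_maps_closed[OF lin] elementary_in_Cp)
      finally show ?case .
    qed
    have K: "0 \<le> K" unfolding K_def by (rule lp_norm_fin_nonneg[OF p_ge_1])
    \<comment> \<open>The weak norm may vanish while \<open>finite_rank_in_Cp\<close> asks for a
      positive bound; the surplus \<open>e\<close> is removed afterwards.\<close>
    have le: "vnorm Y (U (f n)) \<le> C * ((w n + e) * K)" if "e > 0" for e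
    proof -
      have "vnorm Cp (f n) \<le> (w n + e) * K"
        unfolding f_def K_def
      proof (rule finite_rank_in_Cp(2))
        show "0 < w n + e" using w[of n] that by simp
        show "lp_norm_fin q n (\<lambda>i. norm (\<phi> i \<omega>)) \<le> w n + e" if "\<omega> \<in> topspace \<Omega>" for \<omega>
          using pt[OF _ that, of n] \<open>e > 0\<close> by simp
      qed (use \<phi>x in auto)
      then have "C * vnorm Cp (f n) \<le> C * ((w n + e) * K)" using C(1) by (rule mult_left_mono)
      then show ?thesis using C(2)[OF f[of n]] by simp
    qed
    have "vnorm Y (U (f n)) \<le> C * (w n * K)"
    proof (rule field_le_epsilon)
      fix e :: real assume e: "e > 0"
      \<comment> \<open>The surplus contributes \<open>d * (C * K)\<close>; the added one avoids
        division by zero.\<close>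
      define d where "d = e / (C * K + 1)"
      have CK: "0 < C * K + 1" using C(1) K by (simp add: add_nonneg_pos)
      then have "d > 0" using e by (simp add: d_def)
      have "C * ((w n + d) * K) = C * (w n * K) + d * (C * K)" by (simp add: algebra_simps)
      also have "d * (C * K) \<le> d * (C * K + 1)" using \<open>d > 0\<close> by simp
      also have "\<dots> = e" using CK by (simp add: d_def)
      finally show "vnorm Y (U (f n)) \<le> C * (w n * K) + e" using le[OF \<open>d > 0\<close>] by simp
    qed
    then show ?thesis using Uf[of n] by (simp add: w_def K_def)
  qed
  then show ?thesis using C(1) unfolding chevet_saphar_bounded_def by blast
qed

end

subsection \<open>Partitions of unity\<close>

text \<open>The covering sets are sublevel sets of \<open>\<rho>\<close>, so the bumps
  \<open>max 0 (\<delta> - \<rho> \<omega> (w j))\<close> can be written down directly; their sum is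
  positive on the whole space and dividing by it suffices. In the application \<open>\<rho>\<close>
  measures the variation of given functions.\<close>

lemma exists_partition_of_unity:
  fixes \<Omega> :: "'t topology" and \<rho> :: "'t \<Rightarrow> 't \<Rightarrow> real"
  assumes "compact_space \<Omega>" and "\<delta> > 0"
    and cont: "\<And>\<omega>'. \<omega>' \<in> topspace \<Omega> \<Longrightarrow> continuous_map \<Omega> euclideanreal (\<lambda>\<omega>. \<rho> \<omega> \<omega>')"
    and refl: "\<And>\<omega>. \<omega> \<in> topspace \<Omega> \<Longrightarrow> \<rho> \<omega> \<omega> = 0"
  obtains n :: nat and t :: "nat \<Rightarrow> 't \<Rightarrow> real" and w :: "nat \<Rightarrow> 't" where
    "\<And>j. j < n \<Longrightarrow> w j \<in> topspace \<Omega>"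
    "\<And>j. j < n \<Longrightarrow> continuous_map \<Omega> euclideanreal (t j)"
    "\<And>j \<omega>. \<omega> \<in> topspace \<Omega> \<Longrightarrow> 0 \<le> t j \<omega>"
    "\<And>\<omega>. \<omega> \<in> topspace \<Omega> \<Longrightarrow> (\<Sum>j<n. t j \<omega>) = 1"
    "\<And>j \<omega>. j < n \<Longrightarrow> \<omega> \<in> topspace \<Omega> \<Longrightarrow> t j \<omega> \<noteq> 0 \<Longrightarrow> \<rho> \<omega> (w j) < \<delta>"
proof -
  define U where "U \<omega>' = {\<omega> \<in> topspace \<Omega>. \<rho> \<omega> \<omega>' < \<delta>}" for \<omega>'
  have "openin \<Omega> (U \<omega>')" if "\<omega>' \<in> topspace \<Omega>" for \<omega>'
    using openin_continuous_map_preimage[OF cont[OF that], of "{..<\<delta>}"] by (simp add: U_def)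
  moreover have "topspace \<Omega> \<subseteq> \<Union> (U ` topspace \<Omega>)"
    using refl \<open>\<delta> > 0\<close> by (auto simp: U_def)
  ultimately obtain F where F: "finite F" "F \<subseteq> U ` topspace \<Omega>" "topspace \<Omega> \<subseteq> \<Union>F"
    using assms(1) unfolding compact_space_def compactin_def by (metis (no_types, lifting) imageE)
  obtain D where D: "D \<subseteq> topspace \<Omega>" "finite D" "F = U ` D"
    using finite_subset_image[OF F(1,2)] by blast
  obtain w :: "nat \<Rightarrow> 't" and n where w: "D = w ` {i. i < n}"
    using finite_imp_nat_seg_image_inj_on[OF D(2)] by blast
  have wt: "w j \<in> topspace \<Omega>" if "j < n" for j using that w D(1) by auto
  define s where "s j \<omega> = max 0 (\<delta> - \<rho> \<omega> (w j))" for j \<omega>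
  define t where "t j \<omega> = s j \<omega> / (\<Sum>j<n. s j \<omega>)" for j \<omega>
  have s_cont: "continuous_map \<Omega> euclideanreal (s j)" if "j < n" for j
    unfolding s_def using cont[OF wt[OF that]]
    by (intro continuous_map_real_max continuous_map_diff) auto
  have s_pos: "0 < (\<Sum>j<n. s j \<omega>)" if \<omega>: "\<omega> \<in> topspace \<Omega>" for \<omega>
  proof -
    obtain j where j: "j < n" "\<omega> \<in> U (w j)" using F(3) D(3) w \<omega> by auto
    then have "0 < s j \<omega>" by (simp add: s_def U_def)
    also have "s j \<omega> \<le> (\<Sum>j<n. s j \<omega>)" using j by (intro member_le_sum) (auto simp: s_def)
    finally show ?thesis .
  qed
  show thesis
  proof (rule that[of n w t])
    fix j assume "j < n"
    then show "continuous_map \<Omega> euclideanreal (t j)"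
      unfolding t_def using s_cont s_pos
      by (intro continuous_map_real_divide continuous_map_sum) (auto simp: less_imp_neq[symmetric])
  next
    fix j \<omega> assume "\<omega> \<in> topspace \<Omega>"
    then show "0 \<le> t j \<omega>" using s_pos[of \<omega>] by (simp add: t_def s_def)
  next
    fix \<omega> assume "\<omega> \<in> topspace \<Omega>"
    then show "(\<Sum>j<n. t j \<omega>) = 1"
      using s_pos[of \<omega>] by (simp add: t_def flip: sum_divide_distrib)
  next
    fix j \<omega> assume "j < n" "\<omega> \<in> topspace \<Omega>" "t j \<omega> \<noteq> 0"
    then show "\<rho> \<omega> (w j) < \<delta>" by (auto simp: t_def s_def max_def split: if_splits)
  qed (use wt in auto)
qed

context cp_setup
begin

definition emb :: "('t \<Rightarrow> real) \<Rightarrow> 't \<Rightarrow> 'k" where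
  "emb g = (\<lambda>\<omega>\<in>topspace \<Omega>. of_real (g \<omega>))"

lemma emb_in_Z:
  assumes "continuous_map \<Omega> euclideanreal g"
  shows "emb g \<in> carrier Z"
proof -
  have "continuous_map euclideanreal euclidean (of_real :: real \<Rightarrow> 'k)"
    by (simp add: continuous_on_of_real_id)
  then have "continuous_map \<Omega> euclidean (of_real \<circ> g :: 't \<Rightarrow> 'k)"
    by (rule continuous_map_compose[OF assms])
  then show ?thesis unfolding emb_def by (intro restrict_scalar_cont) (simp add: o_def)
qed

lemma p_hull_iff:
  "v \<in> p_hull p X x \<longleftrightarrow> v \<in> carrier X \<and> (\<exists>\<alpha>. (\<forall>n. lp_norm_fin q n (\<lambda>i. norm (\<alpha> i)) \<le> 1) \<and>
    limitin (vtopology X) (\<lambda>N. finsum X (\<lambda>n. \<alpha> n \<odot> x n) {..<N}) v sequentially)"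
  unfolding p_hull_def by (simp add: lp_ball_iff q_ge_1 Bex_def)

lemma p_hullI:
  assumes "v \<in> carrier X" "\<And>n. lp_norm_fin q n (\<lambda>i. norm (\<alpha> i)) \<le> 1"
    "limitin (vtopology X) (\<lambda>N. finsum X (\<lambda>n. \<alpha> n \<odot> x n) {..<N}) v sequentially"
  shows "v \<in> p_hull p X x"
  unfolding p_hull_iff
  by (intro conjI exI[of _ \<alpha>] allI) (rule assms)+

lemma zero_in_p_hull:
  assumes "\<And>n. x n \<in> carrier X"
  shows "\<zero> \<in> p_hull p X x"
proof (rule p_hullI[where \<alpha>="\<lambda>_. 0"])
  show "lp_norm_fin q n (\<lambda>i. norm (0 :: 'k)) \<le> 1" for n
    using lp_norm_fin_scale_le[OF q_ge_1, of 0 n "\<lambda>_. 0" "\<lambda>_. 0"] by simp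
qed (use assms in \<open>auto simp: M.finsum_zero\<close>)

text \<open>For coefficients \<open>\<alpha>\<^sub>j\<close> in the unit ball of \<open>\<ell>\<^sub>q\<close> the functions
  \<open>\<Sum>\<^sub>j \<theta>\<^sub>j \<alpha>\<^sub>j\<close> have values in that ball by convexity, so the Chevet--Saphar bound applies.\<close>

lemma bounded_on_partition:
  assumes Y: "normed_space Y" and S: "bilinear_op Z X Y M S"
    and CS: "chevet_saphar_bounded p Z X Y S C" and "0 \<le> C" and "finite J"
    and \<theta>: "\<And>j. j \<in> J \<Longrightarrow> continuous_map \<Omega> euclideanreal (\<theta> j)"
      "\<And>j \<omega>. j \<in> J \<Longrightarrow> \<omega> \<in> topspace \<Omega> \<Longrightarrow> 0 \<le> \<theta> j \<omega>"
      "\<And>\<omega>. \<omega> \<in> topspace \<Omega> \<Longrightarrow> (\<Sum>j\<in>J. \<theta> j \<omega>) \<le> 1"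
    and y: "y \<in> lp_c0_seqs p X" and v: "\<And>j. j \<in> J \<Longrightarrow> v j \<in> p_hull p X y"
  shows "vnorm Y (finsum Y (\<lambda>j. S (emb (\<theta> j)) (v j)) J) \<le> C * lp_norm p (\<lambda>i. vnorm X (y i))"
    (is "vnorm Y ?s \<le> C * ?L")
proof -
  interpret Y: normed_space Y by fact
  interpret Z: normed_space Z by (rule normed_Z)
  note y_in = lp_c0_seqs_carrier[OF y]
  have e: "emb (\<theta> j) \<in> carrier Z" if "j \<in> J" for j using \<theta>(1)[OF that] by (rule emb_in_Z)
  have "\<forall>j\<in>J. \<exists>\<alpha>. v j \<in> carrier X \<and> (\<forall>n. lp_norm_fin q n (\<lambda>i. norm (\<alpha> i)) \<le> 1) \<and>
      limitin (vtopology X) (\<lambda>N. finsum X (\<lambda>n. \<alpha> n \<odot> y n) {..<N}) (v j) sequentially"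
    using v by (simp add: p_hull_iff)
  from bchoice[OF this] obtain \<alpha> where \<alpha>': "\<forall>j\<in>J. v j \<in> carrier X \<and>
      (\<forall>n. lp_norm_fin q n (\<lambda>i. norm (\<alpha> j i)) \<le> 1) \<and>
      limitin (vtopology X) (\<lambda>N. finsum X (\<lambda>n. \<alpha> j n \<odot> y n) {..<N}) (v j) sequentially" ..
  then have \<alpha>: "\<And>j. j \<in> J \<Longrightarrow> v j \<in> carrier X"
      "\<And>j n. j \<in> J \<Longrightarrow> lp_norm_fin q n (\<lambda>i. norm (\<alpha> j i)) \<le> 1"
      "\<And>j. j \<in> J \<Longrightarrow> limitin (vtopology X) (\<lambda>N. finsum X (\<lambda>n. \<alpha> j n \<odot> y n) {..<N}) (v j) sequentially"
    by simp_all
  \<comment> \<open>Each \<open>v j\<close> is only a limit of its partial sums. The estimate is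
    proved for the truncations, uniformly in \<open>N\<close>, and then passed to the limit.\<close>
  define vN where "vN N j = finsum X (\<lambda>n. \<alpha> j n \<odot> y n) {..<N}" for N j
  have vN: "vN N j \<in> carrier X" for N j unfolding vN_def using y_in by auto
  have fin_le: "vnorm Y (finsum Y (\<lambda>j. S (emb (\<theta> j)) (vN N j)) J) \<le> C * ?L" for N
  proof -
    \<comment> \<open>Exchanging the two sums collects everything in front of \<open>y n\<close>
      into one function, so that the same sequence \<open>y\<close> serves all
      \<open>j\<close>.\<close>
    define h where "h n = finsum Z (\<lambda>j. \<alpha> j n \<odot>\<^bsub>Z\<^esub> emb (\<theta> j)) J" for n
    have h: "h n \<in> carrier Z" for n unfolding h_def using e by (intro Z.finsum_in) auto
    have "finsum Y (\<lambda>j. S (emb (\<theta> j)) (vN N j)) J =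
        finsum Y (\<lambda>j. finsum Y (\<lambda>n. S (\<alpha> j n \<odot>\<^bsub>Z\<^esub> emb (\<theta> j)) (y n)) {..<N}) J"
    proof (rule Y.finsum_eq)
      fix j assume j: "j \<in> J"
      have "S (emb (\<theta> j)) (vN N j) = finsum Y (\<lambda>n. S (emb (\<theta> j)) (\<alpha> j n \<odot> y n)) {..<N}"
        unfolding vN_def using e[OF j] y_in
        by (intro bilinear_op_sum_right[OF normed_X Y S]) auto
      also have "\<dots> = finsum Y (\<lambda>n. S (\<alpha> j n \<odot>\<^bsub>Z\<^esub> emb (\<theta> j)) (y n)) {..<N}"
        using e[OF j] y_in
        by (intro Y.finsum_eq)
          (auto simp: bilinear_op_smult_left[OF S] bilinear_op_smult_right[OF S]
            intro!: bilinear_op_closed[OF S])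
      finally show "S (emb (\<theta> j)) (vN N j) =
        finsum Y (\<lambda>n. S (\<alpha> j n \<odot>\<^bsub>Z\<^esub> emb (\<theta> j)) (y n)) {..<N}" .
    qed (use e y_in in \<open>auto intro!: Y.finsum_in bilinear_op_closed[OF S]\<close>)
    also have "\<dots> = finsum Y (\<lambda>n. finsum Y (\<lambda>j. S (\<alpha> j n \<odot>\<^bsub>Z\<^esub> emb (\<theta> j)) (y n)) J) {..<N}"
      using e y_in \<open>finite J\<close> by (intro Y.finsum_swap) (auto intro!: bilinear_op_closed[OF S])
    also have "\<dots> = finsum Y (\<lambda>n. S (h n) (y n)) {..<N}"
    proof (rule Y.finsum_eq)
      fix n
      show "finsum Y (\<lambda>j. S (\<alpha> j n \<odot>\<^bsub>Z\<^esub> emb (\<theta> j)) (y n)) J = S (h n) (y n)"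
        unfolding h_def using e y_in
        by (intro bilinear_op_sum_left[OF normed_Z Y S, symmetric]) auto
    qed (use h y_in in \<open>auto intro!: bilinear_op_closed[OF S]\<close>)
    finally have "vnorm Y (finsum Y (\<lambda>j. S (emb (\<theta> j)) (vN N j)) J)
        \<le> C * (weak_lp_norm q Z N h * lp_norm_fin p N (\<lambda>i. vnorm X (y i)))"
      using CS h y_in unfolding chevet_saphar_bounded_def by simp
    also have "\<dots> \<le> C * (1 * ?L)"
    proof (intro mult_left_mono mult_mono)
      show "weak_lp_norm q Z N h \<le> 1"
      proof (rule weak_lp_norm_le_point[OF compact p_ge_1])
        fix \<omega> assume \<omega>: "\<omega> \<in> topspace \<Omega>"
        have h_pt: "h n \<omega> = (\<Sum>j\<in>J. \<alpha> j n * of_real (\<theta> j \<omega>))" for n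
        proof -
          have "h n = (\<lambda>\<omega>\<in>topspace \<Omega>. \<Sum>j\<in>J. (\<alpha> j n \<odot>\<^bsub>Z\<^esub> emb (\<theta> j)) \<omega>)"
            unfolding h_def using e by (intro scalar_cont_finsum[OF compact]) auto
          then show ?thesis using \<omega> by (simp add: cont_space_simps(4) emb_def)
        qed
        have "lp_norm_fin q N (\<lambda>i. norm (h i \<omega>))
            \<le> (\<Sum>j\<in>J. \<theta> j \<omega> * lp_norm_fin q N (\<lambda>i. norm (\<alpha> j i)))"
        proof (rule lp_norm_fin_sum_le[OF q_ge_1 \<open>finite J\<close>])
          fix i
          have "norm (h i \<omega>) \<le> (\<Sum>j\<in>J. norm (\<alpha> j i * of_real (\<theta> j \<omega>)))"
            unfolding h_pt by (rule norm_sum)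
          also have "\<dots> = (\<Sum>j\<in>J. \<theta> j \<omega> * \<bar>norm (\<alpha> j i)\<bar>)"
            using \<theta>(2) \<omega> by (intro sum.cong) (auto simp: norm_mult)
          finally show "\<bar>norm (h i \<omega>)\<bar> \<le> (\<Sum>j\<in>J. \<theta> j \<omega> * \<bar>norm (\<alpha> j i)\<bar>)" by simp
        qed (use \<theta>(2) \<omega> in auto)
        also have "\<dots> \<le> (\<Sum>j\<in>J. \<theta> j \<omega> * 1)"
          using \<theta>(2) \<omega> \<alpha>(2) by (intro sum_mono mult_left_mono) auto
        also have "\<dots> \<le> 1" using \<theta>(3) \<omega> by simp
        finally show "lp_norm_fin q N (\<lambda>i. norm (h i \<omega>)) \<le> 1" .
      qed (use h in auto)
      show "lp_norm_fin p N (\<lambda>i. vnorm X (y i)) \<le> ?L" by (rule lp_c0_seqs_fin_le[OF y])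
      show "0 \<le> lp_norm_fin p N (\<lambda>i. vnorm X (y i))" by (rule lp_norm_fin_nonneg[OF p_ge_1])
    qed (use \<open>0 \<le> C\<close> in auto)
    finally show ?thesis by simp
  qed
  \<comment> \<open>For a fixed finite partition the bilinear bound alone controls the truncation
    error.\<close>
  define K where "K j = M * vnorm Z (emb (\<theta> j))" for j
  have le: "vnorm Y ?s \<le> C * ?L + (\<Sum>j\<in>J. K j * vnorm X (vN N j \<ominus> v j))" for N
  proof -
    have in_Y: "S (emb (\<theta> j)) x \<in> carrier Y" if "j \<in> J" "x \<in> carrier X" for j x
      using that e by (intro bilinear_op_closed[OF S])
    have "?s \<ominus>\<^bsub>Y\<^esub> finsum Y (\<lambda>j. S (emb (\<theta> j)) (vN N j)) J
        = finsum Y (\<lambda>j. S (emb (\<theta> j)) (v j) \<ominus>\<^bsub>Y\<^esub> S (emb (\<theta> j)) (vN N j)) J"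
      using in_Y \<alpha>(1) vN by (intro Y.finsum_diff[symmetric]) auto
    then have "vnorm Y (?s \<ominus>\<^bsub>Y\<^esub> finsum Y (\<lambda>j. S (emb (\<theta> j)) (vN N j)) J)
        \<le> (\<Sum>j\<in>J. vnorm Y (S (emb (\<theta> j)) (v j) \<ominus>\<^bsub>Y\<^esub> S (emb (\<theta> j)) (vN N j)))"
      using in_Y \<alpha>(1) vN by (simp add: Y.vnorm_finsum_le)
    also have "\<dots> \<le> (\<Sum>j\<in>J. K j * vnorm X (vN N j \<ominus> v j))"
    proof (rule sum_mono)
      fix j assume j: "j \<in> J"
      have "(\<lambda>x\<in>carrier X. S (emb (\<theta> j)) x) \<in> linear_maps X Y"
        using S e[OF j] by (simp add: bilinear_op_def)
      from linear_maps_diff[OF normed_X Y this \<alpha>(1)[OF j] vN[of N j]]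
      have "S (emb (\<theta> j)) (v j) \<ominus>\<^bsub>Y\<^esub> S (emb (\<theta> j)) (vN N j) = S (emb (\<theta> j)) (v j \<ominus> vN N j)"
        using \<alpha>(1)[OF j] vN[of N j] by simp
      then show "vnorm Y (S (emb (\<theta> j)) (v j) \<ominus>\<^bsub>Y\<^esub> S (emb (\<theta> j)) (vN N j))
          \<le> K j * vnorm X (vN N j \<ominus> v j)"
        using bilinear_op_bound[OF S e[OF j], of "v j \<ominus> vN N j"] \<alpha>(1)[OF j] vN[of N j]
          vnorm_minus_commute[of "v j" "vN N j"]
        by (simp add: K_def)
    qed
    finally have "vnorm Y (?s \<ominus>\<^bsub>Y\<^esub> finsum Y (\<lambda>j. S (emb (\<theta> j)) (vN N j)) J)
        \<le> (\<Sum>j\<in>J. K j * vnorm X (vN N j \<ominus> v j))" .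
    moreover have "vnorm Y ?s \<le> vnorm Y (finsum Y (\<lambda>j. S (emb (\<theta> j)) (vN N j)) J)
        + vnorm Y (?s \<ominus>\<^bsub>Y\<^esub> finsum Y (\<lambda>j. S (emb (\<theta> j)) (vN N j)) J)"
      using in_Y \<alpha>(1) vN by (intro Y.vnorm_le_add_diff Y.finsum_in) auto
    ultimately show ?thesis using fin_le[of N] by simp
  qed
  have "(\<lambda>N. vnorm X (vN N j \<ominus> v j)) \<longlonglongrightarrow> 0" if "j \<in> J" for j
    using \<alpha>(3)[OF that] y_in unfolding vN_def by (subst (asm) limitin_iff) auto
  then have "(\<lambda>N. C * ?L + (\<Sum>j\<in>J. K j * vnorm X (vN N j \<ominus> v j)))
      \<longlonglongrightarrow> C * ?L + (\<Sum>j\<in>J. K j * 0)"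
    by (intro tendsto_intros)
  then show ?thesis using le by (intro LIMSEQ_le_const[where a="vnorm Y ?s"]) auto
qed

end

subsection \<open>Compactness of hulls\<close>

lemma LIMSEQ_squeeze_0:
  fixes f g :: "nat \<Rightarrow> real"
  assumes "g \<longlonglongrightarrow> 0" "\<And>n. 0 \<le> f n" "\<And>n. f n \<le> g n"
  shows "f \<longlonglongrightarrow> 0"
  by (rule tendsto_sandwich[OF _ _ tendsto_const assms(1)])
    (use assms(2,3) in \<open>auto intro: always_eventually\<close>)

context cp_setup
begin

lemma lp_c0_seqsI:
  assumes "\<And>n. y n \<in> carrier X" "\<And>m. lp_norm_fin p m (\<lambda>i. vnorm X (y i)) \<le> C"
    and "p = \<infinity> \<Longrightarrow> (\<lambda>n. vnorm X (y n)) \<longlonglongrightarrow> 0"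
  shows "y \<in> lp_c0_seqs p X" "lp_norm p (\<lambda>i. vnorm X (y i)) \<le> C"
  using lp_norm_leI[OF p_ge_1 assms(2)] assms(1,3) by (auto simp: lp_c0_seqs_def)

lemma lp_c0_seqs_tendsto:
  "x \<in> lp_c0_seqs p X \<Longrightarrow> p = \<infinity> \<Longrightarrow> (\<lambda>n. vnorm X (x n)) \<longlonglongrightarrow> 0"
  by (simp add: lp_c0_seqs_def)

lemma lp_c0_seqs_tail:
  assumes "x \<in> lp_c0_seqs p X" "e > 0"
  obtains N where "\<And>m. lp_norm_fin p m (\<lambda>i. if i < N then 0 else vnorm X (x i)) \<le> e"
  using lp_norm_fin_tail[OF p_ge_1 _ assms(2), of "\<lambda>i. vnorm X (x i)"] assms(1)
  unfolding lp_c0_seqs_def by auto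

definition psums :: "(nat \<Rightarrow> 'x) \<Rightarrow> (nat \<Rightarrow> 'k) \<Rightarrow> nat \<Rightarrow> 'x" where
  "psums x \<gamma> N = finsum X (\<lambda>n. \<gamma> n \<odot> x n) {..<N}"

lemma psums_in: "(\<And>n. x n \<in> carrier X) \<Longrightarrow> psums x \<gamma> N \<in> carrier X"
  unfolding psums_def by auto

lemma psums_diff:
  assumes "\<And>n. x n \<in> carrier X"
  shows "psums x (\<lambda>n. \<gamma> n - \<gamma>' n) N = psums x \<gamma> N \<ominus> psums x \<gamma>' N"
proof -
  have "psums x (\<lambda>n. \<gamma> n - \<gamma>' n) N = finsum X (\<lambda>n. \<gamma> n \<odot> x n \<ominus> \<gamma>' n \<odot> x n) {..<N}"
    unfolding psums_def using assms by (intro finsum_eq) (auto simp: smult_diff_left)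
  also have "\<dots> = psums x \<gamma> N \<ominus> psums x \<gamma>' N"
    unfolding psums_def using assms by (intro finsum_diff) auto
  finally show ?thesis .
qed

lemma psums_norm_le:
  assumes "\<And>n. x n \<in> carrier X"
  shows "vnorm X (psums x \<gamma> N) \<le> (\<Sum>i<N. norm (\<gamma> i) * vnorm X (x i))"
  unfolding psums_def
  using vnorm_finsum_le[of "{..<N}" "\<lambda>n. \<gamma> n \<odot> x n"] assms by (simp add: vnorm_smult)

text \<open>Hoelder between the tail of \<open>x\<close> and the coefficients; the estimate is
  uniform over all \<open>\<gamma>\<close> in a ball of \<open>l_q\<close>.\<close>

lemma psums_tail_le:
  assumes x: "\<And>n. x n \<in> carrier X" and "N0 \<le> N" "N \<le> N'"
    and \<gamma>: "\<And>m. lp_norm_fin q m (\<lambda>i. norm (\<gamma> i)) \<le> R"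
    and tail: "\<And>m. lp_norm_fin p m (\<lambda>i. if i < N0 then 0 else vnorm X (x i)) \<le> e"
  shows "vnorm X (psums x \<gamma> N' \<ominus> psums x \<gamma> N) \<le> e * R"
proof -
  have "{..<N'} = {..<N} \<union> {N..<N'}" using assms(3) by auto
  then have "psums x \<gamma> N' = psums x \<gamma> N \<oplus> finsum X (\<lambda>n. \<gamma> n \<odot> x n) {N..<N'}"
    unfolding psums_def using x by (simp add: M.finsum_Un_disjoint Pi_def ivl_disj_int)
  then have "psums x \<gamma> N' \<ominus> psums x \<gamma> N = finsum X (\<lambda>n. \<gamma> n \<odot> x n) {N..<N'}"
    using psums_in[of x \<gamma> N, OF x] finsum_in[of "{N..<N'}" "\<lambda>n. \<gamma> n \<odot> x n"] x
    by (simp add: a_minus_def M.a_comm[of "psums x \<gamma> N"] M.a_assoc M.r_neg)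
  then have "vnorm X (psums x \<gamma> N' \<ominus> psums x \<gamma> N) \<le> (\<Sum>i\<in>{N..<N'}. vnorm X (\<gamma> i \<odot> x i))"
    using vnorm_finsum_le[of "{N..<N'}" "\<lambda>n. \<gamma> n \<odot> x n"] x by simp
  also have "\<dots> = (\<Sum>i\<in>{N..<N'}. \<bar>if i < N0 then 0 else vnorm X (x i)\<bar> * \<bar>norm (\<gamma> i)\<bar>)"
    using x \<open>N0 \<le> N\<close> by (intro sum.cong) (auto simp: vnorm_smult mult.commute)
  also have "\<dots> \<le> (\<Sum>i<N'. \<bar>if i < N0 then 0 else vnorm X (x i)\<bar> * \<bar>norm (\<gamma> i)\<bar>)"
    by (intro sum_mono2) auto
  also have "\<dots> \<le> lp_norm_fin p N' (\<lambda>i. if i < N0 then 0 else vnorm X (x i)) *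
      lp_norm_fin q N' (\<lambda>i. norm (\<gamma> i))"
    by (rule lp_norm_fin_Hoelder[OF p_ge_1])
  also have "\<dots> \<le> e * R"
    using tail \<gamma> lp_norm_fin_nonneg[OF q_ge_1]
      order_trans[OF lp_norm_fin_nonneg[OF p_ge_1] tail]
    by (intro mult_mono) auto
  finally show ?thesis .
qed

text \<open>Subtracting coefficients doubles the radius of their ball; this is the origin of the
  bound 2 in the compactness argument.\<close>

lemma p_hull_diff:
  assumes x: "\<And>n. x n \<in> carrier X" and "a \<in> p_hull p X x" "b \<in> p_hull p X x"
  obtains \<gamma> where "\<And>m. lp_norm_fin q m (\<lambda>i. norm (\<gamma> i)) \<le> 2"
    "(\<lambda>N. vnorm X (psums x \<gamma> N \<ominus> (a \<ominus> b))) \<longlonglongrightarrow> 0"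
proof -
  obtain \<alpha> where \<alpha>: "a \<in> carrier X" "\<And>m. lp_norm_fin q m (\<lambda>i. norm (\<alpha> i)) \<le> 1"
      "(\<lambda>N. vnorm X (psums x \<alpha> N \<ominus> a)) \<longlonglongrightarrow> 0"
    using assms(2) x unfolding p_hull_iff psums_def by (subst (asm) limitin_iff) auto
  obtain \<beta> where \<beta>: "b \<in> carrier X" "\<And>m. lp_norm_fin q m (\<lambda>i. norm (\<beta> i)) \<le> 1"
      "(\<lambda>N. vnorm X (psums x \<beta> N \<ominus> b)) \<longlonglongrightarrow> 0"
    using assms(3) x unfolding p_hull_iff psums_def by (subst (asm) limitin_iff) auto
  show thesis
  proof (rule that[of "\<lambda>i. \<alpha> i - \<beta> i"])
    fix m
    have "lp_norm_fin q m (\<lambda>i. norm (\<alpha> i - \<beta> i))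
        \<le> 1 * lp_norm_fin q m (\<lambda>i. norm (\<alpha> i)) + 1 * lp_norm_fin q m (\<lambda>i. norm (\<beta> i))"
      by (intro lp_norm_fin_add_le q_ge_1) (auto intro: norm_triangle_ineq4)
    then show "lp_norm_fin q m (\<lambda>i. norm (\<alpha> i - \<beta> i)) \<le> 2" using \<alpha>(2)[of m] \<beta>(2)[of m] by simp
  next
    have "(psums x \<alpha> N \<ominus> psums x \<beta> N) \<ominus> (a \<ominus> b) = (psums x \<alpha> N \<ominus> a) \<ominus> (psums x \<beta> N \<ominus> b)" for N
      using psums_in[of x \<alpha> N, OF x] psums_in[of x \<beta> N, OF x] \<alpha>(1) \<beta>(1)
      by (simp add: a_minus_def M.minus_add M.a_ac)
    then have le: "vnorm X (psums x (\<lambda>i. \<alpha> i - \<beta> i) N \<ominus> (a \<ominus> b))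
        \<le> vnorm X (psums x \<alpha> N \<ominus> a) + vnorm X (psums x \<beta> N \<ominus> b)" for N
      using psums_in[of x \<alpha> N, OF x] psums_in[of x \<beta> N, OF x] \<alpha>(1) \<beta>(1)
      by (simp add: psums_diff[of x, OF x] vnorm_diff_le)
    have lim: "(\<lambda>N. vnorm X (psums x \<alpha> N \<ominus> a) + vnorm X (psums x \<beta> N \<ominus> b)) \<longlonglongrightarrow> 0"
      using tendsto_add[OF \<alpha>(3) \<beta>(3)] by simp
    have nn: "0 \<le> vnorm X (psums x (\<lambda>i. \<alpha> i - \<beta> i) N \<ominus> (a \<ominus> b))" for N
      using psums_in[of x, OF x] \<alpha>(1) \<beta>(1) by simp
    show "(\<lambda>N. vnorm X (psums x (\<lambda>i. \<alpha> i - \<beta> i) N \<ominus> (a \<ominus> b))) \<longlonglongrightarrow> 0"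
      by (rule LIMSEQ_squeeze_0[OF lim nn le])
  qed
qed

lemma psums_limit_dist_le:
  assumes x: "\<And>n. x n \<in> carrier X" and v: "v \<in> carrier X" and "N0 \<le> N"
    and \<gamma>: "\<And>m. lp_norm_fin q m (\<lambda>i. norm (\<gamma> i)) \<le> R"
    and tail: "\<And>m. lp_norm_fin p m (\<lambda>i. if i < N0 then 0 else vnorm X (x i)) \<le> e"
    and lim: "(\<lambda>N. vnorm X (psums x \<gamma> N \<ominus> v)) \<longlonglongrightarrow> 0"
  shows "vnorm X (psums x \<gamma> N \<ominus> v) \<le> e * R"
proof -
  have "vnorm X (psums x \<gamma> N \<ominus> v) \<le> e * R + vnorm X (psums x \<gamma> N' \<ominus> v)" if "N' \<ge> N" for N'
    using psums_tail_le[of x N0 N N' \<gamma> R e, OF x \<open>N0 \<le> N\<close> that \<gamma> tail]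
      vnorm_diff_triangle[of "psums x \<gamma> N" "psums x \<gamma> N'" v]
      vnorm_minus_commute[of "psums x \<gamma> N" "psums x \<gamma> N'"] psums_in[of x, OF x] v by simp
  moreover have "(\<lambda>N'. e * R + vnorm X (psums x \<gamma> N' \<ominus> v)) \<longlonglongrightarrow> e * R + 0"
    by (intro tendsto_add tendsto_const lim)
  ultimately have "vnorm X (psums x \<gamma> N \<ominus> v) \<le> e * R + 0"
    using LIMSEQ_le_const by blast
  then show ?thesis by simp
qed

text \<open>If no \<open>\<delta>\<close> works, there are \<open>\<gamma>\<^sub>k\<close> in twice the unit ball of \<open>\<ell>\<^sub>q\<close> with \<open>\<Sum> \<gamma>\<^sub>k\<^sub>n x\<^sub>n\<close> tending to \<open>0\<close>; a subsequence
  converges coordinatewise to some \<open>l\<close>, and \<open>\<Sum> l\<^sub>n x\<^sub>n = 0\<close>. Hence \<open>\<gamma>\<^sub>k\<close> may be replaced by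
  \<open>\<gamma>\<^sub>k - l\<close>, whose first coordinates are small.\<close>

lemma p_hull_small_differences:
  assumes x: "x \<in> lp_c0_seqs p X" and "\<epsilon> > 0"
  obtains \<delta> y where "\<delta> > 0" "y \<in> lp_c0_seqs p X" "lp_norm p (\<lambda>i. vnorm X (y i)) \<le> \<epsilon>"
    "\<And>a b. a \<in> p_hull p X x \<Longrightarrow> b \<in> p_hull p X x \<Longrightarrow> vnorm X (a \<ominus> b) < \<delta> \<Longrightarrow> a \<ominus> b \<in> p_hull p X y"
proof -
  note x_in = lp_c0_seqs_carrier[OF x]
  define L where "L = lp_norm p (\<lambda>i. vnorm X (x i))"
  have L: "0 \<le> L" unfolding L_def by (intro lp_norm_nonneg p_ge_1 lp_c0_seqs_lp_seq x)
  \<comment> \<open>Chosen because the sequence \<open>y\<close> below has norm at most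
    \<open>\<eta> * L + 8 * \<eta>\<close>.\<close>
  define \<eta> where "\<eta> = \<epsilon> / (L + 8)"
  have \<eta>: "\<eta> > 0" using L \<open>\<epsilon> > 0\<close> by (simp add: \<eta>_def)
  obtain N where N: "\<And>m. lp_norm_fin p m (\<lambda>i. if i < N then 0 else vnorm X (x i)) \<le> \<eta>"
    using lp_c0_seqs_tail[OF x \<eta>] by blast
  \<comment> \<open>Small on the head, enlarged on the tail. The coefficients to be absorbed will
    have norm at most 4, so dividing them by 8 leaves at most one half, and the tail of
    \<open>x\<close> is small enough to bear the enlargement.\<close>
  define y where "y i = (if i < N then of_real \<eta> else 8) \<odot> x i" for i
  have y_in: "y i \<in> carrier X" for i using x_in by (simp add: y_def)
  have y_norm: "vnorm X (y i) = (if i < N then \<eta> else 8) * vnorm X (x i)" for i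
    using x_in \<eta> by (simp add: y_def vnorm_smult)
  have "lp_norm_fin p m (\<lambda>i. vnorm X (y i)) \<le> \<epsilon>" for m
  proof -
    have "lp_norm_fin p m (\<lambda>i. vnorm X (y i)) \<le> \<eta> * lp_norm_fin p m (\<lambda>i. vnorm X (x i))
        + 8 * lp_norm_fin p m (\<lambda>i. if i < N then 0 else vnorm X (x i))"
      using \<eta> x_in by (intro lp_norm_fin_add_le p_ge_1) (auto simp: y_norm abs_mult)
    also have "\<dots> \<le> \<eta> * L + 8 * \<eta>"
      using \<eta> N[of m] lp_c0_seqs_fin_le[OF x, of m] by (simp add: L_def add_mono)
    also have "\<dots> = \<eta> * (L + 8)" by (simp add: algebra_simps)
    also have "\<dots> = \<epsilon>" using L by (simp add: \<eta>_def)
    finally show ?thesis .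
  qed
  moreover have "(\<lambda>n. vnorm X (y n)) \<longlonglongrightarrow> 0" if "p = \<infinity>"
  proof (rule LIMSEQ_squeeze_0)
    show "(\<lambda>n. (\<eta> + 8) * vnorm X (x n)) \<longlonglongrightarrow> 0"
      by (rule tendsto_mult_right_zero[OF lp_c0_seqs_tendsto[OF x that]])
    show "vnorm X (y n) \<le> (\<eta> + 8) * vnorm X (x n)" for n
      unfolding y_norm using \<eta> x_in by (intro mult_right_mono) auto
  qed (use y_in in simp)
  ultimately have y: "y \<in> lp_c0_seqs p X" "lp_norm p (\<lambda>i. vnorm X (y i)) \<le> \<epsilon>"
    using lp_c0_seqsI[of y \<epsilon>, OF y_in] by auto
  have "\<exists>\<delta>>0. \<forall>a\<in>p_hull p X x. \<forall>b\<in>p_hull p X x. vnorm X (a \<ominus> b) < \<delta> \<longrightarrow> a \<ominus> b \<in> p_hull p X y"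
  proof (rule ccontr)
    assume no_\<delta>: "\<not> ?thesis"
    \<comment> \<open>Difference and coefficients are coded as a pair, so that a single choice
      provides both sequences.\<close>
    have "\<exists>vg. fst vg \<in> carrier X \<and> vnorm X (fst vg) < 1 / Suc k \<and> fst vg \<notin> p_hull p X y \<and>
        (\<forall>m. lp_norm_fin q m (\<lambda>i. norm (snd vg i)) \<le> 2) \<and>
        (\<lambda>N. vnorm X (psums x (snd vg) N \<ominus> fst vg)) \<longlonglongrightarrow> 0" for k
    proof -
      have "1 / Suc k > (0::real)" by simp
      then obtain a b where ab: "a \<in> p_hull p X x" "b \<in> p_hull p X x" "vnorm X (a \<ominus> b) < 1 / Suc k"
          "a \<ominus> b \<notin> p_hull p X y"
        using no_\<delta> by blast
      obtain \<gamma> where "\<And>m. lp_norm_fin q m (\<lambda>i. norm (\<gamma> i)) \<le> 2"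
        "(\<lambda>N. vnorm X (psums x \<gamma> N \<ominus> (a \<ominus> b))) \<longlonglongrightarrow> 0"
        using p_hull_diff[of x a b, OF x_in ab(1,2)] by blast
      then show ?thesis
        using ab by (intro exI[of _ "(a \<ominus> b, \<gamma>)"]) (auto simp: p_hull_iff)
    qed
    then have "\<forall>k. \<exists>vg. fst vg \<in> carrier X \<and> vnorm X (fst vg) < 1 / Suc k \<and> fst vg \<notin> p_hull p X y \<and>
        (\<forall>m. lp_norm_fin q m (\<lambda>i. norm (snd vg i)) \<le> 2) \<and>
        (\<lambda>N. vnorm X (psums x (snd vg) N \<ominus> fst vg)) \<longlonglongrightarrow> 0" by blast
    from choice[OF this] obtain vg where vg: "\<forall>k. fst (vg k) \<in> carrier X \<and>
        vnorm X (fst (vg k)) < 1 / Suc k \<and> fst (vg k) \<notin> p_hull p X y \<and>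
        (\<forall>m. lp_norm_fin q m (\<lambda>i. norm (snd (vg k) i)) \<le> 2) \<and>
        (\<lambda>N. vnorm X (psums x (snd (vg k)) N \<ominus> fst (vg k))) \<longlonglongrightarrow> 0" ..
    have vg2: "norm (snd (vg k) i) \<le> 2" for k i
      using abs_le_lp_norm_fin[OF q_ge_1, of i "Suc i" "\<lambda>i. norm (snd (vg k) i)"] vg
      by (auto intro: order_trans)
    obtain l r where r: "strict_mono r" and l: "\<And>i. (\<lambda>k. snd (vg (r k)) i) \<longlonglongrightarrow> l i"
      using coordinatewise_convergent_subsequence[of "\<lambda>k. snd (vg k)" 2, OF vg2] by blast
    define v g where "v k = fst (vg (r k))" and "g k = snd (vg (r k))" for k
    have v: "v k \<in> carrier X" "v k \<notin> p_hull p X y" for k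
      using vg by (auto simp: v_def)
    have g: "lp_norm_fin q m (\<lambda>i. norm (g k i)) \<le> 2" for k m
      using vg by (auto simp: g_def)
    have gv: "(\<lambda>N. vnorm X (psums x (g k) N \<ominus> v k)) \<longlonglongrightarrow> 0" for k
      using vg by (auto simp: v_def g_def)
    have v0: "(\<lambda>k. vnorm X (v k)) \<longlonglongrightarrow> 0"
    proof (rule LIMSEQ_squeeze_0)
      show "(\<lambda>k. 1 / real (Suc k)) \<longlonglongrightarrow> 0" by (rule LIMSEQ_Suc[OF lim_1_over_n])
      show "vnorm X (v k) \<le> 1 / real (Suc k)" for k
      proof -
        have "vnorm X (v k) < 1 / real (Suc (r k))" using vg by (simp add: v_def)
        also have "\<dots> \<le> 1 / real (Suc k)"
          using seq_suble[OF r, of k] by (intro divide_left_mono) auto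
        finally show ?thesis by simp
      qed
    qed (use v in simp)
    \<comment> \<open>Coordinatewise limits need not respect norms, but each dual test is a finite
      sum and does pass to the limit.\<close>
    have l_norm: "lp_norm_fin q m (\<lambda>i. norm (l i)) \<le> 2" for m
    proof (subst lp_norm_fin_le_iff_dual[OF p_ge_1], simp, intro allI impI)
      fix b :: "nat \<Rightarrow> real" assume b: "\<forall>i. 0 \<le> b i" "lp_norm_fin p m b \<le> 1"
      have "(\<Sum>i<m. \<bar>norm (g k i)\<bar> * b i) \<le> 2" for k
        using g[of m k] lp_norm_fin_le_iff_dual[OF p_ge_1, of 2 m "\<lambda>i. norm (g k i)"] b by simp
      moreover have "(\<lambda>k. \<Sum>i<m. \<bar>norm (g k i)\<bar> * b i) \<longlonglongrightarrow> (\<Sum>i<m. \<bar>norm (l i)\<bar> * b i)"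
        unfolding g_def by (intro tendsto_intros l)
      ultimately show "(\<Sum>i<m. \<bar>norm (l i)\<bar> * b i) \<le> 2"
        by (intro LIMSEQ_le_const2) auto
    qed
    define d where "d k i = g k i - l i" for k i
    have d0: "(\<lambda>k. d k i) \<longlonglongrightarrow> 0" for i
      using tendsto_diff[OF l[of i] tendsto_const, of "l i"] by (simp add: d_def g_def)
    have d_norm: "lp_norm_fin q m (\<lambda>i. norm (d k i)) \<le> 4" for k m
    proof -
      have "lp_norm_fin q m (\<lambda>i. norm (d k i))
          \<le> 1 * lp_norm_fin q m (\<lambda>i. norm (g k i)) + 1 * lp_norm_fin q m (\<lambda>i. norm (l i))"
        by (intro lp_norm_fin_add_le q_ge_1) (auto simp: d_def intro: norm_triangle_ineq4)
      then show ?thesis using g[of m k] l_norm[of m] by simp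
    qed
    \<comment> \<open>The three contributions are the first \<open>N\<close> coordinates of
      \<open>g k - l\<close>, the tail of the series for \<open>v k\<close>, and \<open>v k\<close>
      itself; letting \<open>k\<close> grow leaves only the tail, at most
      \<open>2 * e / 3\<close>.\<close>
    have l0: "(\<lambda>N. vnorm X (psums x l N)) \<longlonglongrightarrow> 0"
    proof (rule LIMSEQ_I)
      fix e :: real assume "e > 0"
      then have "e / 3 > 0" by simp
      obtain N0 where N0: "\<And>m. lp_norm_fin p m (\<lambda>i. if i < N0 then 0 else vnorm X (x i)) \<le> e / 3"
        using lp_c0_seqs_tail[OF x \<open>e / 3 > 0\<close>] by blast
      have "vnorm X (psums x l N) \<le> e / 3 * 2" if "N \<ge> N0" for N
      proof -
        have "vnorm X (psums x l N) \<le>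
            (\<Sum>i<N. norm (d k i) * vnorm X (x i)) + e / 3 * 2 + vnorm X (v k)" for k
        proof -
          have 1: "vnorm X (psums x (g k) N \<ominus> psums x l N) \<le> (\<Sum>i<N. norm (d k i) * vnorm X (x i))"
            using psums_norm_le[of x "d k" N, OF x_in] psums_diff[of x "g k" l N, OF x_in]
            by (simp add: d_def[abs_def])
          have 2: "vnorm X (psums x (g k) N \<ominus> v k) \<le> e / 3 * 2"
            by (intro psums_limit_dist_le[of x "v k" N0 N "g k" 2 "e / 3"] x_in v(1) that g N0 gv)
          have in_X: "psums x l N \<in> carrier X" "psums x (g k) N \<in> carrier X" "v k \<in> carrier X"
            using psums_in x_in v by auto
          show ?thesis
            using 1 2 vnorm_le_add_diff[OF in_X(1,2)] vnorm_le_add_diff[OF in_X(2,3)]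
              vnorm_minus_commute[OF in_X(1,2)] by linarith
        qed
        moreover have "(\<lambda>k. (\<Sum>i<N. norm (d k i) * vnorm X (x i)) + e / 3 * 2 + vnorm X (v k))
            \<longlonglongrightarrow> (\<Sum>i<N. norm (0::'k) * vnorm X (x i)) + e / 3 * 2 + 0"
          by (intro tendsto_intros d0 v0)
        ultimately have "vnorm X (psums x l N)
            \<le> (\<Sum>i<N. norm (0::'k) * vnorm X (x i)) + e / 3 * 2 + 0"
          by (intro LIMSEQ_le_const) auto
        then show ?thesis by simp
      qed
      then show "\<exists>N0. \<forall>N\<ge>N0. norm (vnorm X (psums x l N) - 0) < e"
        using \<open>e > 0\<close> psums_in[of x, OF x_in] by (intro exI[of _ N0]) fastforce
    qed
    \<comment> \<open>Subtracting the null series with coefficients \<open>l\<close> leaves the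
      represented vector \<open>v k\<close> unchanged.\<close>
    have dv: "(\<lambda>N. vnorm X (psums x (d k) N \<ominus> v k)) \<longlonglongrightarrow> 0" for k
    proof -
      have le: "vnorm X (psums x (d k) N \<ominus> v k)
          \<le> vnorm X (psums x (g k) N \<ominus> v k) + vnorm X (psums x l N)" for N
      proof -
        have in_X: "psums x l N \<in> carrier X" "psums x (g k) N \<in> carrier X" "v k \<in> carrier X"
          using psums_in x_in v by auto
        have "psums x (d k) N = psums x (g k) N \<ominus> psums x l N"
          using psums_diff[of x "g k" l N, OF x_in] by (simp add: d_def[abs_def])
        then have "psums x (d k) N \<ominus> v k = (psums x (g k) N \<ominus> v k) \<ominus> psums x l N"
          using in_X by (simp add: a_minus_def M.a_ac)
        then show ?thesis using in_X by (simp add: vnorm_diff_le)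
      qed
      have lim: "(\<lambda>N. vnorm X (psums x (g k) N \<ominus> v k) + vnorm X (psums x l N)) \<longlonglongrightarrow> 0"
        using tendsto_add[OF gv[of k] l0] by simp
      have nn: "0 \<le> vnorm X (psums x (d k) N \<ominus> v k)" for N
        using psums_in[of x, OF x_in] v(1) by simp
      show ?thesis by (rule LIMSEQ_squeeze_0[OF lim nn le])
    qed
    \<comment> \<open>The head consists of finitely many coordinates, each tending to zero, so some
      \<open>k\<close> makes its weight less than one half.\<close>
    have "(\<lambda>k. \<Sum>i<N. norm (d k i) / \<eta>) \<longlonglongrightarrow> (\<Sum>i<N. norm (0::'k) / \<eta>)"
      using \<eta> by (intro tendsto_intros d0) auto
    then have "\<forall>\<^sub>F k in sequentially. (\<Sum>i<N. norm (d k i) / \<eta>) < 1 / 2"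
      by (intro order_tendstoD) auto
    then obtain k where k: "(\<Sum>i<N. norm (d k i) / \<eta>) < 1 / 2"
      using eventually_happens'[OF sequentially_bot] by blast
    \<comment> \<open>Chosen so that \<open>\<alpha> i\<close> times \<open>y i\<close> equals
      \<open>d k i\<close> times \<open>x i\<close>. The head costs at most one half by the choice
      of \<open>k\<close>, the division by 8 at most \<open>4 / 8\<close>.\<close>
    define \<alpha> where "\<alpha> i = (if i < N then d k i / of_real \<eta> else d k i / 8)" for i
    have "v k \<in> p_hull p X y"
    proof (rule p_hullI[where \<alpha>=\<alpha>])
      fix m
      show "lp_norm_fin q m (\<lambda>i. norm (\<alpha> i)) \<le> 1"
      proof (subst lp_norm_fin_le_iff_dual[OF p_ge_1], simp, intro allI impI)
        fix b :: "nat \<Rightarrow> real" assume b: "\<forall>i. 0 \<le> b i" "lp_norm_fin p m b \<le> 1"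
        have b1: "b i \<le> 1" if "i < m" for i
          using abs_le_lp_norm_fin[OF p_ge_1 that, of b] b by simp
        have pt: "\<bar>norm (\<alpha> i)\<bar> * b i \<le> (if i < N then norm (d k i) / \<eta> else 0) +
            (\<bar>norm (d k i)\<bar> * b i) / 8" if "i < m" for i
        proof (cases "i < N")
          case True
          have "norm (d k i) / \<eta> * b i \<le> norm (d k i) / \<eta> * 1"
            using b1[OF that] \<eta> by (intro mult_left_mono) auto
          moreover have "0 \<le> norm (d k i) * b i / 8" using b by simp
          ultimately show ?thesis using True \<eta> by (simp add: \<alpha>_def norm_divide)
        qed (simp add: \<alpha>_def norm_divide)
        have "(\<Sum>i<m. \<bar>norm (\<alpha> i)\<bar> * b i) \<le> (\<Sum>i<m. (if i < N then norm (d k i) / \<eta> else 0) +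
            (\<bar>norm (d k i)\<bar> * b i) / 8)"
          using pt by (intro sum_mono) auto
        also have "\<dots> = (\<Sum>i<m. if i < N then norm (d k i) / \<eta> else 0) +
            (\<Sum>i<m. \<bar>norm (d k i)\<bar> * b i) / 8"
          by (simp add: sum.distrib sum_divide_distrib)
        also have "(\<Sum>i<m. if i < N then norm (d k i) / \<eta> else 0) \<le> (\<Sum>i<N. norm (d k i) / \<eta>)"
        proof -
          have "(\<Sum>i<m. if i < N then norm (d k i) / \<eta> else 0) = (\<Sum>i\<in>{..<m} \<inter> {..<N}. norm (d k i) / \<eta>)"
            by (rule sum.mono_neutral_cong_right) auto
          also have "\<dots> \<le> (\<Sum>i<N. norm (d k i) / \<eta>)" using \<eta> by (intro sum_mono2) auto
          finally show ?thesis .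
        qed
        also have "(\<Sum>i<m. \<bar>norm (d k i)\<bar> * b i) \<le> 4"
          using d_norm[of m k] lp_norm_fin_le_iff_dual[OF p_ge_1, of 4 m "\<lambda>i. norm (d k i)"] b by simp
        finally show "(\<Sum>i<m. \<bar>norm (\<alpha> i)\<bar> * b i) \<le> 1" using k by simp
      qed
      have "\<alpha> i \<odot> y i = d k i \<odot> x i" for i
        using x_in \<eta> by (simp add: \<alpha>_def y_def flip: smult_mult)
      then have eq: "(\<lambda>N. finsum X (\<lambda>n. \<alpha> n \<odot> y n) {..<N}) = psums x (d k)"
        by (simp add: psums_def fun_eq_iff)
      show "limitin (vtopology X) (\<lambda>N. finsum X (\<lambda>n. \<alpha> n \<odot> y n) {..<N}) (v k) sequentially"
        unfolding eq using dv[of k] v psums_in[of x, OF x_in] by (subst limitin_iff) auto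
    qed (rule v)
    then show False using v by simp
  qed
  then show thesis using that y by blast
qed

section \<open>Linear structure of the p-continuous functions\<close>

lemma Cp_smult:
  assumes f: "f \<in> carrier Cp"
  shows "(\<lambda>\<omega>\<in>topspace \<Omega>. c \<odot> f \<omega>) \<in> carrier Cp"
proof -
  obtain x where x: "x \<in> lp_c0_seqs p X" and hull: "f ` topspace \<Omega> \<subseteq> p_hull p X x"
    using f by (auto simp: cp_space_simps cp_seqs_def)
  note x_in = lp_c0_seqs_carrier[OF x]
  define y where "y i = c \<odot> x i" for i
  have y_in: "y i \<in> carrier X" for i using x_in by (simp add: y_def)
  have y_norm: "vnorm X (y i) = norm c * vnorm X (x i)" for i using x_in by (simp add: y_def vnorm_smult)
  have "lp_norm_fin p m (\<lambda>i. vnorm X (y i)) \<le> norm c * lp_norm p (\<lambda>i. vnorm X (x i))" for m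
  proof -
    have "lp_norm_fin p m (\<lambda>i. vnorm X (y i)) \<le> norm c * lp_norm_fin p m (\<lambda>i. vnorm X (x i))"
      by (intro lp_norm_fin_scale_le p_ge_1) (auto simp: y_norm abs_mult)
    also have "\<dots> \<le> norm c * lp_norm p (\<lambda>i. vnorm X (x i))"
      by (intro mult_left_mono lp_c0_seqs_fin_le x) auto
    finally show ?thesis .
  qed
  moreover have "(\<lambda>n. vnorm X (y n)) \<longlonglongrightarrow> 0" if "p = \<infinity>"
    using tendsto_mult_right_zero[OF lp_c0_seqs_tendsto[OF x that]] by (simp add: y_norm)
  ultimately have y: "y \<in> lp_c0_seqs p X" by (rule lp_c0_seqsI(1)[of y, OF y_in])
  have "c \<odot> f \<omega> \<in> p_hull p X y" if "\<omega> \<in> topspace \<Omega>" for \<omega>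
  proof -
    have "f \<omega> \<in> p_hull p X x" using hull that by auto
    then obtain \<alpha> where \<alpha>: "f \<omega> \<in> carrier X" "\<And>m. lp_norm_fin q m (\<lambda>i. norm (\<alpha> i)) \<le> 1"
        "(\<lambda>N. vnorm X (psums x \<alpha> N \<ominus> f \<omega>)) \<longlonglongrightarrow> 0"
      using x_in unfolding p_hull_iff psums_def by (subst (asm) limitin_iff) auto
    have "psums y \<alpha> N = c \<odot> psums x \<alpha> N" for N
    proof -
      have "psums y \<alpha> N = finsum X (\<lambda>n. c \<odot> (\<alpha> n \<odot> x n)) {..<N}"
        unfolding psums_def y_def using x_in
        by (intro finsum_eq) (auto simp flip: smult_mult simp: mult.commute)
      also have "\<dots> = c \<odot> psums x \<alpha> N"
        unfolding psums_def using x_in by (intro smult_finsum[symmetric]) auto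
      finally show ?thesis .
    qed
    then have "vnorm X (psums y \<alpha> N \<ominus> c \<odot> f \<omega>) = norm c * vnorm X (psums x \<alpha> N \<ominus> f \<omega>)" for N
      using psums_in[of x, OF x_in] \<alpha>(1) by (simp flip: smult_diff_right add: vnorm_smult)
    then have "(\<lambda>N. vnorm X (psums y \<alpha> N \<ominus> c \<odot> f \<omega>)) \<longlonglongrightarrow> 0"
      using tendsto_mult_right_zero[OF \<alpha>(3)] by simp
    then show ?thesis
      using \<alpha> psums_in[of y, OF y_in] y_in unfolding psums_def
      by (intro p_hullI[where \<alpha>=\<alpha>]) (auto simp: limitin_iff)
  qed
  then have "y \<in> cp_seqs p \<Omega> X (\<lambda>\<omega>\<in>topspace \<Omega>. c \<odot> f \<omega>)"
    using y by (auto simp: cp_seqs_def)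
  moreover have "continuous_map \<Omega> (vtopology X) (\<lambda>\<omega>. c \<odot> f \<omega>)"
    using f by (intro continuous_map_smult_const) (simp add: cp_space_simps cont_space_simps)
  then have "continuous_map \<Omega> (vtopology X) (\<lambda>\<omega>\<in>topspace \<Omega>. c \<odot> f \<omega>)"
    by (rule continuous_map_eq) simp
  ultimately show ?thesis by (auto simp: cp_space_simps cont_space_simps)
qed

text \<open>Two interleaved coefficient sequences have norm at most 2 together, so they are halved
  and the factor 2 is put into the interleaved generating sequence.\<close>

lemma Cp_add:
  assumes f: "f \<in> carrier Cp" and g: "g \<in> carrier Cp"
  shows "(\<lambda>\<omega>\<in>topspace \<Omega>. f \<omega> \<oplus> g \<omega>) \<in> carrier Cp"
proof -
  obtain x where x: "x \<in> lp_c0_seqs p X" and hx: "f ` topspace \<Omega> \<subseteq> p_hull p X x"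
    using f by (auto simp: cp_space_simps cp_seqs_def)
  obtain z where z: "z \<in> lp_c0_seqs p X" and hz: "g ` topspace \<Omega> \<subseteq> p_hull p X z"
    using g by (auto simp: cp_space_simps cp_seqs_def)
  note x_in = lp_c0_seqs_carrier[OF x] and z_in = lp_c0_seqs_carrier[OF z]
  define y where "y i = 2 \<odot> interleave x z i" for i
  have y_in: "y i \<in> carrier X" for i using x_in z_in by (simp add: y_def interleave_def)
  have y_norm: "vnorm X (y i) = 2 * interleave (\<lambda>i. vnorm X (x i)) (\<lambda>i. vnorm X (z i)) i" for i
    using x_in z_in by (simp add: y_def vnorm_smult interleave_def)
  have "lp_norm_fin p m (\<lambda>i. vnorm X (y i))
      \<le> 2 * lp_norm p (\<lambda>i. vnorm X (x i)) + 2 * lp_norm p (\<lambda>i. vnorm X (z i))" for m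
    by (rule lp_norm_fin_interleave_le[OF p_ge_1 _ lp_c0_seqs_fin_le[OF x] lp_c0_seqs_fin_le[OF z]])
      (auto simp: y_norm abs_mult)
  moreover have "(\<lambda>n. vnorm X (y n)) \<longlonglongrightarrow> 0" if "p = \<infinity>"
  proof -
    have "filterlim (\<lambda>n::nat. n div 2) at_top sequentially"
      by (rule filterlim_at_top_div_const_nat) simp
    then have "(\<lambda>n. 2 * (vnorm X (x (n div 2)) + vnorm X (z (n div 2)))) \<longlonglongrightarrow> 2 * (0 + 0)"
      by (intro tendsto_mult tendsto_const tendsto_add
          filterlim_compose[OF lp_c0_seqs_tendsto[OF x that]]
          filterlim_compose[OF lp_c0_seqs_tendsto[OF z that]])
    then have "(\<lambda>n. 2 * (vnorm X (x (n div 2)) + vnorm X (z (n div 2)))) \<longlonglongrightarrow> 0" by simp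
    then show ?thesis
      by (rule LIMSEQ_squeeze_0) (use x_in z_in y_in in \<open>auto simp: y_norm interleave_def\<close>)
  qed
  ultimately have y: "y \<in> lp_c0_seqs p X" by (rule lp_c0_seqsI(1)[of y, OF y_in])
  have "f \<omega> \<oplus> g \<omega> \<in> p_hull p X y" if "\<omega> \<in> topspace \<Omega>" for \<omega>
  proof -
    have "f \<omega> \<in> p_hull p X x" using hx that by auto
    then obtain \<alpha> where \<alpha>: "f \<omega> \<in> carrier X" "\<And>m. lp_norm_fin q m (\<lambda>i. norm (\<alpha> i)) \<le> 1"
        "(\<lambda>N. vnorm X (psums x \<alpha> N \<ominus> f \<omega>)) \<longlonglongrightarrow> 0"
      using x_in unfolding p_hull_iff psums_def by (subst (asm) limitin_iff) auto
    have "g \<omega> \<in> p_hull p X z" using hz that by auto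
    then obtain \<beta> where \<beta>: "g \<omega> \<in> carrier X" "\<And>m. lp_norm_fin q m (\<lambda>i. norm (\<beta> i)) \<le> 1"
        "(\<lambda>N. vnorm X (psums z \<beta> N \<ominus> g \<omega>)) \<longlonglongrightarrow> 0"
      using z_in unfolding p_hull_iff psums_def by (subst (asm) limitin_iff) auto
    define \<gamma> where "\<gamma> i = interleave \<alpha> \<beta> i / 2" for i
    have \<gamma>: "lp_norm_fin q m (\<lambda>i. norm (\<gamma> i)) \<le> 1" for m
      using lp_norm_fin_interleave_le[OF q_ge_1 _ \<alpha>(2) \<beta>(2), of "1/2" "\<lambda>i. norm (\<gamma> i)" m]
      by (simp add: \<gamma>_def interleave_def norm_divide)
    have \<gamma>y: "\<gamma> i \<odot> y i = (if even i then \<alpha> (i div 2) \<odot> x (i div 2) else \<beta> (i div 2) \<odot> z (i div 2))" for i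
      using x_in z_in by (simp add: \<gamma>_def y_def interleave_def flip: smult_mult)
    \<comment> \<open>The first \<open>N\<close> interleaved terms contain \<open>N / 2\<close>
      terms of each kind, rounded up for \<open>x\<close> and down for \<open>z\<close>.\<close>
    have psums_y: "psums y \<gamma> N = psums x \<alpha> (Suc N div 2) \<oplus> psums z \<beta> (N div 2)" for N
    proof (induction N)
      case 0
      then show ?case by (simp add: psums_def)
    next
      case (Suc N)
      have "psums y \<gamma> (Suc N) = psums y \<gamma> N \<oplus> \<gamma> N \<odot> y N"
        unfolding psums_def using y_in by (intro finsum_lessThan_Suc) auto
      also have "\<dots> = (psums x \<alpha> (Suc N div 2) \<oplus> psums z \<beta> (N div 2)) \<oplus> \<gamma> N \<odot> y N"
        using Suc by simp
      also have "\<dots> = psums x \<alpha> (Suc (Suc N) div 2) \<oplus> psums z \<beta> (Suc N div 2)"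
      proof (cases "even N")
        case True
        then obtain k where k: "N = 2 * k" by (elim evenE)
        have "psums x \<alpha> (Suc k) = psums x \<alpha> k \<oplus> \<alpha> k \<odot> x k"
          unfolding psums_def using x_in by (intro finsum_lessThan_Suc) auto
        then show ?thesis
          using k x_in z_in psums_in[of x, OF x_in] psums_in[of z, OF z_in] by (simp add: \<gamma>y M.a_ac)
      next
        case False
        then obtain k where k: "N = 2 * k + 1" by (elim oddE)
        have "psums z \<beta> (Suc k) = psums z \<beta> k \<oplus> \<beta> k \<odot> z k"
          unfolding psums_def using z_in by (intro finsum_lessThan_Suc) auto
        then show ?thesis
          using k x_in z_in psums_in[of x, OF x_in] psums_in[of z, OF z_in] by (simp add: \<gamma>y M.a_ac)
      qed
      finally show ?case .
    qed
    have lim: "(\<lambda>N. vnorm X (psums x \<alpha> (Suc N div 2) \<ominus> f \<omega>) + vnorm X (psums z \<beta> (N div 2) \<ominus> g \<omega>)) \<longlonglongrightarrow> 0 + 0"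
    proof (intro tendsto_add filterlim_compose[OF \<alpha>(3)] filterlim_compose[OF \<beta>(3)])
      show "filterlim (\<lambda>n::nat. n div 2) at_top sequentially"
        by (rule filterlim_at_top_div_const_nat) simp
      from filterlim_compose[OF this filterlim_Suc]
      show "filterlim (\<lambda>n. Suc n div 2) at_top sequentially" .
    qed
    have le: "vnorm X (psums y \<gamma> N \<ominus> (f \<omega> \<oplus> g \<omega>))
        \<le> vnorm X (psums x \<alpha> (Suc N div 2) \<ominus> f \<omega>) + vnorm X (psums z \<beta> (N div 2) \<ominus> g \<omega>)" for N
      unfolding psums_y using psums_in[of x, OF x_in] psums_in[of z, OF z_in] \<alpha>(1) \<beta>(1)
      by (simp add: add_diff_add vnorm_triangle)
    have nn: "0 \<le> vnorm X (psums y \<gamma> N \<ominus> (f \<omega> \<oplus> g \<omega>))" for N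
      using psums_in[of y, OF y_in] \<alpha>(1) \<beta>(1) by simp
    have "(\<lambda>N. vnorm X (psums y \<gamma> N \<ominus> (f \<omega> \<oplus> g \<omega>))) \<longlonglongrightarrow> 0"
      by (rule LIMSEQ_squeeze_0[OF _ nn le]) (use lim in simp)
    then show ?thesis
      using \<alpha>(1) \<beta>(1) \<gamma> psums_in[of y, OF y_in] y_in unfolding psums_def
      by (intro p_hullI[where \<alpha>=\<gamma>]) (auto simp: limitin_iff)
  qed
  then have "y \<in> cp_seqs p \<Omega> X (\<lambda>\<omega>\<in>topspace \<Omega>. f \<omega> \<oplus> g \<omega>)"
    using y by (auto simp: cp_seqs_def)
  moreover have "continuous_map \<Omega> (vtopology X) (\<lambda>\<omega>. f \<omega> \<oplus> g \<omega>)"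
    using f g by (intro continuous_map_add) (simp_all add: cp_space_simps cont_space_simps)
  then have "continuous_map \<Omega> (vtopology X) (\<lambda>\<omega>\<in>topspace \<Omega>. f \<omega> \<oplus> g \<omega>)"
    by (rule continuous_map_eq) simp
  ultimately show ?thesis by (auto simp: cp_space_simps cont_space_simps)
qed

end

subsection \<open>Extending operators to \<open>\<C>\<^sub>p(\<Omega>, X)\<close>\<close>

context cp_setup
begin

text \<open>A partition of unity with tags, as for Riemann sums. Fineness is the variation of
  \<open>f\<close> where \<open>t j\<close> does not vanish, which stands in for a metric on the
  space.\<close>

definition fine_for :: "('t \<Rightarrow> 'x) \<Rightarrow> real \<Rightarrow> nat \<Rightarrow> (nat \<Rightarrow> 't \<Rightarrow> real) \<Rightarrow> (nat \<Rightarrow> 't) \<Rightarrow> bool" where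
  "fine_for f \<delta> n t w \<longleftrightarrow>
    (\<forall>j<n. w j \<in> topspace \<Omega> \<and> continuous_map \<Omega> euclideanreal (t j) \<and>
      (\<forall>\<omega>\<in>topspace \<Omega>. 0 \<le> t j \<omega> \<and> (t j \<omega> \<noteq> 0 \<longrightarrow> vnorm X (f \<omega> \<ominus> f (w j)) < \<delta>))) \<and>
    (\<forall>\<omega>\<in>topspace \<Omega>. (\<Sum>j<n. t j \<omega>) = 1)"

lemma fineD:
  assumes "fine_for f \<delta> n t w"
  shows "j < n \<Longrightarrow> w j \<in> topspace \<Omega>" "j < n \<Longrightarrow> continuous_map \<Omega> euclideanreal (t j)"
    "j < n \<Longrightarrow> \<omega> \<in> topspace \<Omega> \<Longrightarrow> 0 \<le> t j \<omega>"
    "j < n \<Longrightarrow> \<omega> \<in> topspace \<Omega> \<Longrightarrow> t j \<omega> \<noteq> 0 \<Longrightarrow> vnorm X (f \<omega> \<ominus> f (w j)) < \<delta>"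
    "\<omega> \<in> topspace \<Omega> \<Longrightarrow> (\<Sum>j<n. t j \<omega>) = 1"
  using assms by (auto simp: fine_for_def)

lemma fine_mono: "fine_for f \<delta> n t w \<Longrightarrow> \<delta> \<le> \<delta>' \<Longrightarrow> fine_for f \<delta>' n t w"
  by (fastforce simp: fine_for_def)

text \<open>Summing the variations over \<open>F\<close> gives one partition for finitely many
  functions; comparing \<open>f\<close>, \<open>g\<close> and their sum along a common partition
  depends on it.\<close>

lemma exists_fine:
  assumes F: "finite F" "F \<subseteq> carrier (cont_space \<Omega> X)" and "\<delta> > 0"
  shows "\<exists>n t w. \<forall>f\<in>F. fine_for f \<delta> n t w"
proof -
  have in_X: "f \<omega> \<in> carrier X" if "f \<in> F" "\<omega> \<in> topspace \<Omega>" for f \<omega>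
  proof -
    have "continuous_map \<Omega> (vtopology X) f" using F(2) that by (auto simp: cont_space_simps)
    then show ?thesis using that by (simp add: continuous_map_iff)
  qed
  define \<rho> where "\<rho> \<omega> \<omega>' = (\<Sum>f\<in>F. vnorm X (f \<omega> \<ominus> f \<omega>'))" for \<omega> \<omega>'
  have cont: "continuous_map \<Omega> euclideanreal (\<lambda>\<omega>. \<rho> \<omega> \<omega>')" if "\<omega>' \<in> topspace \<Omega>" for \<omega>'
    unfolding \<rho>_def using F in_X that
    by (intro continuous_map_sum continuous_map_vnorm_diff) (auto simp: cont_space_simps)
  have refl: "\<rho> \<omega> \<omega> = 0" if "\<omega> \<in> topspace \<Omega>" for \<omega>
    using in_X that by (simp add: \<rho>_def)
  have le: "vnorm X (f \<omega> \<ominus> f \<omega>') \<le> \<rho> \<omega> \<omega>'"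
    if "f \<in> F" "\<omega> \<in> topspace \<Omega>" "\<omega>' \<in> topspace \<Omega>" for f \<omega> \<omega>'
    unfolding \<rho>_def using that in_X F(1)
    by (intro member_le_sum[of f F "\<lambda>f. vnorm X (f \<omega> \<ominus> f \<omega>')"]) auto
  show ?thesis
  proof (rule exists_partition_of_unity[OF compact \<open>\<delta> > 0\<close> cont refl])
    fix n :: nat and t :: "nat \<Rightarrow> 't \<Rightarrow> real" and w
    assume P: "\<And>j. j < n \<Longrightarrow> w j \<in> topspace \<Omega>"
      "\<And>j. j < n \<Longrightarrow> continuous_map \<Omega> euclideanreal (t j)"
      "\<And>j \<omega>. \<omega> \<in> topspace \<Omega> \<Longrightarrow> 0 \<le> t j \<omega>"
      "\<And>\<omega>. \<omega> \<in> topspace \<Omega> \<Longrightarrow> (\<Sum>j<n. t j \<omega>) = 1"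
      "\<And>j \<omega>. j < n \<Longrightarrow> \<omega> \<in> topspace \<Omega> \<Longrightarrow> t j \<omega> \<noteq> 0 \<Longrightarrow> \<rho> \<omega> (w j) < \<delta>"
    have "fine_for f \<delta> n t w" if "f \<in> F" for f
      unfolding fine_for_def using P that by (auto intro: le_less_trans[OF le])
    then show "\<exists>n t w. \<forall>f\<in>F. fine_for f \<delta> n t w" by blast
  qed
qed

end

text \<open>\<open>C\<close> bounds the sums uniformly over all partitions; \<open>M\<close> serves
  for limits inside a single sum and for recognising \<open>S\<close> on elementary
  functions.\<close>

locale cp_extension = cp_setup X \<Omega> p + Y: banach_space Y
  for X :: "('k::rc_field, 'x) nspace" (structure) and \<Omega> :: "'t topology" and p
    and Y :: "('k, 'y) nspace" +
  fixes S :: "('t \<Rightarrow> 'k) \<Rightarrow> 'x \<Rightarrow> 'y" and M C :: real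
  assumes S: "bilinear_op Z X Y M S" and CS: "chevet_saphar_bounded p Z X Y S C"
    and C_nonneg: "0 \<le> C" and M_nonneg: "0 \<le> M"
begin

lemma normed_Y: "normed_space Y" ..

text \<open>The value that an extension of \<open>S\<close> must take at the function with values
  \<open>\<Sum> t j \<omega> f (w j)\<close>, which has finite rank and is uniformly close to
  \<open>f\<close> when the partition is fine for \<open>f\<close>.\<close>

definition rsum :: "('t \<Rightarrow> 'x) \<Rightarrow> nat \<Rightarrow> (nat \<Rightarrow> 't \<Rightarrow> real) \<Rightarrow> (nat \<Rightarrow> 't) \<Rightarrow> 'y" where
  "rsum f n t w = finsum Y (\<lambda>j. S (emb (t j)) (f (w j))) {..<n}"

lemma Cp_cont: "f \<in> carrier Cp \<Longrightarrow> f \<in> carrier (cont_space \<Omega> X)"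
  by (simp add: cp_space_simps)

lemma Cp_in_X: "f \<in> carrier Cp \<Longrightarrow> \<omega> \<in> topspace \<Omega> \<Longrightarrow> f \<omega> \<in> carrier X"
  by (simp add: cp_space_simps cont_space_simps continuous_map_iff)

lemma S_in: "continuous_map \<Omega> euclideanreal \<theta> \<Longrightarrow> x \<in> carrier X \<Longrightarrow> S (emb \<theta>) x \<in> carrier Y"
  by (intro bilinear_op_closed[OF S] emb_in_Z)

lemma rsum_in: "f \<in> carrier Cp \<Longrightarrow> fine_for g \<delta> n t w \<Longrightarrow> rsum f n t w \<in> carrier Y"
  unfolding rsum_def by (intro Y.finsum_in S_in Cp_in_X) (auto simp: fineD)

lemma rsum_bound:
  assumes "x \<in> cp_seqs p \<Omega> X f" "fine_for g \<delta> n t w"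
  shows "vnorm Y (rsum f n t w) \<le> C * lp_norm p (\<lambda>i. vnorm X (x i))"
  unfolding rsum_def
  using assms by (intro bounded_on_partition[OF normed_Y S CS C_nonneg])
    (auto simp: fineD cp_seqs_def)

text \<open>The second partition sums to one, so every \<open>t j\<close> is the sum of the products
  \<open>t j * t' k\<close>. Two sums can thus be compared over the product partition.\<close>

lemma rsum_refine:
  assumes f: "f \<in> carrier Cp" and P: "fine_for g \<delta> n t w" and P': "fine_for g' \<delta>' n' t' w'"
  shows "rsum f n t w =
    finsum Y (\<lambda>j. finsum Y (\<lambda>k. S (emb (\<lambda>\<omega>. t j \<omega> * t' k \<omega>)) (f (w j))) {..<n'}) {..<n}"
  unfolding rsum_def
proof (rule Y.finsum_eq)
  fix j assume j: "j \<in> {..<n}"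
  have e: "emb (\<lambda>\<omega>. t j \<omega> * t' k \<omega>) \<in> carrier Z" if "k < n'" for k
    using fineD[OF P] fineD[OF P'] j that by (intro emb_in_Z continuous_map_real_mult) auto
  then have "finsum Z (\<lambda>k. emb (\<lambda>\<omega>. t j \<omega> * t' k \<omega>)) {..<n'}
      = (\<lambda>\<omega>\<in>topspace \<Omega>. \<Sum>k<n'. emb (\<lambda>\<omega>. t j \<omega> * t' k \<omega>) \<omega>)"
    by (intro scalar_cont_finsum[OF compact]) auto
  also have "\<dots> = emb (t j)"
    unfolding emb_def
  proof (rule restrict_ext)
    fix \<omega> assume \<omega>: "\<omega> \<in> topspace \<Omega>"
    have "(\<Sum>k<n'. of_real (t j \<omega> * t' k \<omega>)) = (of_real (t j \<omega> * (\<Sum>k<n'. t' k \<omega>)) :: 'k)"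
      by (simp add: sum_distrib_left)
    then show "(\<Sum>k<n'. (\<lambda>\<omega>\<in>topspace \<Omega>. of_real (t j \<omega> * t' k \<omega>)) \<omega>) = (of_real (t j \<omega>) :: 'k)"
      using \<omega> fineD(5)[OF P' \<omega>] by simp
  qed
  finally have eq: "emb (t j) = finsum Z (\<lambda>k. emb (\<lambda>\<omega>. t j \<omega> * t' k \<omega>)) {..<n'}" ..
  show "S (emb (t j)) (f (w j)) = finsum Y (\<lambda>k. S (emb (\<lambda>\<omega>. t j \<omega> * t' k \<omega>)) (f (w j))) {..<n'}"
    unfolding eq using e j Cp_in_X[OF f] fineD(1)[OF P]
    by (intro bilinear_op_sum_left[OF normed_Z normed_Y S]) auto
  show "finsum Y (\<lambda>k. S (emb (\<lambda>\<omega>. t j \<omega> * t' k \<omega>)) (f (w j))) {..<n'} \<in> carrier Y"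
    using j Cp_in_X[OF f] fineD[OF P] fineD[OF P']
    by (intro Y.finsum_in S_in continuous_map_real_mult) auto
qed

text \<open>Over the product partition the difference of two sums has the vectors
  \<open>f (w j) - f (w' k)\<close>. Where \<open>t j * t' k\<close> does not vanish, both values
  are within \<open>\<delta> / 2\<close> of a common \<open>f \<omega>\<close>, so the vector lies
  in a hull of small norm and \<open>bounded_on_partition\<close> applies.\<close>

lemma rsum_Cauchy:
  assumes f: "f \<in> carrier Cp" and "\<epsilon> > 0"
  shows "\<exists>\<delta>>0. \<forall>n t w n' t' w'. fine_for f \<delta> n t w \<longrightarrow> fine_for f \<delta> n' t' w' \<longrightarrow>
    vnorm Y (rsum f n t w \<ominus>\<^bsub>Y\<^esub> rsum f n' t' w') \<le> \<epsilon>"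
proof -
  obtain x where x: "x \<in> lp_c0_seqs p X" and hull: "f ` topspace \<Omega> \<subseteq> p_hull p X x"
    using f by (auto simp: cp_space_simps cp_seqs_def)
  have "\<epsilon> / (C + 1) > 0" using C_nonneg \<open>\<epsilon> > 0\<close> by simp
  then obtain \<delta> y where \<delta>: "\<delta> > 0" and y: "y \<in> lp_c0_seqs p X"
      "lp_norm p (\<lambda>i. vnorm X (y i)) \<le> \<epsilon> / (C + 1)"
    and small: "\<And>a b. a \<in> p_hull p X x \<Longrightarrow> b \<in> p_hull p X x \<Longrightarrow> vnorm X (a \<ominus> b) < \<delta> \<Longrightarrow> a \<ominus> b \<in> p_hull p X y"
    using p_hull_small_differences[OF x] by blast
  show ?thesis
  proof (intro exI[of _ "\<delta> / 2"] conjI allI impI)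
    fix n t w n' t' w' assume P: "fine_for f (\<delta> / 2) n t w" and P': "fine_for f (\<delta> / 2) n' t' w'"
    define \<theta> where "\<theta> j k \<omega> = t j \<omega> * t' k \<omega>" for j k \<omega>
    have \<theta>: "continuous_map \<Omega> euclideanreal (\<theta> j k)" if "j < n" "k < n'" for j k
      unfolding \<theta>_def using fineD[OF P] fineD[OF P'] that by (intro continuous_map_real_mult) auto
    have fw: "f (w j) \<in> carrier X" "f (w' k) \<in> carrier X" if "j < n" "k < n'" for j k
      using fineD(1)[OF P] fineD(1)[OF P'] Cp_in_X[OF f] that by auto
    \<comment> \<open>Nothing is known about the difference when the product vanishes identically;
      zero lies in every hull and is a harmless value there.\<close>
    define v where "v j k = (if \<exists>\<omega>\<in>topspace \<Omega>. \<theta> j k \<omega> \<noteq> 0 then f (w j) \<ominus> f (w' k) else \<zero>)" for j k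
    have v: "v j k \<in> p_hull p X y" if jk: "j < n" "k < n'" for j k
    proof (cases "\<exists>\<omega>\<in>topspace \<Omega>. \<theta> j k \<omega> \<noteq> 0")
      case True
      then obtain \<omega> where \<omega>: "\<omega> \<in> topspace \<Omega>" "t j \<omega> \<noteq> 0" "t' k \<omega> \<noteq> 0" by (auto simp: \<theta>_def)
      have "vnorm X (f (w j) \<ominus> f (w' k)) \<le> vnorm X (f \<omega> \<ominus> f (w j)) + vnorm X (f \<omega> \<ominus> f (w' k))"
        using vnorm_diff_triangle[of "f (w j)" "f \<omega>" "f (w' k)"]
          vnorm_minus_commute[of "f (w j)" "f \<omega>"] fw[OF jk] Cp_in_X[OF f \<omega>(1)] by simp
      also have "\<dots> < \<delta> / 2 + \<delta> / 2"
        using fineD(4)[OF P jk(1) \<omega>(1,2)] fineD(4)[OF P' jk(2) \<omega>(1,3)] by simp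
      finally have "f (w j) \<ominus> f (w' k) \<in> p_hull p X y"
        using hull fineD(1)[OF P jk(1)] fineD(1)[OF P' jk(2)] by (intro small) auto
      then show ?thesis using True by (simp add: v_def)
    next
      case False
      then show ?thesis using zero_in_p_hull[of y] lp_c0_seqs_carrier[OF y(1)] by (simp add: v_def)
    qed
    have tm: "S (emb (\<theta> j k)) (f (w j)) \<ominus>\<^bsub>Y\<^esub> S (emb (\<theta> j k)) (f (w' k)) = S (emb (\<theta> j k)) (v j k)"
      if jk: "j < n" "k < n'" for j k
    proof -
      note e = emb_in_Z[OF \<theta>[OF jk]]
      have lin: "(\<lambda>x\<in>carrier X. S (emb (\<theta> j k)) x) \<in> linear_maps X Y"
        using S e by (simp add: bilinear_op_def)
      have *: "S (emb (\<theta> j k)) (f (w j)) \<ominus>\<^bsub>Y\<^esub> S (emb (\<theta> j k)) (f (w' k)) =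
          S (emb (\<theta> j k)) (f (w j) \<ominus> f (w' k))"
        using linear_maps_diff[OF normed_X normed_Y lin fw[OF jk]] fw[OF jk] by simp
      show ?thesis
      proof (cases "\<exists>\<omega>\<in>topspace \<Omega>. \<theta> j k \<omega> \<noteq> 0")
        case True
        then show ?thesis using * by (simp add: v_def)
      next
        case False
        then have e0: "emb (\<theta> j k) = 0 \<odot>\<^bsub>Z\<^esub> emb (\<theta> j k)"
          by (auto simp: emb_def cont_space_simps fun_eq_iff)
        interpret Z: normed_space Z by (rule normed_Z)
        have zero: "S (emb (\<theta> j k)) u = \<zero>\<^bsub>Y\<^esub>" if "u \<in> carrier X" for u
          using bilinear_op_smult_left[OF S that e, of 0] e0 e bilinear_op_closed[OF S e that]
          by (simp del: Z.smult_0)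
        show ?thesis using zero * fw[OF jk] by (simp add: v_def False)
      qed
    qed
    let ?A = "\<lambda>j k. S (emb (\<theta> j k)) (f (w j))" and ?B = "\<lambda>j k. S (emb (\<theta> j k)) (f (w' k))"
    have in_Y: "?A j k \<in> carrier Y" "?B j k \<in> carrier Y" if "j < n" "k < n'" for j k
      using S_in[OF \<theta>[OF that]] fw[OF that] by auto
    have A: "rsum f n t w = finsum Y (\<lambda>j. finsum Y (\<lambda>k. ?A j k) {..<n'}) {..<n}"
      unfolding \<theta>_def by (rule rsum_refine[OF f P P'])
    have "rsum f n' t' w' = finsum Y (\<lambda>k. finsum Y (\<lambda>j. ?B j k) {..<n}) {..<n'}"
      unfolding \<theta>_def using rsum_refine[OF f P' P] by (simp add: mult.commute)
    also have "\<dots> = finsum Y (\<lambda>j. finsum Y (\<lambda>k. ?B j k) {..<n'}) {..<n}"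
      using in_Y by (intro Y.finsum_swap) auto
    finally have B: "rsum f n' t' w' = \<dots>" .
    have "rsum f n t w \<ominus>\<^bsub>Y\<^esub> rsum f n' t' w'
        = finsum Y (\<lambda>j. finsum Y (\<lambda>k. ?A j k) {..<n'} \<ominus>\<^bsub>Y\<^esub> finsum Y (\<lambda>k. ?B j k) {..<n'}) {..<n}"
      unfolding A B using in_Y by (intro Y.finsum_diff[symmetric] Y.finsum_in) auto
    also have "\<dots> = finsum Y (\<lambda>j. finsum Y (\<lambda>k. S (emb (\<theta> j k)) (v j k)) {..<n'}) {..<n}"
    proof (rule Y.finsum_eq)
      fix j assume j: "j \<in> {..<n}"
      have "finsum Y (\<lambda>k. ?A j k) {..<n'} \<ominus>\<^bsub>Y\<^esub> finsum Y (\<lambda>k. ?B j k) {..<n'}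
          = finsum Y (\<lambda>k. ?A j k \<ominus>\<^bsub>Y\<^esub> ?B j k) {..<n'}"
        using in_Y j by (intro Y.finsum_diff[symmetric]) auto
      also have "\<dots> = finsum Y (\<lambda>k. S (emb (\<theta> j k)) (v j k)) {..<n'}"
        using j v by (intro Y.finsum_eq S_in \<theta>) (auto simp: tm p_hull_iff)
      finally show "finsum Y (\<lambda>k. ?A j k) {..<n'} \<ominus>\<^bsub>Y\<^esub> finsum Y (\<lambda>k. ?B j k) {..<n'}
          = finsum Y (\<lambda>k. S (emb (\<theta> j k)) (v j k)) {..<n'}" .
      show "finsum Y (\<lambda>k. S (emb (\<theta> j k)) (v j k)) {..<n'} \<in> carrier Y"
        using j v by (intro Y.finsum_in S_in \<theta>) (auto simp: p_hull_iff)
    qed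
    also have "\<dots> = finsum Y (\<lambda>(j, k). S (emb (\<theta> j k)) (v j k)) ({..<n} \<times> {..<n'})"
      using v by (intro Y.finsum_product S_in \<theta>) (auto simp: p_hull_iff)
    also have "\<dots> = finsum Y (\<lambda>jk. S (emb (case jk of (j, k) \<Rightarrow> \<theta> j k)) (case jk of (j, k) \<Rightarrow> v j k))
        ({..<n} \<times> {..<n'})"
      by (simp add: case_prod_unfold)
    finally have eq: "rsum f n t w \<ominus>\<^bsub>Y\<^esub> rsum f n' t' w' = \<dots>" .
    have "vnorm Y (rsum f n t w \<ominus>\<^bsub>Y\<^esub> rsum f n' t' w') \<le> C * lp_norm p (\<lambda>i. vnorm X (y i))"
      unfolding eq
    proof (rule bounded_on_partition[OF normed_Y S CS C_nonneg _ _ _ _ y(1)])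
      fix \<omega> assume \<omega>: "\<omega> \<in> topspace \<Omega>"
      have "(\<Sum>jk\<in>{..<n} \<times> {..<n'}. (case jk of (j, k) \<Rightarrow> \<theta> j k) \<omega>) = (\<Sum>j<n. t j \<omega> * (\<Sum>k<n'. t' k \<omega>))"
        by (simp add: \<theta>_def case_prod_unfold sum_distrib_left sum.cartesian_product)
      also have "\<dots> = 1" using fineD(5)[OF P \<omega>] fineD(5)[OF P' \<omega>] by simp
      finally show "(\<Sum>jk\<in>{..<n} \<times> {..<n'}. (case jk of (j, k) \<Rightarrow> \<theta> j k) \<omega>) \<le> 1" by simp
    qed (use \<theta> v fineD(3)[OF P] fineD(3)[OF P'] in \<open>auto simp: \<theta>_def\<close>)
    also have "\<dots> \<le> C * (\<epsilon> / (C + 1))" using y(2) C_nonneg by (rule mult_left_mono)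
    also have "\<dots> \<le> \<epsilon>" using C_nonneg \<open>\<epsilon> > 0\<close> by (simp add: field_simps)
    finally show "vnorm Y (rsum f n t w \<ominus>\<^bsub>Y\<^esub> rsum f n' t' w') \<le> \<epsilon>" .
  qed (use \<delta> in simp)
qed

text \<open>Convergence along fineness rather than along a sequence, so that limits for different
  functions can be read off from the same partition.\<close>

definition rsum_limit :: "('t \<Rightarrow> 'x) \<Rightarrow> 'y \<Rightarrow> bool" where
  "rsum_limit f v \<longleftrightarrow> v \<in> carrier Y \<and>
    (\<forall>\<epsilon>>0. \<exists>\<delta>>0. \<forall>n t w. fine_for f \<delta> n t w \<longrightarrow> vnorm Y (rsum f n t w \<ominus>\<^bsub>Y\<^esub> v) \<le> \<epsilon>)"

text \<open>Sums over \<open>1 / Suc k\<close>-fine partitions form a Cauchy sequence, completeness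
  of \<open>Y\<close> gives a limit, and \<open>rsum_Cauchy\<close> shows that all sufficiently fine
  partitions approach the same limit.\<close>

lemma rsum_limit_exists:
  assumes f: "f \<in> carrier Cp"
  shows "\<exists>v. rsum_limit f v"
proof -
  have "\<exists>s. \<exists>n t w. fine_for f (1 / Suc k) n t w \<and> s = rsum f n t w" for k
  proof -
    have "\<exists>n t w. \<forall>f\<in>{f}. fine_for f (1 / Suc k) n t w"
      using Cp_cont[OF f] by (intro exists_fine) auto
    then show ?thesis by blast
  qed
  then have "\<forall>k. \<exists>s. \<exists>n t w. fine_for f (1 / Suc k) n t w \<and> s = rsum f n t w" ..
  from choice[OF this] obtain s where "\<forall>k. \<exists>n t w. fine_for f (1 / Suc k) n t w \<and> s k = rsum f n t w" ..
  then have s: "\<exists>n t w. fine_for f (1 / Suc k) n t w \<and> s k = rsum f n t w" for k ..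
  have s_in: "s k \<in> carrier Y" for k using s[of k] rsum_in[OF f] by auto
  have near: "\<exists>K. \<forall>k\<ge>K. \<forall>n t w. fine_for f \<delta> n t w \<longrightarrow> vnorm Y (rsum f n t w \<ominus>\<^bsub>Y\<^esub> s k) \<le> \<epsilon>"
    if "\<delta> > 0" and \<delta>: "\<And>n t w n' t' w'. fine_for f \<delta> n t w \<Longrightarrow> fine_for f \<delta> n' t' w' \<Longrightarrow>
      vnorm Y (rsum f n t w \<ominus>\<^bsub>Y\<^esub> rsum f n' t' w') \<le> \<epsilon>" for \<delta> \<epsilon>
  proof -
    obtain K where K: "1 / Suc K < \<delta>" using \<open>\<delta> > 0\<close> nat_approx_posE by blast
    have "vnorm Y (rsum f n t w \<ominus>\<^bsub>Y\<^esub> s k) \<le> \<epsilon>" if "k \<ge> K" "fine_for f \<delta> n t w" for k n t w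
    proof -
      obtain n' t' w' where P': "fine_for f (1 / Suc k) n' t' w'" "s k = rsum f n' t' w'"
        using s by blast
      have "1 / Suc k \<le> 1 / Suc K" using that(1) by (intro divide_left_mono) auto
      then have "fine_for f \<delta> n' t' w'" using K P'(1) by (intro fine_mono[OF P'(1)]) simp
      then show ?thesis using \<delta>[OF that(2)] P'(2) by simp
    qed
    then show ?thesis by blast
  qed
  have "Metric_space.MCauchy (carrier Y) (vdist Y) s"
    unfolding Y.metric.MCauchy_def
  proof (intro conjI allI impI)
    show "range s \<subseteq> carrier Y" using s_in by auto
    fix \<epsilon> :: real assume "\<epsilon> > 0"
    then have "\<epsilon> / 2 > 0" by simp
    obtain \<delta> where \<delta>: "\<delta> > 0" "\<And>n t w n' t' w'. fine_for f \<delta> n t w \<Longrightarrow> fine_for f \<delta> n' t' w' \<Longrightarrow>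
        vnorm Y (rsum f n t w \<ominus>\<^bsub>Y\<^esub> rsum f n' t' w') \<le> \<epsilon> / 2"
      using rsum_Cauchy[OF f \<open>\<epsilon> / 2 > 0\<close>] by blast
    obtain K where K: "\<And>k n t w. k \<ge> K \<Longrightarrow> fine_for f \<delta> n t w \<Longrightarrow> vnorm Y (rsum f n t w \<ominus>\<^bsub>Y\<^esub> s k) \<le> \<epsilon> / 2"
      using near[OF \<delta>] by blast
    obtain K' where K': "1 / Suc K' < \<delta>" using \<delta>(1) nat_approx_posE by blast
    have "vdist Y (s k) (s k') < \<epsilon>" if "max K K' \<le> k" "max K K' \<le> k'" for k k'
    proof -
      obtain n t w where P: "fine_for f (1 / Suc k) n t w" "s k = rsum f n t w"
        using s by blast
      have "1 / Suc k \<le> 1 / Suc K'" using that by (intro divide_left_mono) auto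
      then have "fine_for f \<delta> n t w" using K' by (intro fine_mono[OF P(1)]) simp
      then have "vnorm Y (s k \<ominus>\<^bsub>Y\<^esub> s k') \<le> \<epsilon> / 2" using K[of k' n t w] that P(2) by simp
      then show ?thesis using s_in \<open>\<epsilon> > 0\<close> by (simp add: vdist_def)
    qed
    then show "\<exists>N. \<forall>n n'. N \<le> n \<longrightarrow> N \<le> n' \<longrightarrow> vdist Y (s n) (s n') < \<epsilon>" by blast
  qed
  then obtain v where "limitin (vtopology Y) s v sequentially"
    using Y.complete unfolding Y.metric.mcomplete_def by blast
  then have v: "v \<in> carrier Y" and lim: "(\<lambda>k. vnorm Y (s k \<ominus>\<^bsub>Y\<^esub> v)) \<longlonglongrightarrow> 0"
    using Y.limitin_iff[of s, OF s_in] by auto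
  have "\<exists>\<delta>>0. \<forall>n t w. fine_for f \<delta> n t w \<longrightarrow> vnorm Y (rsum f n t w \<ominus>\<^bsub>Y\<^esub> v) \<le> \<epsilon>" if "\<epsilon> > 0" for \<epsilon>
  proof -
    obtain \<delta> where \<delta>: "\<delta> > 0" "\<And>n t w n' t' w'. fine_for f \<delta> n t w \<Longrightarrow> fine_for f \<delta> n' t' w' \<Longrightarrow>
        vnorm Y (rsum f n t w \<ominus>\<^bsub>Y\<^esub> rsum f n' t' w') \<le> \<epsilon>"
      using rsum_Cauchy[OF f \<open>\<epsilon> > 0\<close>] by blast
    obtain K where K: "\<And>k n t w. k \<ge> K \<Longrightarrow> fine_for f \<delta> n t w \<Longrightarrow> vnorm Y (rsum f n t w \<ominus>\<^bsub>Y\<^esub> s k) \<le> \<epsilon>"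
      using near[OF \<delta>] by blast
    have "vnorm Y (rsum f n t w \<ominus>\<^bsub>Y\<^esub> v) \<le> \<epsilon>" if P: "fine_for f \<delta> n t w" for n t w
    proof -
      have "vnorm Y (rsum f n t w \<ominus>\<^bsub>Y\<^esub> v) \<le> \<epsilon> + vnorm Y (s k \<ominus>\<^bsub>Y\<^esub> v)" if "k \<ge> K" for k
        using Y.vnorm_diff_triangle[OF rsum_in[OF f P] s_in[of k] v] K[OF that P] by simp
      moreover have "(\<lambda>k. \<epsilon> + vnorm Y (s k \<ominus>\<^bsub>Y\<^esub> v)) \<longlonglongrightarrow> \<epsilon> + 0"
        by (intro tendsto_add tendsto_const lim)
      ultimately have "vnorm Y (rsum f n t w \<ominus>\<^bsub>Y\<^esub> v) \<le> \<epsilon> + 0" using LIMSEQ_le_const by blast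
      then show ?thesis by simp
    qed
    then show ?thesis using \<delta>(1) by blast
  qed
  then show ?thesis using v unfolding rsum_limit_def by blast
qed

text \<open>The minimum of the finitely many thresholds and of \<open>\<epsilon>\<close> works for
  all functions at once. Fineness \<open>\<epsilon>\<close> itself is included because elementary
  functions are identified through it.\<close>

lemma rsum_limit_close:
  assumes F: "finite F" "F \<subseteq> carrier Cp" and lim: "\<And>f. f \<in> F \<Longrightarrow> rsum_limit f (v f)" and "\<epsilon> > 0"
  shows "\<exists>n t w. \<forall>f\<in>F. fine_for f \<epsilon> n t w \<and> vnorm Y (rsum f n t w \<ominus>\<^bsub>Y\<^esub> v f) \<le> \<epsilon>"
proof -
  have "\<forall>f\<in>F. \<exists>\<delta>>0. \<forall>n t w. fine_for f \<delta> n t w \<longrightarrow> vnorm Y (rsum f n t w \<ominus>\<^bsub>Y\<^esub> v f) \<le> \<epsilon>"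
    using lim \<open>\<epsilon> > 0\<close> unfolding rsum_limit_def by blast
  from bchoice[OF this] obtain d where d: "\<forall>f\<in>F. d f > 0 \<and>
      (\<forall>n t w. fine_for f (d f) n t w \<longrightarrow> vnorm Y (rsum f n t w \<ominus>\<^bsub>Y\<^esub> v f) \<le> \<epsilon>)" ..
  define \<delta> where "\<delta> = Min (insert \<epsilon> (d ` F))"
  have \<delta>: "\<delta> > 0" "\<delta> \<le> \<epsilon>" "\<And>f. f \<in> F \<Longrightarrow> \<delta> \<le> d f"
    using F(1) d \<open>\<epsilon> > 0\<close> by (auto simp: \<delta>_def)
  have "F \<subseteq> carrier (cont_space \<Omega> X)" using F(2) Cp_cont by blast
  then obtain n t w where P: "\<And>f. f \<in> F \<Longrightarrow> fine_for f \<delta> n t w"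
    using exists_fine[OF F(1) _ \<delta>(1)] by blast
  show ?thesis
  proof (intro exI[of _ n] exI[of _ t] exI[of _ w] ballI conjI)
    fix f assume f: "f \<in> F"
    show "fine_for f \<epsilon> n t w" using fine_mono[OF P[OF f] \<delta>(2)] .
    show "vnorm Y (rsum f n t w \<ominus>\<^bsub>Y\<^esub> v f) \<le> \<epsilon>"
      using d f fine_mono[OF P[OF f] \<delta>(3)[OF f]] by blast
  qed
qed

lemma eq_if_close:
  assumes "a \<in> carrier Y" "b \<in> carrier Y" "\<And>\<epsilon>. \<epsilon> > 0 \<Longrightarrow> vnorm Y (a \<ominus>\<^bsub>Y\<^esub> b) \<le> K * \<epsilon>" "K > 0"
  shows "a = b"
proof -
  have "vnorm Y (a \<ominus>\<^bsub>Y\<^esub> b) \<le> 0"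
  proof (rule field_le_epsilon)
    fix e :: real assume "e > 0"
    then show "vnorm Y (a \<ominus>\<^bsub>Y\<^esub> b) \<le> 0 + e"
      using assms(3)[of "e / K"] assms(4) by simp
  qed
  then have "vnorm Y (a \<ominus>\<^bsub>Y\<^esub> b) = 0" using assms(1,2) by (intro antisym) auto
  then show ?thesis using assms(1,2) by (simp add: Y.vnorm_eq_0 Y.diff_eq_zero_iff)
qed

definition ext_op :: "('t \<Rightarrow> 'x) \<Rightarrow> 'y" where
  "ext_op = (\<lambda>f\<in>carrier Cp. SOME v. rsum_limit f v)"

lemma ext_op_limit: "f \<in> carrier Cp \<Longrightarrow> rsum_limit f (ext_op f)"
  unfolding ext_op_def using someI_ex[OF rsum_limit_exists] by simp

lemma ext_op_in: "f \<in> carrier Cp \<Longrightarrow> ext_op f \<in> carrier Y"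
  using ext_op_limit by (simp add: rsum_limit_def)

lemma ext_op_bound:
  assumes f: "f \<in> carrier Cp" and x: "x \<in> cp_seqs p \<Omega> X f"
  shows "vnorm Y (ext_op f) \<le> C * lp_norm p (\<lambda>i. vnorm X (x i))"
proof (rule field_le_epsilon)
  fix \<epsilon> :: real assume "\<epsilon> > 0"
  obtain n t w where P: "fine_for f \<epsilon> n t w" "vnorm Y (rsum f n t w \<ominus>\<^bsub>Y\<^esub> ext_op f) \<le> \<epsilon>"
    using rsum_limit_close[of "{f}" ext_op \<epsilon>] f ext_op_limit \<open>\<epsilon> > 0\<close> by blast
  then show "vnorm Y (ext_op f) \<le> C * lp_norm p (\<lambda>i. vnorm X (x i)) + \<epsilon>"
    using rsum_bound[OF x P(1)] rsum_in[OF f P(1)] ext_op_in[OF f]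
      Y.vnorm_le_add_diff[of "ext_op f" "rsum f n t w"]
      Y.vnorm_minus_commute[of "ext_op f" "rsum f n t w"] by simp
qed

text \<open>For a fixed partition \<open>rsum\<close> is linear in the function, and a partition
  suitable for both functions transfers this to the limits up to a multiple of every
  \<open>\<epsilon>\<close>.\<close>

lemma ext_op_smult:
  assumes f: "f \<in> carrier Cp"
  shows "ext_op (c \<odot>\<^bsub>Cp\<^esub> f) = c \<odot>\<^bsub>Y\<^esub> ext_op f"
proof (rule eq_if_close)
  let ?g = "c \<odot>\<^bsub>Cp\<^esub> f"
  have g: "?g \<in> carrier Cp" using Cp_smult[OF f, of c] by (simp add: cp_space_simps)
  show "ext_op ?g \<in> carrier Y" "c \<odot>\<^bsub>Y\<^esub> ext_op f \<in> carrier Y"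
    using ext_op_in[OF g] ext_op_in[OF f] by auto
  fix \<epsilon> :: real assume "\<epsilon> > 0"
  obtain n t w where P: "fine_for f \<epsilon> n t w" "vnorm Y (rsum f n t w \<ominus>\<^bsub>Y\<^esub> ext_op f) \<le> \<epsilon>"
      "vnorm Y (rsum ?g n t w \<ominus>\<^bsub>Y\<^esub> ext_op ?g) \<le> \<epsilon>"
    using rsum_limit_close[of "{f, ?g}" ext_op \<epsilon>] f g ext_op_limit \<open>\<epsilon> > 0\<close> by blast
  note D = fineD[OF P(1)]
  have eq: "rsum ?g n t w = c \<odot>\<^bsub>Y\<^esub> rsum f n t w"
  proof -
    have "rsum ?g n t w = finsum Y (\<lambda>j. c \<odot>\<^bsub>Y\<^esub> S (emb (t j)) (f (w j))) {..<n}"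
      unfolding rsum_def using D Cp_in_X[OF f]
      by (intro Y.finsum_eq)
        (auto simp: cp_space_simps bilinear_op_smult_right[OF S] emb_in_Z intro!: Y.smult_in S_in)
    then show ?thesis
      unfolding rsum_def using D Cp_in_X[OF f]
      by (subst Y.smult_finsum) (auto intro!: S_in)
  qed
  note in_Y = rsum_in[OF f P(1)] rsum_in[OF g P(1)] ext_op_in[OF f] ext_op_in[OF g]
  have "vnorm Y (ext_op ?g \<ominus>\<^bsub>Y\<^esub> c \<odot>\<^bsub>Y\<^esub> ext_op f)
      \<le> vnorm Y (ext_op ?g \<ominus>\<^bsub>Y\<^esub> rsum ?g n t w) + vnorm Y (rsum ?g n t w \<ominus>\<^bsub>Y\<^esub> c \<odot>\<^bsub>Y\<^esub> ext_op f)"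
    using in_Y by (intro Y.vnorm_diff_triangle) auto
  also have "rsum ?g n t w \<ominus>\<^bsub>Y\<^esub> c \<odot>\<^bsub>Y\<^esub> ext_op f = c \<odot>\<^bsub>Y\<^esub> (rsum f n t w \<ominus>\<^bsub>Y\<^esub> ext_op f)"
    using in_Y by (simp add: eq Y.smult_diff_right)
  also have "vnorm Y (ext_op ?g \<ominus>\<^bsub>Y\<^esub> rsum ?g n t w) + vnorm Y \<dots> \<le> \<epsilon> + norm c * \<epsilon>"
    using in_Y P(2,3) Y.vnorm_minus_commute[OF in_Y(4,2)]
    by (simp add: Y.vnorm_smult add_mono mult_left_mono)
  finally show "vnorm Y (ext_op ?g \<ominus>\<^bsub>Y\<^esub> c \<odot>\<^bsub>Y\<^esub> ext_op f) \<le> (1 + norm c) * \<epsilon>"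
    by (simp add: algebra_simps)
qed (simp add: add_pos_nonneg)

lemma ext_op_add:
  assumes f: "f \<in> carrier Cp" and g: "g \<in> carrier Cp"
  shows "ext_op (f \<oplus>\<^bsub>Cp\<^esub> g) = ext_op f \<oplus>\<^bsub>Y\<^esub> ext_op g"
proof (rule eq_if_close)
  let ?h = "f \<oplus>\<^bsub>Cp\<^esub> g"
  have h: "?h \<in> carrier Cp" using Cp_add[OF f g] by (simp add: cp_space_simps)
  show "ext_op ?h \<in> carrier Y" "ext_op f \<oplus>\<^bsub>Y\<^esub> ext_op g \<in> carrier Y"
    using ext_op_in[OF h] ext_op_in[OF f] ext_op_in[OF g] by auto
  fix \<epsilon> :: real assume "\<epsilon> > 0"
  obtain n t w where P: "fine_for f \<epsilon> n t w" "vnorm Y (rsum f n t w \<ominus>\<^bsub>Y\<^esub> ext_op f) \<le> \<epsilon>"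
      "vnorm Y (rsum g n t w \<ominus>\<^bsub>Y\<^esub> ext_op g) \<le> \<epsilon>"
      "vnorm Y (rsum ?h n t w \<ominus>\<^bsub>Y\<^esub> ext_op ?h) \<le> \<epsilon>"
    using rsum_limit_close[of "{f, g, ?h}" ext_op \<epsilon>] f g h ext_op_limit \<open>\<epsilon> > 0\<close> by blast
  note D = fineD[OF P(1)]
  have eq: "rsum ?h n t w = rsum f n t w \<oplus>\<^bsub>Y\<^esub> rsum g n t w"
  proof -
    have "rsum ?h n t w = finsum Y (\<lambda>j. S (emb (t j)) (f (w j)) \<oplus>\<^bsub>Y\<^esub> S (emb (t j)) (g (w j))) {..<n}"
      unfolding rsum_def using D Cp_in_X[OF f] Cp_in_X[OF g]
      by (intro Y.finsum_eq)
        (auto simp: cp_space_simps bilinear_op_add_right[OF S] emb_in_Z intro!: Y.M.a_closed S_in)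
    then show ?thesis
      unfolding rsum_def using D Cp_in_X[OF f] Cp_in_X[OF g]
      by (subst (asm) Y.finsum_add) (auto intro!: S_in)
  qed
  note in_Y = rsum_in[OF f P(1)] rsum_in[OF g P(1)] rsum_in[OF h P(1)]
    ext_op_in[OF f] ext_op_in[OF g] ext_op_in[OF h]
  have "vnorm Y (ext_op ?h \<ominus>\<^bsub>Y\<^esub> (ext_op f \<oplus>\<^bsub>Y\<^esub> ext_op g))
      \<le> vnorm Y (ext_op ?h \<ominus>\<^bsub>Y\<^esub> rsum ?h n t w)
        + vnorm Y (rsum ?h n t w \<ominus>\<^bsub>Y\<^esub> (ext_op f \<oplus>\<^bsub>Y\<^esub> ext_op g))"
    using in_Y by (intro Y.vnorm_diff_triangle) auto
  also have "rsum ?h n t w \<ominus>\<^bsub>Y\<^esub> (ext_op f \<oplus>\<^bsub>Y\<^esub> ext_op g)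
      = (rsum f n t w \<ominus>\<^bsub>Y\<^esub> ext_op f) \<oplus>\<^bsub>Y\<^esub> (rsum g n t w \<ominus>\<^bsub>Y\<^esub> ext_op g)"
    using in_Y by (simp add: eq Y.add_diff_add)
  also have "vnorm Y (ext_op ?h \<ominus>\<^bsub>Y\<^esub> rsum ?h n t w) + vnorm Y \<dots> \<le> \<epsilon> + (\<epsilon> + \<epsilon>)"
    using in_Y P(2-4) Y.vnorm_minus_commute[OF in_Y(6,3)]
      Y.vnorm_triangle[of "rsum f n t w \<ominus>\<^bsub>Y\<^esub> ext_op f" "rsum g n t w \<ominus>\<^bsub>Y\<^esub> ext_op g"] by simp
  finally show "vnorm Y (ext_op ?h \<ominus>\<^bsub>Y\<^esub> (ext_op f \<oplus>\<^bsub>Y\<^esub> ext_op g)) \<le> 3 * \<epsilon>" by simp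
qed simp

text \<open>For this function the sum equals \<open>S h x\<close>, where \<open>h\<close> averages
  the values of \<open>\<phi>\<close> at the tags. Fineness controls the distance of
  \<open>h\<close> and \<open>\<phi>\<close> only after multiplication by the norm of
  \<open>x\<close>, which is exactly the quantity in the bilinear bound.\<close>

lemma ext_op_elementary:
  assumes \<phi>: "\<phi> \<in> carrier Z" and x: "x \<in> carrier X"
  shows "ext_op (\<lambda>\<omega>\<in>topspace \<Omega>. \<phi> \<omega> \<odot> x) = S \<phi> x" (is "ext_op ?f = _")
proof (rule eq_if_close)
  interpret Z: normed_space Z by (rule normed_Z)
  have f: "?f \<in> carrier Cp" by (rule elementary_in_Cp[OF \<phi> x])
  show "ext_op ?f \<in> carrier Y" "S \<phi> x \<in> carrier Y"
    using ext_op_in[OF f] bilinear_op_closed[OF S \<phi> x] by auto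
  fix \<epsilon> :: real assume "\<epsilon> > 0"
  obtain n t w where P: "fine_for ?f \<epsilon> n t w" "vnorm Y (rsum ?f n t w \<ominus>\<^bsub>Y\<^esub> ext_op ?f) \<le> \<epsilon>"
    using rsum_limit_close[of "{?f}" ext_op \<epsilon>] f ext_op_limit \<open>\<epsilon> > 0\<close> by blast
  note D = fineD[OF P(1)]
  have e: "emb (t j) \<in> carrier Z" if "j < n" for j using D(2)[OF that] by (rule emb_in_Z)
  define h where "h = finsum Z (\<lambda>j. \<phi> (w j) \<odot>\<^bsub>Z\<^esub> emb (t j)) {..<n}"
  have h: "h \<in> carrier Z" unfolding h_def using e by (intro Z.finsum_in) auto
  have "rsum ?f n t w = finsum Y (\<lambda>j. S (\<phi> (w j) \<odot>\<^bsub>Z\<^esub> emb (t j)) x) {..<n}"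
    unfolding rsum_def using D(1) e x
    by (intro Y.finsum_eq)
      (auto simp: bilinear_op_smult_left[OF S] bilinear_op_smult_right[OF S]
        intro!: Y.smult_in bilinear_op_closed[OF S])
  also have "\<dots> = S h x"
    unfolding h_def using e x by (intro bilinear_op_sum_left[OF normed_Z normed_Y S, symmetric]) auto
  finally have rs: "rsum ?f n t w = S h x" .
  have h_pt: "h \<omega> = (\<Sum>j<n. \<phi> (w j) * of_real (t j \<omega>))" if "\<omega> \<in> topspace \<Omega>" for \<omega>
  proof -
    have "h = (\<lambda>\<omega>\<in>topspace \<Omega>. \<Sum>j<n. (\<phi> (w j) \<odot>\<^bsub>Z\<^esub> emb (t j)) \<omega>)"
      unfolding h_def using e by (intro scalar_cont_finsum[OF compact]) auto
    then show ?thesis using that by (simp add: cont_space_simps(4) emb_def)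
  qed
  have diff_pt: "norm (h \<omega> - \<phi> \<omega>) * vnorm X x \<le> \<epsilon>" if \<omega>: "\<omega> \<in> topspace \<Omega>" for \<omega>
  proof -
    have "\<phi> \<omega> = (\<Sum>j<n. \<phi> \<omega> * of_real (t j \<omega>))"
      using D(5)[OF \<omega>] by (simp flip: sum_distrib_left of_real_sum)
    then have "h \<omega> - \<phi> \<omega> = (\<Sum>j<n. (\<phi> (w j) - \<phi> \<omega>) * of_real (t j \<omega>))"
      unfolding h_pt[OF \<omega>] by (simp add: left_diff_distrib sum_subtractf)
    then have "norm (h \<omega> - \<phi> \<omega>) * vnorm X x \<le> (\<Sum>j<n. norm ((\<phi> (w j) - \<phi> \<omega>) * of_real (t j \<omega>))) * vnorm X x"
      using x by (simp add: mult_right_mono norm_sum)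
    also have "\<dots> = (\<Sum>j<n. t j \<omega> * (norm (\<phi> \<omega> - \<phi> (w j)) * vnorm X x))"
      unfolding sum_distrib_right
      using D(3) \<omega> by (intro sum.cong) (auto simp: norm_mult norm_minus_commute)
    also have "\<dots> \<le> (\<Sum>j<n. t j \<omega> * \<epsilon>)"
    proof (rule sum_mono)
      fix j assume j: "j \<in> {..<n}"
      show "t j \<omega> * (norm (\<phi> \<omega> - \<phi> (w j)) * vnorm X x) \<le> t j \<omega> * \<epsilon>"
      proof (cases "t j \<omega> = 0")
        case False
        then have "vnorm X (?f \<omega> \<ominus> ?f (w j)) < \<epsilon>" using D(4) j \<omega> by blast
        moreover have "?f \<omega> \<ominus> ?f (w j) = (\<phi> \<omega> - \<phi> (w j)) \<odot> x"
          using \<omega> D(1) j x by (simp add: smult_diff_left)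
        ultimately have "norm (\<phi> \<omega> - \<phi> (w j)) * vnorm X x \<le> \<epsilon>"
          using x by (simp add: vnorm_smult)
        then show ?thesis using D(3) j \<omega> by (intro mult_left_mono) auto
      qed simp
    qed
    also have "\<dots> = \<epsilon>" using D(5)[OF \<omega>] by (simp flip: sum_distrib_right)
    finally show ?thesis .
  qed
  have diff: "vnorm Z (h \<ominus>\<^bsub>Z\<^esub> \<phi>) * vnorm X x \<le> \<epsilon>"
  \<comment> \<open>If \<open>x\<close> is zero, \<open>h\<close> need not be close to
    \<open>\<phi>\<close>, but the product is zero anyway.\<close>
  proof (cases "vnorm X x = 0")
    case True
    then show ?thesis using \<open>\<epsilon> > 0\<close> by simp
  next
    case False
    then have pos: "vnorm X x > 0" using vnorm_nonneg[OF x] by simp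
    have "vnorm Z (h \<ominus>\<^bsub>Z\<^esub> \<phi>) \<le> \<epsilon> / vnorm X x"
    proof (rule scalar_cont_norm_le)
      fix \<omega> assume \<omega>: "\<omega> \<in> topspace \<Omega>"
      have eq: "(h \<ominus>\<^bsub>Z\<^esub> \<phi>) \<omega> = h \<omega> - \<phi> \<omega>"
        using \<omega> \<phi> by (simp add: a_minus_def Z.a_inv_eq_smult cont_space_simps(3,4))
      show "norm ((h \<ominus>\<^bsub>Z\<^esub> \<phi>) \<omega>) \<le> \<epsilon> / vnorm X x"
        unfolding eq using diff_pt[OF \<omega>] pos by (simp add: pos_le_divide_eq)
    qed (use pos \<open>\<epsilon> > 0\<close> in simp)
    then show ?thesis using pos by (simp add: field_simps)
  qed
  have lin: "(\<lambda>z\<in>carrier Z. S z x) \<in> linear_maps Z Y"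
    using S x by (simp add: bilinear_op_def)
  have "vnorm Y (S h x \<ominus>\<^bsub>Y\<^esub> S \<phi> x) = vnorm Y (S (h \<ominus>\<^bsub>Z\<^esub> \<phi>) x)"
    using linear_maps_diff[OF normed_Z normed_Y lin h \<phi>] h \<phi> by simp
  also have "\<dots> \<le> M * (vnorm Z (h \<ominus>\<^bsub>Z\<^esub> \<phi>) * vnorm X x)"
    using bilinear_op_bound[OF S, of "h \<ominus>\<^bsub>Z\<^esub> \<phi>" x] h \<phi> x by (simp add: mult.assoc)
  also have "\<dots> \<le> M * \<epsilon>" using diff M_nonneg by (rule mult_left_mono)
  finally have "vnorm Y (rsum ?f n t w \<ominus>\<^bsub>Y\<^esub> S \<phi> x) \<le> M * \<epsilon>" by (simp add: rs)
  then have "vnorm Y (ext_op ?f \<ominus>\<^bsub>Y\<^esub> S \<phi> x) \<le> \<epsilon> + M * \<epsilon>"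
    using Y.vnorm_diff_triangle[OF ext_op_in[OF f] rsum_in[OF f P(1)] bilinear_op_closed[OF S \<phi> x]]
      P(2) Y.vnorm_minus_commute[OF ext_op_in[OF f] rsum_in[OF f P(1)]] by simp
  then show "vnorm Y (ext_op ?f \<ominus>\<^bsub>Y\<^esub> S \<phi> x) \<le> (1 + M) * \<epsilon>" by (simp add: algebra_simps)
qed (use M_nonneg in simp)

lemma ext_op_bounded: "ext_op \<in> bounded_ops Cp Y"
proof -
  have "ext_op \<in> linear_maps Cp Y"
    unfolding linear_maps_def
    using ext_op_in ext_op_add ext_op_smult by (auto simp: ext_op_def)
  moreover have "vnorm Y (ext_op f) \<le> C * vnorm Cp f" if f: "f \<in> carrier Cp" for f
  proof (cases "C = 0")
    case True
    then show ?thesis using ext_op_bound[OF f] f by (auto simp: cp_space_simps)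
  next
    case False
    then have "C > 0" using C_nonneg by simp
    \<comment> \<open>Dividing by \<open>C\<close> lets the estimate pass under the infimum that
      defines the norm.\<close>
    have "vnorm Y (ext_op f) / C \<le> vnorm Cp f"
      unfolding cp_space_simps
    proof (rule cINF_greatest)
      show "cp_seqs p \<Omega> X f \<noteq> {}" using f by (simp add: cp_space_simps)
      fix x assume "x \<in> cp_seqs p \<Omega> X f"
      then show "vnorm Y (ext_op f) / C \<le> lp_norm p (\<lambda>n. vnorm X (x n))"
        using ext_op_bound[OF f, of x] \<open>C > 0\<close> by (simp add: field_simps)
    qed
    then show ?thesis using \<open>C > 0\<close> by (simp add: field_simps)
  qed
  ultimately show ?thesis unfolding bounded_ops_def by blast
qed

end

subsection \<open>Summing operators and the Chevet--Saphar bound\<close>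

text \<open>A nearly norming vector, rotated so that the value of \<open>T\<close> is real and such
  values can be added without cancellation.\<close>

lemma op_norm_approx:
  fixes T :: "'v \<Rightarrow> 'k::rc_field"
  assumes "normed_space X" "T \<in> bounded_ops X scalars" "e > 0"
  shows "\<exists>x r. x \<in> carrier X \<and> vnorm X x \<le> 1 \<and> T x = of_real r \<and> vnorm (dual X) T - e \<le> r"
proof -
  interpret X: normed_space X by fact
  have "vnorm (dual X) T - e < (SUP x\<in>unit_ball X. norm (T x))"
    using assms(3) by (simp add: dual_def op_space_def)
  moreover have "unit_ball X \<noteq> {}"
    using X.vnorm_zero by (auto simp: unit_ball_def intro!: exI[of _ "\<zero>\<^bsub>X\<^esub>"])
  moreover have "bdd_above ((\<lambda>x. norm (T x)) ` unit_ball X)"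
    using op_norm_ge[OF assms(1,2)]
    by (intro bdd_aboveI2[of _ _ "vnorm (op_space X scalars) T"]) (auto simp: unit_ball_def)
  ultimately obtain x where x: "x \<in> unit_ball X" "vnorm (dual X) T - e < norm (T x)"
    by (auto simp: less_cSUP_iff)
  obtain u where u: "norm u = 1" "u * T x = of_real (norm (T x))"
    using exists_unimodular_mult by blast
  have x_in: "x \<in> carrier X" "vnorm X x \<le> 1" using x(1) by (auto simp: unit_ball_def)
  have "T (u \<odot>\<^bsub>X\<^esub> x) = of_real (norm (T x))"
    using linear_maps_smult[OF bounded_ops_linear[OF assms(2)] x_in(1), of u] u(2) by simp
  then show ?thesis
    using x_in x(2) u(1)
    by (intro exI[of _ "u \<odot>\<^bsub>X\<^esub> x"] exI[of _ "norm (T x)"]) (auto simp: X.vnorm_smult)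
qed

text \<open>Serves to replace a constant of unknown sign by a nonnegative one; the product of norms
  on the right is nonnegative.\<close>

lemma chevet_saphar_bounded_mono:
  assumes "normed_space Z" "1 \<le> p" "chevet_saphar_bounded p Z X Y B C" "C \<le> C'"
  shows "chevet_saphar_bounded p Z X Y B C'"
  unfolding chevet_saphar_bounded_def
proof (intro allI impI)
  fix n :: nat and z x assume zx: "\<forall>i<n. z i \<in> carrier Z \<and> x i \<in> carrier X"
  have "0 \<le> weak_lp_norm (conj_index p) Z n z * lp_norm_fin p n (\<lambda>i. vnorm X (x i))"
    using zx assms(2)
    by (intro mult_nonneg_nonneg weak_lp_norm_nonneg[OF assms(1)] lp_norm_fin_nonneg conj_index_ge_1) auto
  from mult_right_mono[OF assms(4) this]
  show "vnorm Y (finsum Y (\<lambda>i. B (z i) (x i)) {..<n})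
      \<le> C' * (weak_lp_norm (conj_index p) Z n z * lp_norm_fin p n (\<lambda>i. vnorm X (x i)))"
    using assms(3) zx unfolding chevet_saphar_bounded_def by (meson order_trans)
qed

context cp_setup
begin

text \<open>Hoelder between the norms of \<open>S (z i)\<close> and of \<open>x i\<close>. For
  \<open>q = \<infinity>\<close>, where summing means bounded, \<open>p = 1\<close> and the weak
  norm dominates each supremum norm by evaluation at points.\<close>

lemma chevet_saphar_bounded_of_summing:
  assumes S: "S \<in> bounded_ops Z (dual X)" and sum: "S \<in> summing_ops q Z (dual X)"
  shows "\<exists>C. chevet_saphar_bounded p Z X scalars S C"
proof (cases "q = \<infinity>")
  case True
  then have p: "p = 1" using conj_index_involutive[OF p_ge_1] by simp
  obtain M where M: "0 \<le> M" "bilinear_op Z X scalars M S"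
    using bilinear_op_of_bounded_ops[OF normed_Z normed_X normed_space_scalars] S
    unfolding dual_def by blast
  have "norm (\<Sum>i<n. S (z i) (x i)) \<le>
      M * (weak_lp_norm q Z n z * lp_norm_fin p n (\<lambda>i. vnorm X (x i)))"
    if zx: "\<forall>i<n. z i \<in> carrier Z \<and> x i \<in> carrier X" for n z x
  proof -
    let ?w = "weak_lp_norm q Z n z"
    have w: "0 \<le> ?w" using zx by (intro weak_lp_norm_nonneg normed_Z q_ge_1) auto
    have z_le: "vnorm Z (z i) \<le> ?w" if i: "i < n" for i
    proof (rule scalar_cont_norm_le[OF w])
      fix \<omega> assume "\<omega> \<in> topspace \<Omega>"
      then have "lp_norm_fin q n (\<lambda>i. norm (z i \<omega>)) \<le> ?w"
        using zx by (intro weak_lp_norm_ge_point compact q_ge_1) auto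
      then show "norm (z i \<omega>) \<le> ?w"
        using abs_le_lp_norm_fin[OF q_ge_1 i, of "\<lambda>i. norm (z i \<omega>)"] by simp
    qed
    have "norm (\<Sum>i<n. S (z i) (x i)) \<le> (\<Sum>i<n. norm (S (z i) (x i)))" by (rule norm_sum)
    also have "\<dots> \<le> (\<Sum>i<n. M * ?w * vnorm X (x i))"
    proof (rule sum_mono)
      fix i assume i: "i \<in> {..<n}"
      have "norm (S (z i) (x i)) \<le> M * vnorm Z (z i) * vnorm X (x i)"
        using bilinear_op_bound[OF M(2), of "z i" "x i"] zx i by simp
      also have "\<dots> \<le> M * ?w * vnorm X (x i)"
        using M(1) z_le zx i by (intro mult_right_mono mult_left_mono) auto
      finally show "norm (S (z i) (x i)) \<le> M * ?w * vnorm X (x i)" .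
    qed
    also have "\<dots> = M * ?w * (\<Sum>i<n. \<bar>vnorm X (x i)\<bar>)"
      using zx by (simp add: sum_distrib_left)
    finally show ?thesis by (simp add: p lp_norm_fin_1 mult.assoc)
  qed
  then show ?thesis unfolding chevet_saphar_bounded_def by auto
next
  case False
  then obtain C where C: "\<And>n v. (\<forall>i<n. v i \<in> carrier Z) \<Longrightarrow>
      lp_norm_fin q n (\<lambda>i. vnorm (dual X) (S (v i))) \<le> C * weak_lp_norm q Z n v"
    using sum unfolding summing_ops_def by auto
  have S_in: "S z \<in> bounded_ops X scalars" if "z \<in> carrier Z" for z
    using linear_maps_closed[OF bounded_ops_linear[OF S] that] by (simp add: dual_def op_space_simps)
  have "norm (\<Sum>i<n. S (z i) (x i)) \<le>
      C * (weak_lp_norm q Z n z * lp_norm_fin p n (\<lambda>i. vnorm X (x i)))"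
    if zx: "\<forall>i<n. z i \<in> carrier Z \<and> x i \<in> carrier X" for n z x
  proof -
    have "norm (\<Sum>i<n. S (z i) (x i)) \<le> (\<Sum>i<n. norm (S (z i) (x i)))" by (rule norm_sum)
    also have "\<dots> \<le> (\<Sum>i<n. \<bar>vnorm X (x i)\<bar> * \<bar>vnorm (dual X) (S (z i))\<bar>)"
    proof (rule sum_mono)
      fix i assume i: "i \<in> {..<n}"
      have "norm (S (z i) (x i)) \<le> vnorm (dual X) (S (z i)) * vnorm X (x i)"
        using op_norm_bound[OF normed_X normed_space_scalars S_in, of "z i" "x i"] zx i
        by (simp add: dual_def)
      then have "norm (S (z i) (x i)) \<le> \<bar>vnorm (dual X) (S (z i)) * vnorm X (x i)\<bar>"
        by (rule order_trans[OF _ abs_ge_self])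
      then show "norm (S (z i) (x i)) \<le> \<bar>vnorm X (x i)\<bar> * \<bar>vnorm (dual X) (S (z i))\<bar>"
        by (simp add: abs_mult mult.commute)
    qed
    also have "\<dots> \<le> lp_norm_fin p n (\<lambda>i. vnorm X (x i)) * lp_norm_fin q n (\<lambda>i. vnorm (dual X) (S (z i)))"
      by (rule lp_norm_fin_Hoelder[OF p_ge_1])
    also have "\<dots> \<le> lp_norm_fin p n (\<lambda>i. vnorm X (x i)) * (C * weak_lp_norm q Z n z)"
      using C zx by (intro mult_left_mono lp_norm_fin_nonneg p_ge_1) auto
    finally show ?thesis by (simp add: mult_ac)
  qed
  then show ?thesis unfolding chevet_saphar_bounded_def by auto
qed

text \<open>An extremal \<open>b\<close> linearises the \<open>l_q\<close> norm, and vectors of norm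
  at most \<open>b i\<close>, obtained by scaling nearly norming vectors of \<open>S (v i)\<close>,
  turn the result into one sum covered by the hypothesis.\<close>

lemma summing_of_chevet_saphar_bounded:
  assumes S: "S \<in> bounded_ops Z (dual X)" and CS: "chevet_saphar_bounded p Z X scalars S C0"
  shows "S \<in> summing_ops q Z (dual X)"
proof -
  define C where "C = max C0 0"
  have C: "0 \<le> C" "chevet_saphar_bounded p Z X scalars S C"
    using chevet_saphar_bounded_mono[OF normed_Z p_ge_1 CS, of C] by (auto simp: C_def)
  have S_in: "S z \<in> bounded_ops X scalars" if "z \<in> carrier Z" for z
    using linear_maps_closed[OF bounded_ops_linear[OF S] that] by (simp add: dual_def op_space_simps)
  have "lp_norm_fin q n (\<lambda>i. vnorm (dual X) (S (v i))) \<le> C * weak_lp_norm q Z n v"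
    if v: "\<forall>i<n. v i \<in> carrier Z" for n v
  proof (rule field_le_epsilon)
    fix e :: real assume "e > 0"
    let ?w = "weak_lp_norm q Z n v" and ?a = "\<lambda>i. vnorm (dual X) (S (v i))"
    have w: "0 \<le> ?w" using v by (intro weak_lp_norm_nonneg normed_Z q_ge_1) auto
    have a: "0 \<le> ?a i" if "i < n" for i
      using op_norm_nonneg[OF normed_X normed_space_scalars S_in] v that by (simp add: dual_def)
    obtain b where b: "\<And>i. 0 \<le> b i" "lp_norm_fin p n b \<le> 1"
        "(\<Sum>i<n. \<bar>?a i\<bar> * b i) = lp_norm_fin q n ?a"
      using lp_norm_fin_attained[OF p_ge_1, of n ?a] by auto
    define B where "B = (\<Sum>i<n. b i)"
    have B: "0 \<le> B" using b(1) by (simp add: B_def sum_nonneg)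
    \<comment> \<open>The individual errors \<open>d\<close> are weighted by \<open>b i\<close> and
      add up to \<open>d * B\<close>, which is less than \<open>e\<close>.\<close>
    define d where "d = e / (B + 1)"
    have d: "d > 0" using \<open>e > 0\<close> B by (simp add: d_def)
    have "\<forall>i. \<exists>xr. i < n \<longrightarrow> fst xr \<in> carrier X \<and> vnorm X (fst xr) \<le> 1 \<and>
        S (v i) (fst xr) = of_real (snd xr) \<and> ?a i - d \<le> snd xr"
      using op_norm_approx[OF normed_X S_in d] v by fastforce
    from choice[OF this] obtain xr where xr: "\<forall>i. i < n \<longrightarrow> fst (xr i) \<in> carrier X \<and>
        vnorm X (fst (xr i)) \<le> 1 \<and> S (v i) (fst (xr i)) = of_real (snd (xr i)) \<and>
        ?a i - d \<le> snd (xr i)" ..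
    define x where "x i = of_real (b i) \<odot> fst (xr i)" for i
    have x: "x i \<in> carrier X" if "i < n" for i using xr that by (simp add: x_def)
    have Sx: "S (v i) (x i) = of_real (b i * snd (xr i))" if "i < n" for i
      using linear_maps_smult[OF bounded_ops_linear[OF S_in], of "v i" "fst (xr i)" "of_real (b i)"]
        xr v that by (simp add: x_def)
    have "lp_norm_fin q n ?a - e \<le> (\<Sum>i<n. \<bar>?a i\<bar> * b i) - d * B"
      using b(3) B d \<open>e > 0\<close> by (simp add: d_def divide_le_eq field_simps)
    also have "\<dots> = (\<Sum>i<n. (?a i - d) * b i)"
      using a by (simp add: B_def sum_distrib_left sum_subtractf left_diff_distrib)
    also have "\<dots> \<le> (\<Sum>i<n. snd (xr i) * b i)"
      using xr b(1) by (intro sum_mono mult_right_mono) auto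
    also have "\<dots> \<le> norm (of_real (\<Sum>i<n. snd (xr i) * b i) :: 'k)" by (simp only: norm_of_real abs_ge_self)
    also have "of_real (\<Sum>i<n. snd (xr i) * b i) = (\<Sum>i<n. S (v i) (x i))"
      unfolding of_real_sum using Sx by (intro sum.cong) (auto simp: mult.commute)
    also have "norm \<dots> \<le> C * (?w * lp_norm_fin p n (\<lambda>i. vnorm X (x i)))"
      using C(2) x v unfolding chevet_saphar_bounded_def by simp
    also have "\<dots> \<le> C * (?w * 1)"
    proof (intro mult_left_mono C(1) w)
      have "lp_norm_fin p n (\<lambda>i. vnorm X (x i)) \<le> lp_norm_fin p n b"
      proof (rule lp_norm_fin_mono[OF p_ge_1])
        fix i assume i: "i < n"
        have "b i * vnorm X (fst (xr i)) \<le> b i * 1"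
          using xr i b(1) by (intro mult_left_mono) auto
        then show "\<bar>vnorm X (x i)\<bar> \<le> \<bar>b i\<bar>"
          using xr i b(1) x[OF i] by (simp add: x_def vnorm_smult)
      qed
      then show "lp_norm_fin p n (\<lambda>i. vnorm X (x i)) \<le> 1" using b(2) by simp
    qed
    finally show "lp_norm_fin q n ?a \<le> C * ?w + e" by simp
  qed
  then show ?thesis using S unfolding summing_ops_def by auto
qed

lemma summing_eq_bounded_iff:
  "bounded_ops Z (dual X) = summing_ops q Z (dual X) \<longleftrightarrow>
    (\<forall>S\<in>bounded_ops Z (dual X). \<exists>C. chevet_saphar_bounded p Z X scalars S C)"
proof -
  have "summing_ops q Z (dual X) \<subseteq> bounded_ops Z (dual X)" by (auto simp: summing_ops_def)
  then show ?thesis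
    using chevet_saphar_bounded_of_summing summing_of_chevet_saphar_bounded by blast
qed

end

subsection \<open>Tensor norms\<close>

lemma bilinear_op_forms: "bilinear_op Z X scalars M A \<Longrightarrow> A \<in> bilinear_forms Z X"
  by (auto simp: bilinear_op_def bilinear_forms_def)

lemma bilinear_forms_add_left:
  assumes "A \<in> bilinear_forms Z X" "z \<in> carrier Z" "w \<in> carrier Z" "x \<in> carrier X" "z \<oplus>\<^bsub>Z\<^esub> w \<in> carrier Z"
  shows "A (z \<oplus>\<^bsub>Z\<^esub> w) x = A z x + A w x"
  using assms linear_maps_add[of "\<lambda>z\<in>carrier Z. A z x" Z scalars z w] by (simp add: bilinear_forms_def)

lemma bilinear_forms_add_right:
  assumes "A \<in> bilinear_forms Z X" "z \<in> carrier Z" "x \<in> carrier X" "y \<in> carrier X" "x \<oplus>\<^bsub>X\<^esub> y \<in> carrier X"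
  shows "A z (x \<oplus>\<^bsub>X\<^esub> y) = A z x + A z y"
  using assms linear_maps_add[of "\<lambda>x\<in>carrier X. A z x" X scalars x y] by (simp add: bilinear_forms_def)

lemma bilinear_forms_smult_left:
  assumes "A \<in> bilinear_forms Z X" "z \<in> carrier Z" "x \<in> carrier X" "c \<odot>\<^bsub>Z\<^esub> z \<in> carrier Z"
  shows "A (c \<odot>\<^bsub>Z\<^esub> z) x = c * A z x"
  using assms linear_maps_smult[of "\<lambda>z\<in>carrier Z. A z x" Z scalars z c] by (simp add: bilinear_forms_def)

lemma bilinear_forms_smult_right:
  assumes "A \<in> bilinear_forms Z X" "z \<in> carrier Z" "x \<in> carrier X" "c \<odot>\<^bsub>X\<^esub> x \<in> carrier X"
  shows "A z (c \<odot>\<^bsub>X\<^esub> x) = c * A z x"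
  using assms linear_maps_smult[of "\<lambda>x\<in>carrier X. A z x" X scalars x c] by (simp add: bilinear_forms_def)

text \<open>The weight \<open>t\<^sub>i\<close> is split as \<open>t\<^sub>i\<^sup>1\<^sup>/\<^sup>q t\<^sub>i\<^sup>1\<^sup>/\<^sup>p\<close>.\<close>

lemma Hoelder_split:
  assumes "1 \<le> p" and t: "\<And>i. 0 \<le> (t i :: real)"
  shows "\<exists>a b. (\<forall>i. 0 \<le> a i \<and> 0 \<le> b i \<and> a i * b i = t i \<and> (t i = 0 \<longrightarrow> a i = 0 \<and> b i = 0)) \<and>
    lp_norm_fin (conj_index p) n a * lp_norm_fin p n b \<le> (\<Sum>i<n. t i)"
proof -
  \<comment> \<open>At an endpoint one factor carries all of \<open>t\<close> and the other is the
    indicator of its support, which has supremum at most one. That zeros of \<open>t\<close> are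
    zeros of both factors is what the later rescaling relies on.\<close>
  define z where "z i = (if t i = 0 then 0 else 1 :: real)" for i
  have "lp_norm_fin \<infinity> n z \<le> 1"
    by (subst lp_norm_fin_top_le_iff) (auto simp: z_def)
  then have 1: "lp_norm_fin \<infinity> n z * lp_norm_fin 1 n t \<le> (\<Sum>i<n. t i)"
    using t sum_nonneg[of "{..<n}" t] mult_right_mono[of "lp_norm_fin \<infinity> n z" 1 "\<Sum>i<n. t i"]
    by (simp add: lp_norm_fin_1)
  show ?thesis
    using assms(1)
  proof (cases rule: conj_index_cases)
    case one
    then show ?thesis using 1 t by (intro exI[of _ z] exI[of _ t]) (auto simp: z_def)
  next
    case top
    then show ?thesis using 1 t
      by (intro exI[of _ t] exI[of _ z]) (auto simp: z_def mult.commute)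
  next
    case (real r s)
    define T where "T = (\<Sum>i<n. t i)"
    have T: "0 \<le> T" using t by (simp add: T_def sum_nonneg)
    have "lp_norm_fin (conj_index p) n (\<lambda>i. t i powr (1/s)) = T powr (1/s)"
      using real t by (simp add: lp_norm_fin_real powr_powr T_def)
    moreover have "lp_norm_fin p n (\<lambda>i. t i powr (1/r)) = T powr (1/r)"
      using real t by (simp add: lp_norm_fin_real powr_powr T_def)
    moreover have *: "u powr (1/s) * u powr (1/r) = u" if "0 \<le> u" for u :: real
      using real(5) that by (simp flip: powr_add add: add.commute)
    ultimately show ?thesis
      using t T
      by (intro exI[of _ "\<lambda>i. t i powr (1/s)"] exI[of _ "\<lambda>i. t i powr (1/r)"])
        (auto simp: T_def[symmetric] *)
  qed
qed

locale tensor_setup = Z: normed_space Z + X: normed_space X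
  for Z :: "('k::rc_field, 'z) nspace" and X :: "('k, 'x) nspace"
begin

abbreviation "BF \<equiv> bilinear_forms Z X"
abbreviation "TP \<equiv> tensor_product Z X"

definition TS :: "('k, ('z \<Rightarrow> 'x \<Rightarrow> 'k) \<Rightarrow> 'k) nspace" where
  "TS = fun_space BF scalars TP (proj_norm Z X)"

lemma tensor_repsI:
  "(\<And>i. i < n \<Longrightarrow> z i \<in> carrier Z) \<Longrightarrow> (\<And>i. i < n \<Longrightarrow> x i \<in> carrier X) \<Longrightarrow>
    (n, z, x) \<in> tensor_reps Z X (tensor_sum Z X n z x)"
  by (auto simp: tensor_reps_def)

lemma tensor_sum_in:
  "(\<And>i. i < n \<Longrightarrow> z i \<in> carrier Z) \<Longrightarrow> (\<And>i. i < n \<Longrightarrow> x i \<in> carrier X) \<Longrightarrow>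
    tensor_sum Z X n z x \<in> TP"
  using tensor_repsI[of n z x] unfolding tensor_product_def by blast

lemma TP_cases:
  assumes "u \<in> TP"
  obtains n z x where "(n, z, x) \<in> tensor_reps Z X u"
  using assms by (auto simp: tensor_product_def)

lemma tensor_repsD:
  assumes "(n, z, x) \<in> tensor_reps Z X u"
  shows "i < n \<Longrightarrow> z i \<in> carrier Z" "i < n \<Longrightarrow> x i \<in> carrier X" "u = tensor_sum Z X n z x"
  using assms by (auto simp: tensor_reps_def)

lemma tensor_reps_add:
  assumes "(n, z, x) \<in> tensor_reps Z X u" "(m, w, y) \<in> tensor_reps Z X v"
  shows "(n + m, \<lambda>i. if i < n then z i else w (i - n), \<lambda>i. if i < n then x i else y (i - n))
    \<in> tensor_reps Z X (\<lambda>A\<in>BF. u A + v A)"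
proof -
  have split: "(\<Sum>i<n + m. f i) = (\<Sum>i<n. f i) + (\<Sum>i<m. f (n + i))" for f :: "nat \<Rightarrow> 'k"
    by (induction m) (auto simp: add.assoc)
  show ?thesis
    using assms by (auto simp: tensor_reps_def tensor_sum_def split intro!: restrict_ext)
qed

lemma tensor_reps_smult:
  assumes "(n, z, x) \<in> tensor_reps Z X u"
  shows "(n, \<lambda>i. c \<odot>\<^bsub>Z\<^esub> z i, x) \<in> tensor_reps Z X (\<lambda>A\<in>BF. c * u A)"
  using assms
  by (auto simp: tensor_reps_def tensor_sum_def bilinear_forms_smult_left sum_distrib_left
      intro!: restrict_ext sum.cong)

lemma tensor_reps_zero: "(0, z, x) \<in> tensor_reps Z X (\<lambda>A\<in>BF. 0)"
  by (auto simp: tensor_reps_def tensor_sum_def)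

lemma TP_subset: "TP \<subseteq> BF \<rightarrow>\<^sub>E carrier scalars"
  by (auto simp: tensor_product_def tensor_reps_def tensor_sum_def)

lemma TS_rc_module: "rc_module TS"
proof -
  have "Module.module scalars TS"
    unfolding TS_def
  proof (rule module_fun_space[OF normed_space_scalars TP_subset])
    show "(\<lambda>t\<in>BF. \<zero>\<^bsub>scalars\<^esub>) \<in> TP"
      using tensor_reps_zero unfolding tensor_product_def by fastforce
    fix f g c assume f: "f \<in> TP"
    then obtain n z x where r: "(n, z, x) \<in> tensor_reps Z X f" by (rule TP_cases)
    show "(\<lambda>t\<in>BF. c \<odot>\<^bsub>scalars\<^esub> f t) \<in> TP"
      using tensor_reps_smult[OF r, of c] unfolding tensor_product_def by fastforce
    assume "g \<in> TP"
    then obtain m w y where "(m, w, y) \<in> tensor_reps Z X g" by (rule TP_cases)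
    from tensor_reps_add[OF r this]
    show "(\<lambda>t\<in>BF. f t \<oplus>\<^bsub>scalars\<^esub> g t) \<in> TP"
      unfolding tensor_product_def by fastforce
  qed
  then show ?thesis by (simp add: rc_module_def)
qed

lemma proj_norm_le:
  assumes "(n, z, x) \<in> tensor_reps Z X u"
  shows "proj_norm Z X u \<le> (\<Sum>i<n. vnorm Z (z i) * vnorm X (x i))"
proof -
  have "bdd_below ((\<lambda>(n, z, x). \<Sum>i<n. vnorm Z (z i) * vnorm X (x i)) ` tensor_reps Z X u)"
    by (rule bdd_belowI2[of _ 0]) (auto simp: tensor_reps_def intro!: sum_nonneg)
  from cINF_lower[OF this assms] show ?thesis by (simp add: proj_norm_def)
qed

lemma proj_norm_ge:
  assumes "u \<in> TP"
    and "\<And>n z x. (n, z, x) \<in> tensor_reps Z X u \<Longrightarrow> C \<le> (\<Sum>i<n. vnorm Z (z i) * vnorm X (x i))"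
  shows "C \<le> proj_norm Z X u"
  unfolding proj_norm_def using assms by (intro cINF_greatest) (auto simp: tensor_product_def)

lemma chevet_saphar_norm_le:
  assumes "1 \<le> p" "(n, z, x) \<in> tensor_reps Z X u"
  shows "chevet_saphar_norm p Z X u
    \<le> weak_lp_norm (conj_index p) Z n z * lp_norm_fin p n (\<lambda>i. vnorm X (x i))"
proof -
  have "bdd_below ((\<lambda>(n, z, x). weak_lp_norm (conj_index p) Z n z *
      lp_norm_fin p n (\<lambda>i. vnorm X (x i))) ` tensor_reps Z X u)"
    using assms(1)
    by (intro bdd_belowI2[of _ 0])
      (auto simp: tensor_reps_def conj_index_ge_1
        intro!: mult_nonneg_nonneg weak_lp_norm_nonneg Z.normed_space_axioms lp_norm_fin_nonneg)
  from cINF_lower[OF this assms(2)] show ?thesis by (simp add: chevet_saphar_norm_def)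
qed

lemma chevet_saphar_norm_ge:
  assumes "u \<in> TP"
    and "\<And>n z x. (n, z, x) \<in> tensor_reps Z X u \<Longrightarrow>
      C \<le> weak_lp_norm (conj_index p) Z n z * lp_norm_fin p n (\<lambda>i. vnorm X (x i))"
  shows "C \<le> chevet_saphar_norm p Z X u"
  unfolding chevet_saphar_norm_def
  using assms by (intro cINF_greatest) (auto simp: tensor_product_def)

lemma chevet_saphar_norm_nonneg:
  assumes "1 \<le> p" "u \<in> TP"
  shows "0 \<le> chevet_saphar_norm p Z X u"
  using assms
  by (intro chevet_saphar_norm_ge mult_nonneg_nonneg weak_lp_norm_nonneg lp_norm_fin_nonneg
      conj_index_ge_1 Z.normed_space_axioms) (auto dest: tensor_repsD)

text \<open>Rescaling within each elementary tensor gives its factors the norms \<open>a i\<close>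
  and \<open>b i\<close> of the split weights without changing the tensor; the weak norm is then
  estimated by the strong one.\<close>

lemma chevet_saphar_le_proj:
  assumes p: "1 \<le> p" and "u \<in> TP"
  shows "chevet_saphar_norm p Z X u \<le> proj_norm Z X u"
proof (rule proj_norm_ge[OF assms(2)])
  fix n z x assume r: "(n, z, x) \<in> tensor_reps Z X u"
  note D = tensor_repsD[OF r]
  define t where "t i = (if i < n then vnorm Z (z i) * vnorm X (x i) else 0)" for i
  have t: "0 \<le> t i" for i using D by (simp add: t_def)
  obtain a b where ab: "\<And>i. 0 \<le> a i" "\<And>i. 0 \<le> b i" "\<And>i. a i * b i = t i"
      "\<And>i. t i = 0 \<Longrightarrow> a i = 0 \<and> b i = 0"
      "lp_norm_fin (conj_index p) n a * lp_norm_fin p n b \<le> (\<Sum>i<n. t i)"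
    using Hoelder_split[of p t n, OF p t] by blast
  define z' where "z' i = of_real (a i / vnorm Z (z i)) \<odot>\<^bsub>Z\<^esub> z i" for i
  define x' where "x' i = of_real (b i / vnorm X (x i)) \<odot>\<^bsub>X\<^esub> x i" for i
  have in': "z' i \<in> carrier Z" "x' i \<in> carrier X" if "i < n" for i
    using D that by (auto simp: z'_def x'_def)
  have zn: "vnorm Z (z' i) = a i" if i: "i < n" for i
    using D(1)[OF i] ab(1,4)[of i] i
    by (cases "vnorm Z (z i) = 0")
      (auto simp: z'_def Z.vnorm_smult norm_divide t_def simp del: of_real_divide)
  have xn: "vnorm X (x' i) = b i" if i: "i < n" for i
    using D(2)[OF i] ab(2,4)[of i] i
    by (cases "vnorm X (x i) = 0")
      (auto simp: x'_def X.vnorm_smult norm_divide t_def simp del: of_real_divide)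
  have "A (z' i) (x' i) = A (z i) (x i)" if i: "i < n" and A: "A \<in> BF" for i A
  proof -
    have eq: "A (z' i) (x' i) = of_real (a i / vnorm Z (z i)) * (of_real (b i / vnorm X (x i)) * A (z i) (x i))"
      unfolding z'_def x'_def using D i A
      by (simp add: bilinear_forms_smult_left bilinear_forms_smult_right del: of_real_divide)
    show ?thesis
    \<comment> \<open>If the weight vanishes, one factor is zero and so is the elementary tensor,
      whatever the quotients with zero denominator are.\<close>
    proof (cases "t i = 0")
      case False
      then have "a i / vnorm Z (z i) * (b i / vnorm X (x i)) = 1"
        using ab(3)[of i] i by (simp add: t_def field_simps)
      then show ?thesis
        unfolding eq by (metis mult.assoc mult_1 of_real_1 of_real_mult)
    next
      case True
      then have "z i = \<zero>\<^bsub>Z\<^esub> \<or> x i = \<zero>\<^bsub>X\<^esub>"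
        using D i by (auto simp: t_def Z.vnorm_eq_0 X.vnorm_eq_0)
      then have "A (z i) (x i) = 0"
        using bilinear_forms_smult_left[OF A Z.M.zero_closed D(2)[OF i], of 0]
          bilinear_forms_smult_right[OF A D(1)[OF i] X.M.zero_closed, of 0] by auto
      then show ?thesis by (simp add: eq)
    qed
  qed
  then have "tensor_sum Z X n z' x' = u"
    unfolding D(3) by (auto simp: tensor_sum_def intro!: restrict_ext sum.cong)
  then have r': "(n, z', x') \<in> tensor_reps Z X u"
    using tensor_repsI[of n z' x'] in' by simp
  have "chevet_saphar_norm p Z X u
      \<le> weak_lp_norm (conj_index p) Z n z' * lp_norm_fin p n (\<lambda>i. vnorm X (x' i))"
    by (rule chevet_saphar_norm_le[OF p r'])
  also have "\<dots> \<le> lp_norm_fin (conj_index p) n (\<lambda>i. vnorm Z (z' i)) * lp_norm_fin p n (\<lambda>i. vnorm X (x' i))"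
    using in' p
    by (intro mult_right_mono weak_lp_norm_le_strong lp_norm_fin_nonneg Z.normed_space_axioms
        conj_index_ge_1) auto
  also have "\<dots> = lp_norm_fin (conj_index p) n a * lp_norm_fin p n b"
    using zn xn lp_norm_fin_cong[of n "\<lambda>i. vnorm Z (z' i)" a] lp_norm_fin_cong[of n "\<lambda>i. vnorm X (x' i)" b]
    by simp
  also have "\<dots> \<le> (\<Sum>i<n. t i)" by (rule ab(5))
  also have "\<dots> = (\<Sum>i<n. vnorm Z (z i) * vnorm X (x i))" by (simp add: t_def)
  finally show "chevet_saphar_norm p Z X u \<le> (\<Sum>i<n. vnorm Z (z i) * vnorm X (x i))" .
qed

lemma tensor_apply:
  "(n, z, x) \<in> tensor_reps Z X u \<Longrightarrow> A \<in> BF \<Longrightarrow> u A = (\<Sum>i<n. A (z i) (x i))"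
  by (simp add: tensor_reps_def tensor_sum_def)

text \<open>Together with \<open>proj_norm_attained\<close> this is the duality between the
  projective norm and bounded bilinear forms.\<close>

lemma bilinear_op_le_proj_norm:
  assumes u: "u \<in> TP" and A: "bilinear_op Z X scalars M A" and "0 \<le> M"
  shows "norm (u A) \<le> M * proj_norm Z X u"
proof (cases "M = 0")
  case True
  obtain n z x where r: "(n, z, x) \<in> tensor_reps Z X u" using u by (rule TP_cases)
  then have "A (z i) (x i) = 0" if "i < n" for i
    using bilinear_op_bound[OF A, of "z i" "x i"] tensor_repsD[OF r] that True by simp
  then show ?thesis using tensor_apply[OF r bilinear_op_forms[OF A]] True by simp
next
  case False
  with assms have "M > 0" by simp
  have "norm (u A) / M \<le> proj_norm Z X u"
  proof (rule proj_norm_ge[OF u])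
    fix n z x assume r: "(n, z, x) \<in> tensor_reps Z X u"
    have "norm (u A) \<le> (\<Sum>i<n. norm (A (z i) (x i)))"
      unfolding tensor_apply[OF r bilinear_op_forms[OF A]] by (rule norm_sum)
    also have "\<dots> \<le> (\<Sum>i<n. M * vnorm Z (z i) * vnorm X (x i))"
      using bilinear_op_bound[OF A] tensor_repsD[OF r] by (intro sum_mono) auto
    also have "\<dots> = M * (\<Sum>i<n. vnorm Z (z i) * vnorm X (x i))"
      by (simp add: sum_distrib_left mult.assoc)
    finally show "norm (u A) / M \<le> (\<Sum>i<n. vnorm Z (z i) * vnorm X (x i))"
      using \<open>M > 0\<close> by (simp add: field_simps)
  qed
  then show ?thesis using \<open>M > 0\<close> by (simp add: field_simps)
qed

lemma proj_norm_add_le: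
  assumes "u \<in> TP" "v \<in> TP"
  shows "proj_norm Z X (\<lambda>A\<in>BF. u A + v A) \<le> proj_norm Z X u + proj_norm Z X v"
proof -
  have *: "proj_norm Z X (\<lambda>A\<in>BF. u A + v A)
      \<le> (\<Sum>i<n. vnorm Z (z i) * vnorm X (x i)) + (\<Sum>i<m. vnorm Z (w i) * vnorm X (y i))"
    if r: "(n, z, x) \<in> tensor_reps Z X u" "(m, w, y) \<in> tensor_reps Z X v" for n z x m w y
  proof -
    have split: "(\<Sum>i<n + m. f i) = (\<Sum>i<n. f i) + (\<Sum>i<m. f (n + i))" for f :: "nat \<Rightarrow> real"
      by (induction m) auto
    show ?thesis using proj_norm_le[OF tensor_reps_add[OF r]] by (simp add: split)
  qed
  have "proj_norm Z X (\<lambda>A\<in>BF. u A + v A) - (\<Sum>i<n. vnorm Z (z i) * vnorm X (x i)) \<le> proj_norm Z X v"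
    if "(n, z, x) \<in> tensor_reps Z X u" for n z x
    using *[OF that] by (intro proj_norm_ge[OF assms(2)]) (simp add: algebra_simps)
  then have "proj_norm Z X (\<lambda>A\<in>BF. u A + v A) - proj_norm Z X v \<le> proj_norm Z X u"
    by (intro proj_norm_ge[OF assms(1)]) (simp add: algebra_simps)
  then show ?thesis by simp
qed

lemma proj_norm_smult:
  assumes "u \<in> TP"
  shows "proj_norm Z X (\<lambda>A\<in>BF. c * u A) = norm c * proj_norm Z X u"
proof -
  have in_TP: "(\<lambda>A\<in>BF. c * u A) \<in> TP" if "u \<in> TP" for u c
    using tensor_reps_smult[of _ _ _ u c] that unfolding tensor_product_def by fastforce
  have nn: "0 \<le> proj_norm Z X u" if "u \<in> TP" for u
    using that tensor_repsD by (intro proj_norm_ge) (auto intro!: sum_nonneg)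
  have le: "proj_norm Z X (\<lambda>A\<in>BF. c * u A) \<le> norm c * proj_norm Z X u"
    if u: "u \<in> TP" and "c \<noteq> 0" for u c
  proof -
    have "proj_norm Z X (\<lambda>A\<in>BF. c * u A) / norm c \<le> proj_norm Z X u"
    proof (rule proj_norm_ge[OF u])
      fix n z x assume r: "(n, z, x) \<in> tensor_reps Z X u"
      have "proj_norm Z X (\<lambda>A\<in>BF. c * u A) \<le> (\<Sum>i<n. vnorm Z (c \<odot>\<^bsub>Z\<^esub> z i) * vnorm X (x i))"
        by (rule proj_norm_le[OF tensor_reps_smult[OF r]])
      also have "\<dots> = norm c * (\<Sum>i<n. vnorm Z (z i) * vnorm X (x i))"
        using tensor_repsD[OF r] by (simp add: Z.vnorm_smult sum_distrib_left mult.assoc)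
      finally show "proj_norm Z X (\<lambda>A\<in>BF. c * u A) / norm c \<le> (\<Sum>i<n. vnorm Z (z i) * vnorm X (x i))"
        using \<open>c \<noteq> 0\<close> by (simp add: field_simps)
    qed
    then show ?thesis using \<open>c \<noteq> 0\<close> by (simp add: field_simps)
  qed
  show ?thesis
  proof (cases "c = 0")
    case True
    have "proj_norm Z X (\<lambda>A\<in>BF. 0) \<le> 0" using proj_norm_le[OF tensor_reps_zero] by simp
    moreover have "0 \<le> proj_norm Z X (\<lambda>A\<in>BF. 0 * u A)" by (rule nn[OF in_TP[OF assms]])
    ultimately show ?thesis using True by simp
  next
    case False
    have "(\<lambda>A\<in>BF. inverse c * (\<lambda>A\<in>BF. c * u A) A) = u"
      using TP_subset assms False by (auto simp: fun_eq_iff PiE_def extensional_def)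
    then have "proj_norm Z X u \<le> norm (inverse c) * proj_norm Z X (\<lambda>A\<in>BF. c * u A)"
      using le[OF in_TP[OF assms], of "inverse c" c] False by simp
    then have "norm c * proj_norm Z X u \<le> proj_norm Z X (\<lambda>A\<in>BF. c * u A)"
      using False by (simp add: norm_divide field_simps)
    then show ?thesis using le[OF assms False] by simp
  qed
qed

text \<open>The Hahn-Banach functional on the tensor product, evaluated at elementary tensors, is a
  bilinear form of norm at most one. Conversely \<open>u\<close>, as a functional on bilinear forms,
  takes at this form the value that the Hahn-Banach functional takes at \<open>u\<close>.\<close>

lemma proj_norm_attained:
  assumes u: "u \<in> TP"
  obtains B where "bilinear_op Z X scalars 1 B" "u B = of_real (proj_norm Z X u)"
proof -
  interpret T: rc_module TS by (rule TS_rc_module)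
  have "\<exists>T\<in>linear_maps TS scalars. (\<forall>v\<in>TP. norm (T v) \<le> proj_norm Z X v) \<and>
      T u = of_real (proj_norm Z X u)"
  proof (rule T.Hahn_Banach_seminorm[of "proj_norm Z X" u])
    fix T assume "T \<in> linear_maps TS scalars" "T u = of_real (proj_norm Z X u)"
      and *: "\<And>v. v \<in> carrier TS \<Longrightarrow> norm (T v) \<le> proj_norm Z X v"
    moreover have "\<forall>v\<in>TP. norm (T v) \<le> proj_norm Z X v" using * by (simp add: TS_def)
    ultimately show ?thesis by blast
  qed (use u in \<open>auto simp: TS_def proj_norm_add_le proj_norm_smult\<close>)
  then obtain T where T: "T \<in> linear_maps TS scalars" "\<And>v. v \<in> TP \<Longrightarrow> norm (T v) \<le> proj_norm Z X v"
      "T u = of_real (proj_norm Z X u)"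
    by blast
  have T_add: "T (\<lambda>A\<in>BF. v A + w A) = T v + T w" if "v \<in> TP" "w \<in> TP" for v w
    using linear_maps_add[OF T(1), of v w] that by (simp add: TS_def)
  have T_smult: "T (\<lambda>A\<in>BF. c * v A) = c * T v" if "v \<in> TP" for v c
    using linear_maps_smult[OF T(1), of v c] that by (simp add: TS_def)
  define e where "e z x = (\<lambda>A\<in>BF. A z x)" for z x
  have e_rep: "(1, \<lambda>_. z, \<lambda>_. x) \<in> tensor_reps Z X (e z x)"
    if "z \<in> carrier Z" "x \<in> carrier X" for z x
    using that by (simp add: tensor_reps_def tensor_sum_def e_def)
  have e_in: "e z x \<in> TP" if "z \<in> carrier Z" "x \<in> carrier X" for z x
    using e_rep[OF that] by (auto simp: tensor_product_def)
  define B where "B z x = T (e z x)" for z x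
  have "bilinear_op Z X scalars 1 B"
    unfolding bilinear_op_def
  proof (intro conjI ballI)
    fix x assume x: "x \<in> carrier X"
    have "B (z \<oplus>\<^bsub>Z\<^esub> w) x = B z x + B w x" if "z \<in> carrier Z" "w \<in> carrier Z" for z w
    proof -
      have "e (z \<oplus>\<^bsub>Z\<^esub> w) x = (\<lambda>A\<in>BF. e z x A + e w x A)"
        using that x by (auto simp: e_def fun_eq_iff bilinear_forms_add_left)
      then show ?thesis unfolding B_def using T_add[OF e_in e_in] that x by simp
    qed
    moreover have "B (c \<odot>\<^bsub>Z\<^esub> z) x = c * B z x" if "z \<in> carrier Z" for c z
    proof -
      have "e (c \<odot>\<^bsub>Z\<^esub> z) x = (\<lambda>A\<in>BF. c * e z x A)"
        using that x by (auto simp: e_def fun_eq_iff bilinear_forms_smult_left)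
      then show ?thesis unfolding B_def using T_smult[OF e_in] that x by simp
    qed
    ultimately show "(\<lambda>z\<in>carrier Z. B z x) \<in> linear_maps Z scalars"
      by (auto simp: linear_maps_def)
  next
    fix z assume z: "z \<in> carrier Z"
    have "B z (x \<oplus>\<^bsub>X\<^esub> y) = B z x + B z y" if "x \<in> carrier X" "y \<in> carrier X" for x y
    proof -
      have "e z (x \<oplus>\<^bsub>X\<^esub> y) = (\<lambda>A\<in>BF. e z x A + e z y A)"
        using that z by (auto simp: e_def fun_eq_iff bilinear_forms_add_right)
      then show ?thesis unfolding B_def using T_add[OF e_in e_in] that z by simp
    qed
    moreover have "B z (c \<odot>\<^bsub>X\<^esub> x) = c * B z x" if "x \<in> carrier X" for c x
    proof -
      have "e z (c \<odot>\<^bsub>X\<^esub> x) = (\<lambda>A\<in>BF. c * e z x A)"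
        using that z by (auto simp: e_def fun_eq_iff bilinear_forms_smult_right)
      then show ?thesis unfolding B_def using T_smult[OF e_in] that z by simp
    qed
    ultimately show "(\<lambda>x\<in>carrier X. B z x) \<in> linear_maps X scalars"
      by (auto simp: linear_maps_def)
    fix x assume x: "x \<in> carrier X"
    show "vnorm scalars (B z x) \<le> 1 * vnorm Z z * vnorm X x"
      using T(2)[OF e_in[OF z x]] proj_norm_le[OF e_rep[OF z x]] by (simp add: B_def)
  qed
  moreover have "u B = of_real (proj_norm Z X u)"
  proof -
    obtain n z x where r: "(n, z, x) \<in> tensor_reps Z X u" using u by (rule TP_cases)
    \<comment> \<open>Induction over the initial segments of a representation reduces the value of
      \<open>T\<close> to elementary tensors.\<close>
    have "T (tensor_sum Z X m z x) = (\<Sum>i<m. B (z i) (x i))" if "m \<le> n" for m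
      using that
    proof (induction m)
      case 0
      have "tensor_sum Z X 0 z x = (\<lambda>A\<in>BF. 0 * tensor_sum Z X 0 z x A)"
        by (simp add: tensor_sum_def)
      moreover have "T (\<lambda>A\<in>BF. 0 * tensor_sum Z X 0 z x A) = 0 * T (tensor_sum Z X 0 z x)"
        by (rule T_smult, rule tensor_sum_in) auto
      ultimately have "T (tensor_sum Z X 0 z x) = 0" by (metis mult_zero_left)
      then show ?case by simp
    next
      case (Suc m)
      have "tensor_sum Z X (Suc m) z x = (\<lambda>A\<in>BF. tensor_sum Z X m z x A + e (z m) (x m) A)"
        by (auto simp: tensor_sum_def e_def fun_eq_iff)
      then have "T (tensor_sum Z X (Suc m) z x) = T (tensor_sum Z X m z x) + T (e (z m) (x m))"
        using T_add[OF tensor_sum_in e_in] tensor_repsD[OF r] Suc.prems by simp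
      then show ?case using Suc by (simp add: B_def)
    qed
    from this[of n] show ?thesis
      using T(3) tensor_apply[OF r bilinear_op_forms[OF calculation]] tensor_repsD(3)[OF r] by simp
  qed
  ultimately show thesis by (rule that)
qed

end

subsection \<open>Uniform boundedness\<close>

text \<open>With ratio \<open>1/3\<close> the whole tail of the series amounts to half of the term
  before it, so it cannot cancel a contribution of full size.\<close>

lemma geometric_third_sum_le: "(\<Sum>i<l. (1/3::real) ^ (Suc k + i)) \<le> (1/2) * (1/3) ^ k"
proof -
  have "(\<Sum>i<l. (1/3::real) ^ (Suc k + i)) = (1/2) * (1/3) ^ k - (1/2) * (1/3) ^ (k + l)"
    by (induction l) simp_all
  then show ?thesis by simp
qed

text \<open>Adding \<open>\<plusminus> 3\<^sup>-\<^sup>k b\<^sub>k\<^sub>k\<close> with the better sign to the first \<open>k\<close> terms gives at least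
  \<open>3\<^sup>-\<^sup>k N\<^sub>k\<close>, and the later terms destroy at most half of this.\<close>

lemma signed_series_lower_bound:
  fixes b :: "nat \<Rightarrow> nat \<Rightarrow> 'k::rc_field"
  assumes le: "\<And>j k. norm (b j k) \<le> N k" and diag: "\<And>k. norm (b k k) = N k"
  obtains \<epsilon> :: "nat \<Rightarrow> 'k" where "\<And>j. norm (\<epsilon> j) = 1"
    "\<And>k. (1/2) * (1/3) ^ k * N k \<le> norm (\<Sum>j. \<epsilon> j * of_real ((1/3) ^ j) * b j k)"
proof -
  define c where "c e j k = e j * of_real ((1/3) ^ j) * b j k" for e :: "nat \<Rightarrow> 'k" and j k
  define good where "good e k \<longleftrightarrow> (1/3) ^ k * N k \<le> norm (\<Sum>j<Suc k. c e j k)" for e k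
  define P where "P n e \<longleftrightarrow> (\<forall>j. norm (e j) = 1) \<and> (\<forall>k<n. good e k)" for n e
  have good_cong: "good e k \<longleftrightarrow> good e' k" if "\<And>j. j \<le> k \<Longrightarrow> e j = e' j" for e e' k
  proof -
    have "(\<Sum>j<Suc k. c e j k) = (\<Sum>j<Suc k. c e' j k)"
      using that by (intro sum.cong) (auto simp: c_def)
    then show ?thesis by (simp add: good_def)
  qed
  \<comment> \<open>Stage \<open>n\<close> settles the first \<open>n\<close> signs and later stages
    leave them unchanged, so the diagonal \<open>f (Suc j) j\<close> agrees with every later stage
    at \<open>j\<close>.\<close>
  have "\<exists>f. \<forall>n. P n (f n) \<and> (\<forall>j<n. f (Suc n) j = f n j)"
  proof (rule dependent_nat_choice)
    show "\<exists>e. P 0 e" by (intro exI[of _ "\<lambda>_. 1"]) (simp add: P_def)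
    fix e n assume e: "P n e"
    define s where "s = (\<Sum>j<n. c e j n)"
    define t where "t = of_real ((1/3) ^ n) * b n n"
    have t: "norm t = (1/3) ^ n * N n" using diag by (simp add: t_def norm_mult norm_power)
    \<comment> \<open>As \<open>2 t\<close> is the difference of \<open>s + t\<close> and
      \<open>s - t\<close>, one of these is at least as large as \<open>t\<close>.\<close>
    have "2 * norm t \<le> norm (s + t) + norm (s - t)"
      using norm_triangle_ineq4[of "s + t" "s - t"] norm_mult[of 2 t] by (simp add: mult_2[symmetric])
    then have "\<exists>\<sigma>::'k. norm \<sigma> = 1 \<and> norm t \<le> norm (s + \<sigma> * t)"
    proof (cases "norm t \<le> norm (s + t)")
      case True
      then show ?thesis by (intro exI[of _ 1]) simp
    next
      case False
      then have "norm t \<le> norm (s - t)"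
        using \<open>2 * norm t \<le> norm (s + t) + norm (s - t)\<close> by simp
      then show ?thesis by (intro exI[of _ "- 1"]) simp
    qed
    then obtain \<sigma> :: 'k where \<sigma>: "norm \<sigma> = 1" "norm t \<le> norm (s + \<sigma> * t)" by blast
    define e' where "e' = e(n := \<sigma>)"
    have "(\<Sum>j<Suc n. c e' j n) = s + \<sigma> * t"
      by (simp add: e'_def s_def t_def c_def mult.assoc)
    then have "good e' n" using \<sigma>(2) t by (simp add: good_def)
    moreover have "good e' k" if "k < n" for k
      using e that good_cong[of k e' e] by (auto simp: P_def e'_def)
    moreover have "norm (e' j) = 1" for j using e \<sigma>(1) by (simp add: P_def e'_def)
    ultimately have "P (Suc n) e'" unfolding P_def by (metis less_Suc_eq)
    then show "\<exists>e'. P (Suc n) e' \<and> (\<forall>j<n. e' j = e j)"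
      by (intro exI[of _ e']) (simp add: e'_def)
  qed
  then obtain f where f: "\<And>n. P n (f n)" "\<And>n j. j < n \<Longrightarrow> f (Suc n) j = f n j" by blast
  define \<epsilon> where "\<epsilon> j = f (Suc j) j" for j
  have stable: "f n j = \<epsilon> j" if "j < n" for n j
    using that
  proof (induction n)
    case (Suc n)
    then show ?case using f(2)[of j n] by (cases "j = n") (auto simp: \<epsilon>_def)
  qed simp
  have "good \<epsilon> k" for k
    using f(1)[of "Suc k"] good_cong[of k "f (Suc k)" \<epsilon>] stable[of _ "Suc k"] by (simp add: P_def)
  then have good: "(1/3) ^ k * N k \<le> norm (\<Sum>j<Suc k. c \<epsilon> j k)" for k by (simp add: good_def)
  have norm_\<epsilon>: "norm (\<epsilon> j) = 1" for j using f(1)[of "Suc j"] by (simp add: P_def \<epsilon>_def)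
  have c_le: "norm (c \<epsilon> j k) \<le> (1/3) ^ j * N k" for j k
    using le[of j k] by (simp add: c_def norm_mult norm_\<epsilon> norm_power mult_left_mono)
  have N: "0 \<le> N k" for k using le[of k k] norm_ge_zero order_trans by blast
  show thesis
  proof (rule that[of \<epsilon>, OF norm_\<epsilon>])
    fix k
    have "summable (\<lambda>j. (1/3) ^ j * N k)" by (intro summable_mult2 summable_geometric) simp
    then have "summable (\<lambda>j. c \<epsilon> j k)" using c_le by (rule rc_field_summable)
    then have "(\<lambda>m. \<Sum>j<m. c \<epsilon> j k) \<longlonglongrightarrow> (\<Sum>j. c \<epsilon> j k)" by (rule summable_LIMSEQ)
    then have "(\<lambda>m. norm (\<Sum>j<m. c \<epsilon> j k)) \<longlonglongrightarrow> norm (\<Sum>j. c \<epsilon> j k)" by (rule tendsto_norm)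
    moreover have "(1/2) * (1/3) ^ k * N k \<le> norm (\<Sum>j<m. c \<epsilon> j k)" if m: "m \<ge> Suc k" for m
    proof -
      obtain l where l: "m = Suc k + l" using m le_Suc_ex by blast
      have split: "(\<Sum>j<m. c \<epsilon> j k) = (\<Sum>j<Suc k. c \<epsilon> j k) + (\<Sum>i<l. c \<epsilon> (Suc k + i) k)"
        unfolding l by (induction l) (simp_all add: add.assoc)
      have "norm (\<Sum>i<l. c \<epsilon> (Suc k + i) k) \<le> (\<Sum>i<l. (1/3) ^ (Suc k + i) * N k)"
        using c_le by (intro sum_norm_le)
      also have "\<dots> = (\<Sum>i<l. (1/3) ^ (Suc k + i)) * N k" by (rule sum_distrib_right[symmetric])
      also have "\<dots> \<le> (1/2) * (1/3) ^ k * N k"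
        using N by (intro mult_right_mono geometric_third_sum_le)
      finally have "norm (\<Sum>i<l. c \<epsilon> (Suc k + i) k) \<le> (1/2) * (1/3) ^ k * N k" .
      moreover have "norm (\<Sum>j<Suc k. c \<epsilon> j k) - norm (\<Sum>i<l. c \<epsilon> (Suc k + i) k) \<le> norm (\<Sum>j<m. c \<epsilon> j k)"
        unfolding split by (rule norm_diff_ineq)
      ultimately show ?thesis using good[of k] by linarith
    qed
    ultimately show "(1/2) * (1/3) ^ k * N k \<le> norm (\<Sum>j. \<epsilon> j * of_real ((1/3) ^ j) * b j k)"
      unfolding c_def by (intro LIMSEQ_le_const) auto
  qed
qed

context tensor_setup
begin

text \<open>\<open>3/2\<close> is the sum of the weights \<open>(1/3) ^ j\<close>. A tensor is a
  finite sum of evaluations, so evaluating it commutes with the series.\<close>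

lemma bilinear_op_series:
  assumes B: "\<And>j. bilinear_op Z X scalars 1 (B j)" and \<epsilon>: "\<And>j. norm (\<epsilon> j) = 1"
  defines "c \<equiv> \<lambda>j. \<epsilon> j * of_real ((1/3) ^ j)"
  defines "T \<equiv> \<lambda>z x. \<Sum>j. c j * B j z x"
  shows "bilinear_op Z X scalars (3/2) T"
    and "u \<in> TP \<Longrightarrow> u T = (\<Sum>j. c j * u (B j))"
proof -
  have c: "norm (c j) = (1/3) ^ j" for j by (simp add: c_def norm_mult \<epsilon> norm_power)
  have term_le: "norm (c j * B j z x) \<le> (1/3) ^ j * (vnorm Z z * vnorm X x)"
    if "z \<in> carrier Z" "x \<in> carrier X" for j z x
    using bilinear_op_bound[OF B that, of j] by (simp add: norm_mult c mult_left_mono)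
  have summ: "summable (\<lambda>j. c j * B j z x)" if "z \<in> carrier Z" "x \<in> carrier X" for z x
    using term_le[OF that]
    by (rule rc_field_summable[rotated]) (intro summable_mult2 summable_geometric, simp)
  note forms = bilinear_op_forms[OF B]
  show T: "bilinear_op Z X scalars (3/2) T"
    unfolding bilinear_op_def
  proof (intro conjI ballI)
    fix x assume x: "x \<in> carrier X"
    have "T (z \<oplus>\<^bsub>Z\<^esub> w) x = T z x + T w x" if "z \<in> carrier Z" "w \<in> carrier Z" for z w
      unfolding T_def using suminf_add[OF summ summ, of z x w x] that x
      by (simp add: bilinear_forms_add_left[OF forms] distrib_left)
    moreover have "T (a \<odot>\<^bsub>Z\<^esub> z) x = a * T z x" if "z \<in> carrier Z" for a z
      unfolding T_def using suminf_mult[OF summ, of z x a] that x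
      by (simp add: bilinear_forms_smult_left[OF forms] mult.left_commute)
    ultimately show "(\<lambda>z\<in>carrier Z. T z x) \<in> linear_maps Z scalars"
      by (auto simp: linear_maps_def)
  next
    fix z assume z: "z \<in> carrier Z"
    have "T z (x \<oplus>\<^bsub>X\<^esub> y) = T z x + T z y" if "x \<in> carrier X" "y \<in> carrier X" for x y
      unfolding T_def using suminf_add[OF summ summ, of z x z y] that z
      by (simp add: bilinear_forms_add_right[OF forms] distrib_left)
    moreover have "T z (a \<odot>\<^bsub>X\<^esub> x) = a * T z x" if "x \<in> carrier X" for a x
      unfolding T_def using suminf_mult[OF summ, of z x a] that z
      by (simp add: bilinear_forms_smult_right[OF forms] mult.left_commute)
    ultimately show "(\<lambda>x\<in>carrier X. T z x) \<in> linear_maps X scalars"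
      by (auto simp: linear_maps_def)
    fix x assume x: "x \<in> carrier X"
    let ?K = "vnorm Z z * vnorm X x"
    have K: "0 \<le> ?K" using z x by simp
    have "norm (\<Sum>j<m. c j * B j z x) \<le> 3/2 * ?K" for m
    proof -
      have "norm (\<Sum>j<m. c j * B j z x) \<le> (\<Sum>j<m. (1/3) ^ j * ?K)"
        using term_le[OF z x] by (intro sum_norm_le)
      also have "\<dots> = (\<Sum>j<m. (1/3) ^ j) * ?K" by (rule sum_distrib_right[symmetric])
      also have "(\<Sum>j<m. (1/3::real) ^ j) = 3/2 - 3/2 * (1/3) ^ m"
        by (induction m) simp_all
      also have "\<dots> \<le> 3/2" by simp
      finally show ?thesis using K by (simp add: mult_right_mono)
    qed
    moreover have "(\<lambda>m. norm (\<Sum>j<m. c j * B j z x)) \<longlonglongrightarrow> norm (T z x)"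
      unfolding T_def by (intro tendsto_norm summable_LIMSEQ summ z x)
    ultimately have "norm (T z x) \<le> 3/2 * ?K" by (intro LIMSEQ_le_const2) auto
    then show "vnorm scalars (T z x) \<le> 3/2 * vnorm Z z * vnorm X x" by simp
  qed
  assume "u \<in> TP"
  then obtain n z x where r: "(n, z, x) \<in> tensor_reps Z X u" by (rule TP_cases)
  have "u T = (\<Sum>i<n. \<Sum>j. c j * B j (z i) (x i))"
    using tensor_apply[OF r bilinear_op_forms[OF T]] by (simp add: T_def)
  also have "\<dots> = (\<Sum>j. \<Sum>i<n. c j * B j (z i) (x i))"
    using summ tensor_repsD[OF r] by (intro suminf_sum[symmetric]) auto
  also have "\<dots> = (\<Sum>j. c j * u (B j))"
    by (simp add: tensor_apply[OF r forms] sum_distrib_left)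
  finally show "u T = (\<Sum>j. c j * u (B j))" .
qed

lemma chevet_saphar_boundedD:
  assumes p: "1 \<le> p" and B: "bilinear_op Z X scalars M B" "chevet_saphar_bounded p Z X scalars B C" "0 \<le> C"
    and u: "u \<in> TP"
  shows "norm (u B) \<le> C * chevet_saphar_norm p Z X u"
proof (cases "C = 0")
  case True
  obtain n z x where r: "(n, z, x) \<in> tensor_reps Z X u" using u by (rule TP_cases)
  then show ?thesis
    using B(2) tensor_repsD[OF r] tensor_apply[OF r bilinear_op_forms[OF B(1)]] True
    by (simp add: chevet_saphar_bounded_def)
next
  case False
  with B have "C > 0" by simp
  have "norm (u B) / C \<le> chevet_saphar_norm p Z X u"
  proof (rule chevet_saphar_norm_ge[OF u])
    fix n z x assume r: "(n, z, x) \<in> tensor_reps Z X u"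
    have "norm (u B) \<le> C * (weak_lp_norm (conj_index p) Z n z * lp_norm_fin p n (\<lambda>i. vnorm X (x i)))"
      using B(2) tensor_repsD[OF r] tensor_apply[OF r bilinear_op_forms[OF B(1)]]
      by (simp add: chevet_saphar_bounded_def)
    then show "norm (u B) / C \<le> weak_lp_norm (conj_index p) Z n z * lp_norm_fin p n (\<lambda>i. vnorm X (x i))"
      using \<open>C > 0\<close> by (simp add: field_simps)
  qed
  then show ?thesis using \<open>C > 0\<close> by (simp add: field_simps)
qed

text \<open>A uniform boundedness argument. At \<open>u k\<close> the form \<open>T\<close> has size
  at least \<open>(1/2) * (1/3) ^ k\<close> times the projective norm, while a constant
  \<open>C\<close> for \<open>T\<close> allows at most \<open>C / 4 ^ k\<close> times that norm;
  then \<open>(4/3) ^ k\<close> would stay below \<open>2 * C\<close>.\<close>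

lemma proj_le_chevet_saphar:
  assumes p: "1 \<le> p"
    and all: "\<And>M B. 0 \<le> M \<Longrightarrow> bilinear_op Z X scalars M B \<Longrightarrow> \<exists>C. chevet_saphar_bounded p Z X scalars B C"
  shows "\<exists>C>0. \<forall>u\<in>TP. proj_norm Z X u \<le> C * chevet_saphar_norm p Z X u"
proof (rule ccontr)
  assume no_C: "\<not> ?thesis"
  have "\<exists>u\<in>TP. 4 ^ k * chevet_saphar_norm p Z X u < proj_norm Z X u" for k :: nat
  proof -
    have "(4::real) ^ k > 0" by simp
    then show ?thesis using no_C by (meson not_le)
  qed
  then have "\<forall>k::nat. \<exists>u. u \<in> TP \<and> 4 ^ k * chevet_saphar_norm p Z X u < proj_norm Z X u" by blast
  from choice[OF this] obtain u where u: "\<And>k. u k \<in> TP"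
      "\<And>k::nat. 4 ^ k * chevet_saphar_norm p Z X (u k) < proj_norm Z X (u k)" by blast
  have "\<forall>k. \<exists>B. bilinear_op Z X scalars 1 B \<and> u k B = of_real (proj_norm Z X (u k))"
    using proj_norm_attained[OF u(1)] by metis
  from choice[OF this] obtain B where B: "\<And>k. bilinear_op Z X scalars 1 (B k)"
      "\<And>k. u k (B k) = of_real (proj_norm Z X (u k))" by blast
  have pos: "0 < proj_norm Z X (u k)" for k
    using u(2)[of k] chevet_saphar_norm_nonneg[OF p u(1)[of k]]
    by (smt (verit) mult_nonneg_nonneg zero_le_power)
  have le: "norm (u k (B j)) \<le> proj_norm Z X (u k)" for j k
    using bilinear_op_le_proj_norm[OF u(1) B(1)] by simp
  have diag: "norm (u k (B k)) = proj_norm Z X (u k)" for k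
    using pos[of k] by (simp add: B(2))
  obtain \<epsilon> :: "nat \<Rightarrow> 'k" where \<epsilon>: "\<And>j. norm (\<epsilon> j) = 1"
    "\<And>k. (1/2) * (1/3) ^ k * proj_norm Z X (u k) \<le> norm (\<Sum>j. \<epsilon> j * of_real ((1/3) ^ j) * u k (B j))"
    using signed_series_lower_bound[of "\<lambda>j k. u k (B j)" "\<lambda>k. proj_norm Z X (u k)", OF le diag] by blast
  define T where "T = (\<lambda>z x. \<Sum>j. \<epsilon> j * of_real ((1/3) ^ j) * B j z x)"
  have T: "bilinear_op Z X scalars (3/2) T" "u k T = (\<Sum>j. \<epsilon> j * of_real ((1/3) ^ j) * u k (B j))" for k
    unfolding T_def using bilinear_op_series[of B \<epsilon>, OF B(1) \<epsilon>(1)] u(1) by auto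
  obtain C0 where C0: "chevet_saphar_bounded p Z X scalars T C0" using all[OF _ T(1)] by auto
  define C where "C = max C0 0"
  have C: "0 \<le> C" "chevet_saphar_bounded p Z X scalars T C"
    using chevet_saphar_bounded_mono[OF Z.normed_space_axioms p C0, of C] by (auto simp: C_def)
  have "(4/3) ^ k \<le> 2 * C" for k
  proof -
    have "(1/2) * (1/3) ^ k * proj_norm Z X (u k) \<le> norm (u k T)" using \<epsilon>(2)[of k] T(2)[of k] by simp
    also have "\<dots> \<le> C * chevet_saphar_norm p Z X (u k)"
      by (rule chevet_saphar_boundedD[OF p T(1) C(2,1) u(1)])
    also have "\<dots> \<le> C * (proj_norm Z X (u k) / 4 ^ k)"
      using u(2)[of k] C(1) by (intro mult_left_mono) (simp_all add: field_simps)
    finally have "((1/2) * (1/3) ^ k) * proj_norm Z X (u k) \<le> (C / 4 ^ k) * proj_norm Z X (u k)"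
      by simp
    then have "(1/2) * (1/3) ^ k \<le> C / 4 ^ k" using pos[of k] by (simp only: mult_le_cancel_right_pos)
    then show ?thesis by (simp add: power_divide field_simps)
  qed
  moreover obtain k where "2 * C < (4/3) ^ k" using real_arch_pow[of "4/3" "2 * C"] by auto
  ultimately show False by (meson not_le)
qed

text \<open>A norming functional on \<open>Y\<close> reduces the sum to the value of a tensor at a
  scalar form with the same bound \<open>M\<close>; hence \<open>K\<close> serves all target
  spaces.\<close>

lemma chevet_saphar_bounded_of_proj_le:
  assumes p: "1 \<le> p" and le: "\<And>u. u \<in> TP \<Longrightarrow> proj_norm Z X u \<le> K * chevet_saphar_norm p Z X u"
    and "0 \<le> K" and Y: "normed_space Y" and S: "bilinear_op Z X Y M S" and "0 \<le> M"
  shows "chevet_saphar_bounded p Z X Y S (M * K)"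
  unfolding chevet_saphar_bounded_def
proof (intro allI impI)
  fix n :: nat and z x assume zx: "\<forall>i<n. z i \<in> carrier Z \<and> x i \<in> carrier X"
  interpret Y: normed_space Y by fact
  let ?y = "finsum Y (\<lambda>i. S (z i) (x i)) {..<n}"
  have y: "?y \<in> carrier Y" using zx by (intro Y.finsum_in bilinear_op_closed[OF S]) auto
  obtain f where f: "f \<in> linear_maps Y scalars" "\<And>y. y \<in> carrier Y \<Longrightarrow> norm (f y) \<le> vnorm Y y"
      "f ?y = of_real (vnorm Y ?y)"
    using Y.Hahn_Banach_seminorm[of "vnorm Y" ?y, OF Y.vnorm_triangle Y.vnorm_smult y] by blast
  define A where "A z x = f (S z x)" for z x
  have A: "bilinear_op Z X scalars M A"
    unfolding bilinear_op_def
  proof (intro conjI ballI)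
    fix x assume x: "x \<in> carrier X"
    show "(\<lambda>z\<in>carrier Z. A z x) \<in> linear_maps Z scalars"
      using x by (auto simp: linear_maps_def A_def bilinear_op_add_left[OF S] bilinear_op_smult_left[OF S]
          linear_maps_add[OF f(1)] linear_maps_smult[OF f(1)] bilinear_op_closed[OF S])
  next
    fix z assume z: "z \<in> carrier Z"
    show "(\<lambda>x\<in>carrier X. A z x) \<in> linear_maps X scalars"
      using z by (auto simp: linear_maps_def A_def bilinear_op_add_right[OF S] bilinear_op_smult_right[OF S]
          linear_maps_add[OF f(1)] linear_maps_smult[OF f(1)] bilinear_op_closed[OF S])
    fix x assume x: "x \<in> carrier X"
    show "vnorm scalars (A z x) \<le> M * vnorm Z z * vnorm X x"
      using f(2)[OF bilinear_op_closed[OF S z x]] bilinear_op_bound[OF S z x] by (simp add: A_def)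
  qed
  have r: "(n, z, x) \<in> tensor_reps Z X (tensor_sum Z X n z x)" and u: "tensor_sum Z X n z x \<in> TP"
    using zx by (auto intro!: tensor_repsI tensor_sum_in)
  have "f ?y = (\<Sum>i<n. A (z i) (x i))"
    using linear_maps_finsum[OF Y normed_space_scalars f(1), of "{..<n}" "\<lambda>i. S (z i) (x i)"]
      bilinear_op_closed[OF S] zx by (simp add: A_def)
  then have "vnorm Y ?y = norm (tensor_sum Z X n z x A)"
    using tensor_apply[OF r bilinear_op_forms[OF A]] f(3) y by (metis Y.vnorm_nonneg abs_of_nonneg norm_of_real)
  also have "\<dots> \<le> M * proj_norm Z X (tensor_sum Z X n z x)"
    by (rule bilinear_op_le_proj_norm[OF u A \<open>0 \<le> M\<close>])
  also have "\<dots> \<le> M * (K * chevet_saphar_norm p Z X (tensor_sum Z X n z x))"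
    using le[OF u] \<open>0 \<le> M\<close> by (rule mult_left_mono)
  also have "\<dots> \<le> M * (K * (weak_lp_norm (conj_index p) Z n z * lp_norm_fin p n (\<lambda>i. vnorm X (x i))))"
    using chevet_saphar_norm_le[OF p r] \<open>0 \<le> M\<close> \<open>0 \<le> K\<close> by (intro mult_left_mono) auto
  finally show "vnorm Y ?y \<le> M * K * (weak_lp_norm (conj_index p) Z n z * lp_norm_fin p n (\<lambda>i. vnorm X (x i)))"
    by (simp add: mult.assoc)
qed

end

subsection \<open>The equivalences\<close>

context cp_setup
begin

definition extension_property :: "('k, 'y) nspace \<Rightarrow> bool" where
  "extension_property Y \<longleftrightarrow>
    (\<forall>S\<in>bounded_ops Z (op_space X Y). \<exists>U\<in>bounded_ops Cp Y. assoc_op \<Omega> X U = S)"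

definition forms_chevet_saphar_bounded :: bool where
  "forms_chevet_saphar_bounded \<longleftrightarrow>
    (\<forall>S\<in>bounded_ops Z (dual X). \<exists>C. chevet_saphar_bounded p Z X scalars S C)"

lemma tensor_setup_Z: "tensor_setup Z X"
  by (intro tensor_setup.intro normed_Z normed_X)

text \<open>Multiplying a scalar form by a fixed nonzero vector \<open>y0\<close> gives a form with
  values in \<open>Y\<close>; the estimate inherited from its extension is divided by the norm of
  \<open>y0\<close>.\<close>

lemma forms_bounded_of_extension_property:
  assumes Y: "normed_space Y" and nontrivial: "carrier Y \<noteq> {\<zero>\<^bsub>Y\<^esub>}" and ext: "extension_property Y"
  shows forms_chevet_saphar_bounded
  unfolding forms_chevet_saphar_bounded_def
proof
  interpret Y: normed_space Y by fact
  fix S assume "S \<in> bounded_ops Z (dual X)"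
  then obtain M where M: "0 \<le> M" and S: "bilinear_op Z X scalars M S"
    using bilinear_op_of_bounded_ops[OF normed_Z normed_X normed_space_scalars] unfolding dual_def by blast
  obtain y0 where y0: "y0 \<in> carrier Y" "y0 \<noteq> \<zero>\<^bsub>Y\<^esub>" using nontrivial Y.M.zero_closed by blast
  have n0: "vnorm Y y0 > 0" using y0 by (simp add: less_le Y.vnorm_eq_0)
  define B where "B z x = S z x \<odot>\<^bsub>Y\<^esub> y0" for z x
  note forms = bilinear_op_forms[OF S]
  interpret Z: normed_space Z by (rule normed_Z)
  have B: "bilinear_op Z X Y (M * vnorm Y y0) B"
    unfolding bilinear_op_def
  proof (intro conjI ballI)
    fix x assume "x \<in> carrier X"
    then show "(\<lambda>z\<in>carrier Z. B z x) \<in> linear_maps Z Y"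
      using y0 by (auto simp: linear_maps_def B_def bilinear_forms_add_left[OF forms]
          bilinear_forms_smult_left[OF forms] Y.smult_add_left Y.smult_mult)
  next
    fix z assume z: "z \<in> carrier Z"
    then show "(\<lambda>x\<in>carrier X. B z x) \<in> linear_maps X Y"
      using y0 by (auto simp: linear_maps_def B_def bilinear_forms_add_right[OF forms]
          bilinear_forms_smult_right[OF forms] Y.smult_add_left Y.smult_mult)
    fix x assume x: "x \<in> carrier X"
    have "norm (S z x) * vnorm Y y0 \<le> M * vnorm Z z * vnorm X x * vnorm Y y0"
      using bilinear_op_bound[OF S z x] n0 by (intro mult_right_mono) auto
    then show "vnorm Y (B z x) \<le> M * vnorm Y y0 * vnorm Z z * vnorm X x"
      using y0 by (simp add: B_def Y.vnorm_smult mult_ac)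
  qed
  have "(\<lambda>z\<in>carrier Z. \<lambda>x\<in>carrier X. B z x) \<in> bounded_ops Z (op_space X Y)"
    using M n0 by (intro bounded_ops_of_bilinear_op[OF normed_Z normed_X Y _ B]) simp
  then obtain U where U: "U \<in> bounded_ops Cp Y"
      "assoc_op \<Omega> X U = (\<lambda>z\<in>carrier Z. \<lambda>x\<in>carrier X. B z x)"
    using ext unfolding extension_property_def by blast
  obtain C where C: "chevet_saphar_bounded p Z X Y (\<lambda>z\<in>carrier Z. \<lambda>x\<in>carrier X. B z x) C"
    using chevet_saphar_bounded_assoc_op[OF Y U(1)] U(2) by auto
  have "chevet_saphar_bounded p Z X scalars S (C / vnorm Y y0)"
    unfolding chevet_saphar_bounded_def
  proof (intro allI impI)
    fix n :: nat and z x assume zx: "\<forall>i<n. z i \<in> carrier Z \<and> x i \<in> carrier X"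
    have le: "vnorm Y (finsum Y (\<lambda>i. (\<lambda>z\<in>carrier Z. \<lambda>x\<in>carrier X. B z x) (z i) (x i)) {..<n})
        \<le> C * (weak_lp_norm q Z n z * lp_norm_fin p n (\<lambda>i. vnorm X (x i)))"
      using zx by (intro C[unfolded chevet_saphar_bounded_def, rule_format]) auto
    have "finsum Y (\<lambda>i. (\<lambda>z\<in>carrier Z. \<lambda>x\<in>carrier X. B z x) (z i) (x i)) {..<n}
        = finsum Y (\<lambda>i. S (z i) (x i) \<odot>\<^bsub>Y\<^esub> y0) {..<n}"
      using zx y0 by (intro Y.finsum_eq) (auto simp: B_def)
    also have "\<dots> = (\<Sum>i<n. S (z i) (x i)) \<odot>\<^bsub>Y\<^esub> y0" by (rule Y.sum_smult[OF y0(1), symmetric])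
    finally have "vnorm Y ((\<Sum>i<n. S (z i) (x i)) \<odot>\<^bsub>Y\<^esub> y0)
        \<le> C * (weak_lp_norm q Z n z * lp_norm_fin p n (\<lambda>i. vnorm X (x i)))"
      using le by (simp only:)
    then show "vnorm scalars (finsum scalars (\<lambda>i. S (z i) (x i)) {..<n})
        \<le> C / vnorm Y y0 * (weak_lp_norm q Z n z * lp_norm_fin p n (\<lambda>i. vnorm X (x i)))"
      using y0 n0 by (simp add: Y.vnorm_smult field_simps)
  qed
  then show "\<exists>C. chevet_saphar_bounded p Z X scalars S C" ..
qed

text \<open>The inequality between the tensor norms yields the Chevet-Saphar bound
  \<open>M * K\<close> from which \<open>ext_op\<close> is built; completeness of \<open>Y\<close>
  enters through the limits of its sums.\<close>

lemma extension_property_of_proj_le: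
  assumes "banach_space Y" and "0 \<le> K"
    and le: "\<And>u. u \<in> tensor_product Z X \<Longrightarrow> proj_norm Z X u \<le> K * chevet_saphar_norm p Z X u"
  shows "extension_property Y"
  unfolding extension_property_def
proof
  interpret Y: banach_space Y by fact
  interpret T: tensor_setup Z X by (rule tensor_setup_Z)
  fix S assume S: "S \<in> bounded_ops Z (op_space X Y)"
  then obtain M where M: "0 \<le> M" and B: "bilinear_op Z X Y M S"
    using bilinear_op_of_bounded_ops[OF normed_Z normed_X Y.normed_space_axioms] by blast
  have "chevet_saphar_bounded p Z X Y S (M * K)"
    using le assms(2) by (intro T.chevet_saphar_bounded_of_proj_le[OF p_ge_1 _ _ Y.normed_space_axioms B M])
  then interpret E: cp_extension X \<Omega> p Y S M "M * K"
    using B M assms(2) by unfold_locales auto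
  have "assoc_op \<Omega> X E.ext_op = S"
  \<comment> \<open>Both sides are extensional in the function and again in the vector, so agreement
    on elementary functions is enough.\<close>
  proof (rule extensionalityI[of _ "carrier Z"])
    show "assoc_op \<Omega> X E.ext_op \<in> extensional (carrier Z)" by (simp add: assoc_op_def)
    show "S \<in> extensional (carrier Z)"
      using bounded_ops_linear[OF S] by (auto simp: linear_maps_def PiE_def)
    fix \<phi> assume \<phi>: "\<phi> \<in> carrier Z"
    have "S \<phi> \<in> bounded_ops X Y"
      using linear_maps_closed[OF bounded_ops_linear[OF S] \<phi>] by (simp add: op_space_simps)
    then have "S \<phi> \<in> extensional (carrier X)"
      by (auto simp: bounded_ops_def linear_maps_def PiE_def)
    moreover have "assoc_op \<Omega> X E.ext_op \<phi> \<in> extensional (carrier X)"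
      using \<phi> by (simp add: assoc_op_def)
    ultimately show "assoc_op \<Omega> X E.ext_op \<phi> = S \<phi>"
      by (intro extensionalityI[of _ "carrier X"]) (auto simp: assoc_op_apply \<phi> E.ext_op_elementary)
  qed
  then show "\<exists>U\<in>bounded_ops Cp Y. assoc_op \<Omega> X U = S" using E.ext_op_bounded by blast
qed

lemma proj_le_of_forms_bounded:
  assumes forms_chevet_saphar_bounded
  shows "\<exists>C>0. \<forall>u\<in>tensor_product Z X. proj_norm Z X u \<le> C * chevet_saphar_norm p Z X u"
proof -
  interpret T: tensor_setup Z X by (rule tensor_setup_Z)
  show ?thesis
  proof (rule T.proj_le_chevet_saphar[OF p_ge_1])
    fix M :: real and B assume M: "0 \<le> M" and B: "bilinear_op Z X scalars M B"
    have "(\<lambda>z\<in>carrier Z. \<lambda>x\<in>carrier X. B z x) \<in> bounded_ops Z (dual X)"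
      unfolding dual_def by (rule bounded_ops_of_bilinear_op[OF normed_Z normed_X normed_space_scalars M B])
    then obtain C where "chevet_saphar_bounded p Z X scalars (\<lambda>z\<in>carrier Z. \<lambda>x\<in>carrier X. B z x) C"
      using assms unfolding forms_chevet_saphar_bounded_def by blast
    then have "chevet_saphar_bounded p Z X scalars B C"
      by (simp add: chevet_saphar_bounded_def)
    then show "\<exists>C. chevet_saphar_bounded p Z X scalars B C" ..
  qed
qed

text \<open>Since \<open>d_p \<le> \<pi>\<close> always holds, only the reverse estimate carries
  information.\<close>

lemma equivalent_norms_iff:
  "equivalent_norms_on (tensor_product Z X) (chevet_saphar_norm p Z X) (proj_norm Z X) \<longleftrightarrow>
    (\<exists>C>0. \<forall>u\<in>tensor_product Z X. proj_norm Z X u \<le> C * chevet_saphar_norm p Z X u)"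
  (is "?L \<longleftrightarrow> ?R")
proof
  assume ?L
  then obtain c where c: "c > 0" "\<forall>u\<in>tensor_product Z X. c * proj_norm Z X u \<le> chevet_saphar_norm p Z X u"
    unfolding equivalent_norms_on_def by blast
  then show ?R by (intro exI[of _ "1 / c"]) (auto simp: field_simps)
next
  interpret T: tensor_setup Z X by (rule tensor_setup_Z)
  assume ?R
  then obtain C where C: "C > 0" "\<forall>u\<in>tensor_product Z X. proj_norm Z X u \<le> C * chevet_saphar_norm p Z X u"
    by blast
  then have "\<forall>u\<in>tensor_product Z X. 1 / C * proj_norm Z X u \<le> chevet_saphar_norm p Z X u \<and>
      chevet_saphar_norm p Z X u \<le> 1 * proj_norm Z X u"
    using T.chevet_saphar_le_proj[OF p_ge_1] by (auto simp: field_simps)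
  then show ?L
    unfolding equivalent_norms_on_def using C(1)
    by (intro exI[of _ "1 / C"] exI[of _ 1] conjI) auto
qed

end

text \<open>A copy of the scalar field on the range of an injection \<open>e\<close>, i.e. a one-dimensional Banach
  space inside the type over which (a) and (b) quantify.\<close>

definition scalar_copy :: "('k::rc_field \<Rightarrow> 'u) \<Rightarrow> ('k, 'u) nspace" where
  "scalar_copy e = \<lparr>carrier = range e, mult = undefined, one = undefined, zero = e 0,
     add = (\<lambda>a b. e (inv_into UNIV e a + inv_into UNIV e b)), smult = (\<lambda>c a. e (c * inv_into UNIV e a)),
     vnorm = (\<lambda>a. norm (inv_into UNIV e a))\<rparr>"

lemma banach_space_scalar_copy:
  fixes e :: "'k::rc_field \<Rightarrow> 'u"
  assumes "inj e"
  shows "banach_space (scalar_copy e)" "carrier (scalar_copy e) \<noteq> {\<zero>\<^bsub>scalar_copy e\<^esub>}"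
proof -
  let ?Y = "scalar_copy e"
  have [simp]: "inv_into UNIV e (e a) = a" for a using assms by simp
  have [simp]: "e a = e b \<longleftrightarrow> a = b" for a b using assms by (simp add: inj_eq)
  have simps [simp]: "carrier ?Y = range e" "zero ?Y = e 0" "add ?Y = (\<lambda>a b. e (inv_into UNIV e a + inv_into UNIV e b))"
    "smult ?Y = (\<lambda>c a. e (c * inv_into UNIV e a))" "vnorm ?Y = (\<lambda>a. norm (inv_into UNIV e a))"
    by (simp_all add: scalar_copy_def)
  have "abelian_group ?Y"
  proof (rule abelian_groupI)
    fix x assume "x \<in> carrier ?Y"
    then show "\<exists>y\<in>carrier ?Y. y \<oplus>\<^bsub>?Y\<^esub> x = \<zero>\<^bsub>?Y\<^esub>"
      by (intro bexI[of _ "e (- inv_into UNIV e x)"]) auto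
  qed (auto simp: algebra_simps)
  then have "Module.module scalars ?Y"
    by (intro moduleI cring_scalars) (auto simp: algebra_simps)
  then have n: "normed_space ?Y"
    by (intro normed_space.intro normed_space_axioms.intro) (auto simp: norm_mult norm_triangle_ineq)
  then interpret Y: normed_space ?Y .
  have diff: "e a \<ominus>\<^bsub>?Y\<^esub> e b = e (a - b)" for a b
    using Y.a_inv_eq_smult[of "e b"] by (simp add: a_minus_def)
  show "banach_space ?Y"
  proof (intro banach_space.intro n banach_space_axioms.intro)
    show "Metric_space.mcomplete (carrier ?Y) (vdist ?Y)"
      unfolding Y.metric.mcomplete_def
    proof (intro allI impI)
      fix \<sigma> assume \<sigma>: "Y.metric.MCauchy \<sigma>"
      then have "\<And>n. \<sigma> n \<in> range e" unfolding Y.metric.MCauchy_def by auto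
      then have "\<forall>n. \<exists>a. \<sigma> n = e a" by blast
      from choice[OF this] obtain a where a: "\<And>n. \<sigma> n = e (a n)" by blast
      have "Cauchy a"
      proof (rule metric_CauchyI)
        fix r :: real assume "r > 0"
        then obtain N where "\<And>m n. N \<le> m \<Longrightarrow> N \<le> n \<Longrightarrow> vdist ?Y (\<sigma> m) (\<sigma> n) < r"
          using \<sigma> unfolding Y.metric.MCauchy_def by blast
        then show "\<exists>M. \<forall>m\<ge>M. \<forall>n\<ge>M. dist (a m) (a n) < r"
          by (intro exI[of _ N]) (auto simp: a vdist_def diff dist_norm)
      qed
      then obtain l where l: "a \<longlonglongrightarrow> l" using rc_field_Cauchy_convergent by (auto simp: convergent_def)
      have "limitin (vtopology ?Y) \<sigma> (e l) sequentially"
        using l by (subst Y.limitin_iff) (auto simp: a diff tendsto_norm_zero_iff LIM_zero_iff)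
      then show "\<exists>x. limitin (vtopology ?Y) \<sigma> x sequentially" by blast
    qed
  qed
  show "carrier ?Y \<noteq> {\<zero>\<^bsub>?Y\<^esub>}"
  proof
    assume "carrier ?Y = {\<zero>\<^bsub>?Y\<^esub>}"
    then have "e 1 \<in> {e 0}" using rangeI[of e 1] by simp
    then show False by simp
  qed
qed

theorem theorem2p3:
  fixes X :: "('k::rc_field, 'x) nspace"
    and \<Omega> :: "'t topology"
    and p :: ennreal
  assumes "banach_space X"
    and "compact_space \<Omega>" and "Hausdorff_space \<Omega>"
    and "1 \<le> p"
    and universe_a: "\<exists>e :: 'k \<Rightarrow> 'u. inj e"
    and universe_b: "\<exists>e :: 'k \<Rightarrow> 'v. inj e"
  defines "a \<equiv>
      (\<forall>Y :: ('k, 'u) nspace. banach_space Y \<longrightarrow>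
        (\<forall>S \<in> bounded_ops (scalar_cont_space \<Omega>) (op_space X Y).
          \<exists>U \<in> bounded_ops (cp_space p \<Omega> X) Y. assoc_op \<Omega> X U = S))"
    and "b \<equiv>
      (\<exists>Y :: ('k, 'v) nspace. banach_space Y \<and> carrier Y \<noteq> {\<zero>\<^bsub>Y\<^esub>} \<and>
        (\<forall>S \<in> bounded_ops (scalar_cont_space \<Omega>) (op_space X Y).
          \<exists>U \<in> bounded_ops (cp_space p \<Omega> X) Y. assoc_op \<Omega> X U = S))"
    and "c \<equiv>
      (bounded_ops (scalar_cont_space \<Omega>) (dual X) =
        summing_ops (conj_index p) (scalar_cont_space \<Omega>) (dual X))"
    and "d \<equiv>
      equivalent_norms_on (tensor_product (scalar_cont_space \<Omega>) X)
        (chevet_saphar_norm p (scalar_cont_space \<Omega>) X)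
        (proj_norm (scalar_cont_space \<Omega>) X)"
  shows "(a \<longleftrightarrow> b) \<and> (b \<longleftrightarrow> c) \<and> (c \<longleftrightarrow> d)"
proof -
  interpret banach_space X by fact
  interpret cp_setup X \<Omega> p
    using assms(2,4) by unfold_locales
  obtain e :: "'k \<Rightarrow> 'u" where e: "inj e" using universe_a by blast
  obtain e' :: "'k \<Rightarrow> 'v" where e': "inj e'" using universe_b by blast
  have a_iff: "a \<longleftrightarrow> (\<forall>Y :: ('k, 'u) nspace. banach_space Y \<longrightarrow> extension_property Y)"
    unfolding a_def extension_property_def ..
  have b_iff: "b \<longleftrightarrow> (\<exists>Y :: ('k, 'v) nspace. banach_space Y \<and> carrier Y \<noteq> {\<zero>\<^bsub>Y\<^esub>} \<and> extension_property Y)"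
    unfolding b_def extension_property_def ..
  have c_iff: "c \<longleftrightarrow> forms_chevet_saphar_bounded"
    unfolding c_def forms_chevet_saphar_bounded_def by (rule summing_eq_bounded_iff)
  \<comment> \<open>Statement (a) yields information only through a nonzero target space; the copy
    of the field is one.\<close>
  have a_c: c if a
    using that banach_space_scalar_copy[OF e] unfolding a_iff c_iff
    by (meson banach_space.axioms(1) forms_bounded_of_extension_property)
  have b_c: c if b
    using that unfolding b_iff c_iff
    by (meson banach_space.axioms(1) forms_bounded_of_extension_property)
  have c_d: d if c
    using that unfolding c_iff d_def equivalent_norms_iff by (rule proj_le_of_forms_bounded)
  \<comment> \<open>Stated for both types, since (a) and (b) range over Banach spaces on possibly
    different types.\<close>
  have d_ext: "(\<forall>Y :: ('k, 'u) nspace. banach_space Y \<longrightarrow> extension_property Y) \<and>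
      (\<forall>Y :: ('k, 'v) nspace. banach_space Y \<longrightarrow> extension_property Y)" if d
  proof -
    from that have "\<exists>C>0. \<forall>u\<in>tensor_product Z X. proj_norm Z X u \<le> C * chevet_saphar_norm p Z X u"
      unfolding d_def equivalent_norms_iff .
    then obtain C where C0: "C > 0"
      and C1: "\<forall>u\<in>tensor_product Z X. proj_norm Z X u \<le> C * chevet_saphar_norm p Z X u"
      by (elim exE conjE)
    have C: "0 \<le> C" "\<And>u. u \<in> tensor_product Z X \<Longrightarrow> proj_norm Z X u \<le> C * chevet_saphar_norm p Z X u"
      using C0 bspec[OF C1] by simp_all
    have "extension_property Y" if "banach_space Y" for Y :: "('k, 'u) nspace"
      by (rule extension_property_of_proj_le[OF that C])
    moreover have "extension_property Y" if "banach_space Y" for Y :: "('k, 'v) nspace"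
      by (rule extension_property_of_proj_le[OF that C])
    ultimately show ?thesis by blast
  qed
  then have d_a: a if d using that unfolding a_iff by blast
  \<comment> \<open>The existence in (b) again uses the copy of the field, now inside the second
    type.\<close>
  have d_b: b if d
    using d_ext[OF that] banach_space_scalar_copy[OF e'] unfolding b_iff by blast
  show ?thesis using a_c b_c c_d d_a d_b by blast
qed

end
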